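(* Let $G=C_{T_1,\dots,T_g}\in\mathcal{U}_{n,l}^g$ be obtained from the cycle $C_g=u_1\cdots u_g$ by attaching trees $T_1,\dots,T_g$ at the roots $u_1,\dots,u_g$, where $|V(T_i)|=n_i$ and the number of leaves in $T_i$ is $l_i$. Then there exist positive integers $p_1,\dots,p_g$, all equal to $1$ except at most one of them, such that $C_{B_1,\dots,B_g}\preceq C_{T_1,\dots,T_g}$, where for each $i$, $B_i$ is the tree with root $u_i$ obtained by identifying the end $u_{i,p_i}$ of the path $P_{p_i}=u_iu_{i,2}\cdots u_{i,p_i}$ (of order $p_i$; for $p_i=1$ this is just $u_i$) with the center of $BST_{n_i-p_i+1,l_i}$. Moreover, equality $C_{B_1,\dots,B_g}= C_{T_1,\dots,T_g}$ in the Laplacian coefficients (i.e. $c_k$ equal for all $k$) holds if and only if $C_{B_1,\dots,B_g}\cong C_{T_1,\dots,T_g}$.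
   Context: For a graph $G$ on $n$ vertices with Laplacian matrix $L(G)=D(G)-A(G)$, write $\det(\lambda I_n-L(G))=\sum_{k=0}^n(-1)^k c_k(G)\lambda^{n-k}$. For graphs $G,H$ of order $n$, $G\preceq H$ means $c_k(G)\le c_k(H)$ for all $0\le k\le n$. A leaf is a vertex of degree $1$ (here leaves of $T_i$ refer to the pendent vertices of the unicyclic graph lying in $T_i$). $\mathcal{U}_{n,l}^g$ is the set of connected unicyclic graphs with $n$ vertices, exactly $l$ leaves and girth $g$; $C_{T_1,\dots,T_g}$ denotes the graph obtained from the cycle $C_g=u_1\cdots u_g$ by attaching trees $T_1,\dots,T_g$ rooted at $u_1,\dots,u_g$. The balanced starlike tree $BST_{m,l}$ is the tree of order $m$ with $l$ leaves obtained by identifying one end of each of $l$ paths, each of order $\lfloor\frac{m-1}{l}\rfloor+1$ or $\lceil\frac{m-1}{l}\rceil+1$, into a single vertex, its center (with $BST_{1,0}$ a single vertex). *)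

theory Defs
  imports "Graph_Theory.Graph_Theory" "Jordan_Normal_Form.Char_Poly"
begin

text \<open>A finite simple graph is a \<^locale>\<open>pair_graph\<close>, i.e. a finite, symmetric,
  loop-free set of arcs; every undirected edge is a pair of opposite arcs, so that
  \<^const>\<open>out_degree\<close> is the degree of a vertex.\<close>

subsection \<open>Trees, unicyclic graphs, leaves and girth\<close>

text \<open>A cycle of an undirected graph, recorded as its set of undirected edges.
  In a symmetric digraph a single edge traversed back and forth is a
  \<^const>\<open>pre_digraph.cycle\<close>, so the bound on the length is needed. For the same reason
  \<^const>\<open>Digraph_Component.tree\<close> cannot be used here: it fails for every symmetric digraph
  with at least one arc.\<close>

definition cycles_of :: "'a pair_pre_digraph \<Rightarrow> 'a set set set" where
  "cycles_of G = {(\<lambda>(x, y). {x, y}) ` set p | p. pre_digraph.cycle (with_proj G) p \<and> length p \<ge> 3}"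

definition is_tree :: "'a pair_pre_digraph \<Rightarrow> bool" where
  "is_tree G \<longleftrightarrow> pair_graph G \<and> Digraph_Component.connected (with_proj G) \<and> cycles_of G = {}"

definition unicyclic :: "'a pair_pre_digraph \<Rightarrow> bool" where
  "unicyclic G \<longleftrightarrow> (\<exists>!C. C \<in> cycles_of G)"

definition girth :: "'a pair_pre_digraph \<Rightarrow> nat" where
  "girth G = Inf (card ` cycles_of G)"

definition leaves :: "'a pair_pre_digraph \<Rightarrow> 'a set" where
  "leaves G = {v \<in> pverts G. out_degree (with_proj G) v = 1}"

definition unicyclic_graphs :: "nat \<Rightarrow> nat \<Rightarrow> nat \<Rightarrow> 'a pair_pre_digraph set" where
  "unicyclic_graphs n l g = {G. pair_graph G \<and> Digraph_Component.connected (with_proj G) \<and>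
     unicyclic G \<and> card (pverts G) = n \<and> card (leaves G) = l \<and> girth G = g}"

subsection \<open>Laplacian coefficients\<close>

definition degree_mat :: "'a pair_pre_digraph \<Rightarrow> 'a list \<Rightarrow> real mat" where
  "degree_mat G vs = mat (length vs) (length vs)
     (\<lambda>(i, j). if i = j then real (out_degree (with_proj G) (vs ! i)) else 0)"

definition adjacency_mat :: "'a pair_pre_digraph \<Rightarrow> 'a list \<Rightarrow> real mat" where
  "adjacency_mat G vs = mat (length vs) (length vs)
     (\<lambda>(i, j). if (vs ! i, vs ! j) \<in> parcs G then 1 else 0)"

definition laplacian_wrt :: "'a pair_pre_digraph \<Rightarrow> 'a list \<Rightarrow> real mat" where
  "laplacian_wrt G vs = degree_mat G vs - adjacency_mat G vs"

text \<open>The order in which the vertices are listed is irrelevant for the characteristic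
  polynomial, see \<open>char_poly_laplacian\<close> below.\<close>

definition laplacian :: "'a pair_pre_digraph \<Rightarrow> real mat" where
  "laplacian G = laplacian_wrt G (SOME vs. distinct vs \<and> set vs = pverts G)"

text \<open>Meaningful for \<open>k \<le> n\<close>, where \<open>n\<close> is the order of the graph; see \<open>char_poly_laplacian_sum\<close>.\<close>

definition lap_coeff :: "'a pair_pre_digraph \<Rightarrow> nat \<Rightarrow> real" where
  "lap_coeff G k = (-1) ^ k * coeff (char_poly (laplacian G)) (card (pverts G) - k)"

definition lap_le :: "'a pair_pre_digraph \<Rightarrow> 'b pair_pre_digraph \<Rightarrow> bool" (infix \<open>\<preceq>\<^sub>L\<close> 50) where
  "G \<preceq>\<^sub>L H \<longleftrightarrow> card (pverts G) = card (pverts H) \<and>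
     (\<forall>k \<le> card (pverts G). lap_coeff G k \<le> lap_coeff H k)"

definition lap_eq :: "'a pair_pre_digraph \<Rightarrow> 'b pair_pre_digraph \<Rightarrow> bool" (infix \<open>\<approx>\<^sub>L\<close> 50) where
  "G \<approx>\<^sub>L H \<longleftrightarrow> card (pverts G) = card (pverts H) \<and>
     (\<forall>k \<le> card (pverts G). lap_coeff G k = lap_coeff H k)"

lemma laplacian_wrt_index:
  assumes "i < length vs" "j < length vs"
  shows "laplacian_wrt G vs $$ (i, j) =
    (if i = j then real (out_degree (with_proj G) (vs ! i)) else 0)
    - (if (vs ! i, vs ! j) \<in> parcs G then 1 else 0)"
  using assms by (simp add: laplacian_wrt_def degree_mat_def adjacency_mat_def)

lemma laplacian_wrt_carrier: "laplacian_wrt G vs \<in> carrier_mat (length vs) (length vs)"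
  unfolding laplacian_wrt_def degree_mat_def adjacency_mat_def
  by (intro minus_carrier_mat mat_carrier)

lemma char_poly_laplacian_wrt:
  assumes vs: "distinct vs" and ws: "distinct ws" and eq: "set vs = set ws"
  shows "char_poly (laplacian_wrt G vs) = char_poly (laplacian_wrt G ws)"
proof -
  define n where "n = length vs"
  have n': "length ws = n"
    using vs ws eq unfolding n_def by (metis distinct_card)
  have "\<exists>j<n. vs ! j = ws ! i" if "i < n" for i
  proof -
    have "ws ! i \<in> set vs" using that n' eq by simp
    then show ?thesis unfolding n_def in_set_conv_nth by blast
  qed
  then obtain f where f: "f i < n" "vs ! f i = ws ! i" if "i < n" for i by metis
  have inj: "f i = f j \<longleftrightarrow> i = j" if "i < n" "j < n" for i j
    using that f ws n' by (metis nth_eq_iff_index_eq)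
  have surj: "f ` {0..<n} = {0..<n}"
  proof (rule endo_inj_surj)
    show "f ` {0..<n} \<subseteq> {0..<n}" using f by auto
    show "inj_on f {0..<n}" using inj by (auto simp: inj_on_def)
  qed simp
  define P where "P = mat n n (\<lambda>(i, j). if j = f i then 1 else (0::real))"
  define Q where "Q = mat n n (\<lambda>(i, j). if i = f j then 1 else (0::real))"
  have P: "P \<in> carrier_mat n n" and Q: "Q \<in> carrier_mat n n"
    by (auto simp: P_def Q_def)
  let ?A = "laplacian_wrt G vs" and ?B = "laplacian_wrt G ws"
  have A: "?A \<in> carrier_mat n n" and B: "?B \<in> carrier_mat n n"
    using laplacian_wrt_carrier[of G vs] laplacian_wrt_carrier[of G ws] n' n_def by auto
  have PM: "(P * M) $$ (i, j) = M $$ (f i, j)" if "M \<in> carrier_mat n n" "i < n" "j < n" for M i j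
    using that f by (simp add: P_def scalar_prod_def if_distrib[of "\<lambda>x. x * _"] sum.delta cong: if_cong)
  have MQ: "(M * Q) $$ (i, j) = M $$ (i, f j)" if "M \<in> carrier_mat n n" "i < n" "j < n" for M i j
    using that f by (simp add: Q_def scalar_prod_def if_distrib[of "\<lambda>x. _ * x"] sum.delta cong: if_cong)
  have PQ: "P * Q = 1\<^sub>m n"
  proof (rule eq_matI)
    fix i j assume "i < dim_row (1\<^sub>m n :: real mat)" "j < dim_col (1\<^sub>m n :: real mat)"
    then have ij: "i < n" "j < n" by auto
    have "(P * Q) $$ (i, j) = Q $$ (f i, j)"
      by (rule PM[OF Q ij])
    also have "\<dots> = (1\<^sub>m n :: real mat) $$ (i, j)"
      using ij f inj by (simp add: Q_def)
    finally show "(P * Q) $$ (i, j) = (1\<^sub>m n :: real mat) $$ (i, j)" .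
  qed (use P Q in auto)
  have QP: "Q * P = 1\<^sub>m n"
    using mat_mult_left_right_inverse[OF P Q PQ] .
  have "?B = P * ?A * Q"
  proof (rule eq_matI)
    fix i j assume "i < dim_row (P * ?A * Q)" "j < dim_col (P * ?A * Q)"
    then have ij: "i < n" "j < n" using P Q by auto
    have "P * ?A \<in> carrier_mat n n" using P A by simp
    then have "(P * ?A * Q) $$ (i, j) = (P * ?A) $$ (i, f j)" using ij by (rule MQ)
    also have "\<dots> = ?A $$ (f i, f j)" using A ij f by (intro PM) auto
    also have "\<dots> = ?B $$ (i, j)"
      using ij f inj n' by (simp add: laplacian_wrt_index n_def[symmetric])
    finally show "?B $$ (i, j) = (P * ?A * Q) $$ (i, j)" ..
  qed (use P Q A B in auto)
  moreover have "{?B, ?A, P, Q} \<subseteq> carrier_mat n n" using P Q A B by simp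
  ultimately have "similar_mat ?B ?A" using PQ QP by (intro similar_matI)
  from char_poly_similar[OF this] show ?thesis ..
qed

lemma char_poly_laplacian:
  assumes "distinct vs" "set vs = pverts G"
  shows "char_poly (laplacian G) = char_poly (laplacian_wrt G vs)"
proof -
  have "distinct (SOME vs. distinct vs \<and> set vs = pverts G) \<and>
      set (SOME vs. distinct vs \<and> set vs = pverts G) = pverts G"
    by (rule someI[of "\<lambda>vs. distinct vs \<and> set vs = pverts G" vs]) (use assms in simp)
  then show ?thesis
    unfolding laplacian_def using assms by (intro char_poly_laplacian_wrt) auto
qed

lemma char_poly_laplacian_sum:
  assumes "finite (pverts G)"
  shows "char_poly (laplacian G) =
    (\<Sum>k\<le>card (pverts G). monom ((-1) ^ k * lap_coeff G k) (card (pverts G) - k))"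
proof -
  let ?n = "card (pverts G)" and ?c = "char_poly (laplacian G)"
  obtain vs where vs: "distinct vs" "set vs = pverts G"
    using finite_distinct_list[OF assms] by blast
  have len: "length vs = ?n" using vs by (metis distinct_card)
  have deg: "degree ?c \<le> ?n"
    using degree_monic_char_poly[OF laplacian_wrt_carrier[of G vs]] len
      char_poly_laplacian[OF vs] by simp
  have "?c = (\<Sum>k\<le>?n. monom (coeff ?c k) k)"
    using poly_as_sum_of_monoms'[OF deg] by simp
  also have "\<dots> = (\<Sum>k\<le>?n. monom (coeff ?c (?n - k)) (?n - k))"
    by (rule sum.reindex_bij_witness[of _ "\<lambda>k. ?n - k" "\<lambda>k. ?n - k"]) auto
  also have "\<dots> = (\<Sum>k\<le>?n. monom ((-1) ^ k * lap_coeff G k) (?n - k))"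
    by (simp add: lap_coeff_def mult.assoc[symmetric] power_mult_distrib[symmetric])
  finally show ?thesis .
qed

subsection \<open>The graphs of the theorem\<close>

definition path_graph :: "nat \<Rightarrow> nat pair_pre_digraph" where
  "path_graph n = \<lparr> pverts = {..<n},
     parcs = {(i, j). i < n \<and> j < n \<and> (j = Suc i \<or> i = Suc j)} \<rparr>"

definition disj_union :: "'i set \<Rightarrow> ('i \<Rightarrow> 'a pair_pre_digraph) \<Rightarrow> ('i \<times> 'a) pair_pre_digraph" where
  "disj_union I G = \<lparr> pverts = (SIGMA i:I. pverts (G i)),
     parcs = {((i, x), (i, y)) | i x y. i \<in> I \<and> (x, y) \<in> parcs (G i)} \<rparr>"

text \<open>The graph \<open>C\<^bsub>T\<^sub>0,\<dots>,T\<^bsub>g-1\<^esub>\<^esub>\<close>, with cycle vertices \<open>(0, u 0), \<dots>, (g - 1, u (g - 1))\<close>; for \<open>g \<ge> 3\<close>.\<close>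

definition cycle_attach ::
  "nat \<Rightarrow> (nat \<Rightarrow> 'a pair_pre_digraph) \<Rightarrow> (nat \<Rightarrow> 'a) \<Rightarrow> (nat \<times> 'a) pair_pre_digraph" where
  "cycle_attach g T u = \<lparr> pverts = pverts (disj_union {..<g} T),
     parcs = parcs (disj_union {..<g} T) \<union>
       {((i, u i), (j, u j)) | i j. i < g \<and> j < g \<and> (j = Suc i mod g \<or> i = Suc j mod g)} \<rparr>"

text \<open>The paths of orders \<open>a 0, \<dots>, a (l - 1)\<close> with their ends \<open>(j, 0)\<close> all identified with
  the centre \<open>(0, 0)\<close>. The centre is inserted explicitly for the case \<open>l = 0\<close>.\<close>

definition starlike :: "nat \<Rightarrow> (nat \<Rightarrow> nat) \<Rightarrow> (nat \<times> nat) pair_pre_digraph" where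
  "starlike l a = (let D = disj_union {..<l} (\<lambda>j. path_graph (a j));
                       f = (\<lambda>(j, k). if k = 0 then (0, 0) else (j, k))
     in \<lparr> pverts = insert (0, 0) (f ` pverts D), parcs = map_prod f f ` parcs D \<rparr>)"

definition star_center :: "nat \<times> nat" where
  "star_center = (0, 0)"

text \<open>If \<open>(m - 1) mod l = r\<close>, then \<open>r\<close> of the paths must get the larger of the two orders
  to reach \<open>m\<close> vertices in total; see \<open>card_BST\<close>.\<close>

definition BST :: "nat \<Rightarrow> nat \<Rightarrow> (nat \<times> nat) pair_pre_digraph" where
  "BST m l = starlike l (\<lambda>j. if j < (m - 1) mod l then nat \<lceil>real (m - 1) / real l\<rceil> + 1
                                                 else nat \<lfloor>real (m - 1) / real l\<rfloor> + 1)"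

text \<open>The parameters for which there is a balanced starlike tree of order \<open>m\<close> with \<open>l\<close> leaves
  (each of the \<open>l\<close> paths must contain a vertex other than the centre).\<close>

definition BST_params :: "nat \<Rightarrow> nat \<Rightarrow> bool" where
  "BST_params m l \<longleftrightarrow> (l = 0 \<and> m = 1) \<or> (1 \<le> l \<and> l + 1 \<le> m)"

lemma nat_floor_of_nat_divide: "nat \<lfloor>real a / real b\<rfloor> = a div b"
  by (simp add: floor_divide_of_nat_eq)

lemma nat_ceiling_of_nat_divide:
  assumes "b > 0" "a mod b > 0"
  shows "nat \<lceil>real a / real b\<rceil> = a div b + 1"
proof -
  have "real a = real (a div b) * real b + real (a mod b)"
    by (metis div_mult_mod_eq of_nat_add of_nat_mult)
  then have 1: "real a / real b = real (a div b) + real (a mod b) / real b"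
    using assms by (simp add: field_simps)
  have "0 < real (a mod b) / real b" "real (a mod b) / real b < 1" using assms by auto
  then have "\<lceil>real a / real b\<rceil> = int (a div b) + 1" unfolding 1 by linarith
  then show ?thesis by simp
qed

lemma card_starlike:
  assumes "\<And>j. j < l \<Longrightarrow> 1 \<le> a j"
  shows "card (pverts (starlike l a)) = 1 + (\<Sum>j<l. a j - 1)"
proof -
  let ?f = "\<lambda>(j, k). if k = (0::nat) then (0, 0) else (j, k)"
  have "pverts (starlike l a) = insert (0, 0) (?f ` (SIGMA j:{..<l}. {..<a j}))"
    by (simp add: starlike_def disj_union_def path_graph_def Let_def)
  also have "\<dots> = insert (0, 0) (SIGMA j:{..<l}. {1..<a j})"
  proof (intro equalityI subsetI)
    fix x assume "x \<in> insert (0, 0) (?f ` (SIGMA j:{..<l}. {..<a j}))"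
    then show "x \<in> insert (0, 0) (SIGMA j:{..<l}. {1..<a j})"
      by (auto split: if_splits)
  next
    fix x assume "x \<in> insert (0, 0) (SIGMA j:{..<l}. {1..<a j})"
    then show "x \<in> insert (0, 0) (?f ` (SIGMA j:{..<l}. {..<a j}))"
      by (cases x) (auto intro!: image_eqI[of _ _ x])
  qed
  finally show ?thesis by simp
qed

lemma card_BST:
  assumes "BST_params m l"
  shows "card (pverts (BST m l)) = m"
proof (cases "l = 0")
  case True
  then show ?thesis using assms by (simp add: BST_def BST_params_def card_starlike)
next
  case False
  then have l: "0 < l" and m: "l + 1 \<le> m" using assms by (auto simp: BST_params_def)
  let ?q = "(m - 1) div l" and ?r = "(m - 1) mod l"
  have "card (pverts (BST m l)) = 1 + (\<Sum>j<l. if j < ?r then ?q + 1 else ?q)"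
    unfolding BST_def by (subst card_starlike) (auto simp: nat_floor_of_nat_divide nat_ceiling_of_nat_divide l intro!: sum.cong)
  also have "(\<Sum>j<l. if j < ?r then ?q + 1 else ?q) = (\<Sum>j<l. ?q + (if j < ?r then 1 else 0))"
    by (rule sum.cong) auto
  also have "\<dots> = l * ?q + card {j. j < l \<and> j < ?r}"
    by (simp add: sum.distrib sum.If_cases Int_def)
  also have "{j. j < l \<and> j < ?r} = {..<?r}"
    using mod_less_divisor[OF l, of "m - 1"] by auto
  finally show ?thesis using m by simp
qed

text \<open>Disjoint copies of \<open>G\<close> and \<open>H\<close> with the vertex \<open>x\<close> of \<open>G\<close> and the vertex \<open>y\<close> of \<open>H\<close>
  identified (as \<open>Inl x\<close>).\<close>

definition identify ::
  "'a pair_pre_digraph \<Rightarrow> 'a \<Rightarrow> 'b pair_pre_digraph \<Rightarrow> 'b \<Rightarrow> ('a + 'b) pair_pre_digraph" where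
  "identify G x H y = (let f = (\<lambda>w. if w = y then Inl x else Inr w)
     in \<lparr> pverts = Inl ` pverts G \<union> f ` pverts H,
          parcs = map_prod Inl Inl ` parcs G \<union> map_prod f f ` parcs H \<rparr>)"

text \<open>The tree \<open>B\<^sub>i\<close> for \<open>n = n\<^sub>i\<close>, \<open>l = l\<^sub>i\<close>, \<open>p = p\<^sub>i\<close>: the path has vertices \<open>0, \<dots>, p - 1\<close>, and its
  vertex \<open>0\<close> is the root.\<close>

definition path_BST :: "nat \<Rightarrow> nat \<Rightarrow> nat \<Rightarrow> (nat + nat \<times> nat) pair_pre_digraph" where
  "path_BST n l p = identify (path_graph p) (p - 1) (BST (n - p + 1) l) star_center"

definition path_BST_root :: "nat + nat \<times> nat" where
  "path_BST_root = Inl 0"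

end

theory Submission
  imports Defs
begin

text \<open>
  Gluing a rooted tree \<open>t\<close> into a graph affects the Laplacian polynomial only through the pair
  \<open>(a, b)\<close> of \<open>det (x I + L(t))\<close> and its minor without the root, and the polynomial depends
  linearly on this pair. Suppose that a pendant path \<open>Z\<close> hangs at a vertex \<open>w\<close>, and that \<open>v\<close> is
  another neighbour of \<open>w\<close>. Moving everything else at \<open>w\<close> over to \<open>v\<close> keeps the number of leaves,
  and it decreases the polynomial by a multiple of \<open>b\<^sub>W a\<^sub>Y - a\<^sub>W b\<^sub>Y\<close>, where \<open>W\<close> is the path \<open>Z\<close>
  together with \<open>w\<close>, rooted at \<open>w\<close>, and \<open>Y\<close> is the part of the graph behind \<open>v\<close>. This difference
  has nonnegative coefficients as soon as \<open>Y\<close> contains a path from \<open>v\<close> with as many edges as \<open>W\<close>,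
  also if that path runs along the cycle into another tree.

  Applied to a shortest pendant path, such moves strictly decrease the coefficients until every
  tree is a path followed by a balanced bunch of paths, and at most one tree has a nontrivial
  initial path: of two such trees, the one with the shorter leg could still be improved.
\<close>

section \<open>Polynomials with nonnegative coefficients\<close>

definition nonneg_coeffs :: "real poly \<Rightarrow> bool" where
  "nonneg_coeffs p \<longleftrightarrow> (\<forall>i. 0 \<le> coeff p i)"

definition pos_coeffs :: "real poly \<Rightarrow> bool" where
  "pos_coeffs p \<longleftrightarrow> nonneg_coeffs p \<and> p \<noteq> 0"

lemma nonneg_coeffs_0 [simp]: "nonneg_coeffs 0"
  and nonneg_coeffs_1 [simp]: "nonneg_coeffs 1"
  by (auto simp: nonneg_coeffs_def coeff_1)

lemma nonneg_coeffs_add: "nonneg_coeffs p \<Longrightarrow> nonneg_coeffs q \<Longrightarrow> nonneg_coeffs (p + q)"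
  by (auto simp: nonneg_coeffs_def)

lemma nonneg_coeffs_mult: "nonneg_coeffs p \<Longrightarrow> nonneg_coeffs q \<Longrightarrow> nonneg_coeffs (p * q)"
  by (auto simp: nonneg_coeffs_def coeff_mult intro!: sum_nonneg)

lemma nonneg_coeffs_numeral [simp]: "nonneg_coeffs (numeral n)"
  by (simp add: nonneg_coeffs_def numeral_poly coeff_pCons split: nat.split)

lemma pos_coeffs_1 [simp]: "pos_coeffs 1"
  by (auto simp: pos_coeffs_def)

lemma pos_coeffs_numeral [simp]: "pos_coeffs (numeral n)"
  by (auto simp: pos_coeffs_def)

lemma pos_coeffs_imp_nonneg: "pos_coeffs p \<Longrightarrow> nonneg_coeffs p"
  by (simp add: pos_coeffs_def)

lemma pos_coeffs_mult: "pos_coeffs p \<Longrightarrow> pos_coeffs q \<Longrightarrow> pos_coeffs (p * q)"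
  by (auto simp: pos_coeffs_def nonneg_coeffs_mult)

lemma pos_coeffs_add: "pos_coeffs p \<Longrightarrow> nonneg_coeffs q \<Longrightarrow> pos_coeffs (p + q)"
proof -
  assume p: "pos_coeffs p" and q: "nonneg_coeffs q"
  then obtain i where "coeff p i \<noteq> 0" by (auto simp: pos_coeffs_def poly_eq_iff)
  with p have "coeff p i > 0" by (auto simp: pos_coeffs_def nonneg_coeffs_def less_le)
  with q have "coeff (p + q) i > 0" by (auto simp: nonneg_coeffs_def intro: add_pos_nonneg)
  then have "p + q \<noteq> 0" by (metis coeff_0 less_irrefl)
  then show ?thesis using p q by (auto simp: pos_coeffs_def nonneg_coeffs_add)
qed

lemma pos_coeffs_add': "nonneg_coeffs p \<Longrightarrow> pos_coeffs q \<Longrightarrow> pos_coeffs (p + q)"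
  using pos_coeffs_add[of q p] by (simp add: add.commute)

lemma poly_pos_coeffs:
  assumes "pos_coeffs p" "x > 0"
  shows "poly p x > 0"
proof -
  obtain i where i: "coeff p i \<noteq> 0" using assms by (auto simp: pos_coeffs_def poly_eq_iff)
  then have "i \<le> degree p" by (rule le_degree)
  moreover have "coeff p i > 0"
    using assms(1) i by (auto simp: pos_coeffs_def nonneg_coeffs_def less_le)
  ultimately show ?thesis
    unfolding poly_altdef using assms
    by (intro sum_pos2[of _ i]) (auto simp: pos_coeffs_def nonneg_coeffs_def)
qed

text \<open>The variable is kept opaque, so that the simplifier does not turn products with it
  into \<^const>\<open>pCons\<close>.\<close>

definition X :: "real poly" where
  "X = [:0, 1:]"

lemma pos_coeffs_X [simp]: "pos_coeffs X"
  by (auto simp: X_def pos_coeffs_def nonneg_coeffs_def coeff_pCons split: nat.split)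

lemma poly_X [simp]: "poly X x = x"
  by (simp add: X_def)

lemmas coeffs_intros = nonneg_coeffs_add nonneg_coeffs_mult pos_coeffs_mult

section \<open>Weights of rooted trees\<close>

datatype rtree = Node "rtree list"

text \<open>The weight of a rooted tree is the pair of \<open>det (x I + L)\<close> and of its principal minor
  without the root. Only these two polynomials matter for the Laplacian polynomial of a graph
  into which the tree is glued at its root.\<close>

type_synonym weight = "real poly \<times> real poly"

fun attach :: "weight \<Rightarrow> weight \<Rightarrow> weight" where
  "attach (a, b) (c, d) = (a * (c + d) + b * c, b * (c + d))"

fun weight :: "rtree \<Rightarrow> weight" where
  "weight (Node ts) = fold (\<lambda>t w. attach w (weight t)) ts (X, 1)"

definition attaches :: "weight \<Rightarrow> rtree list \<Rightarrow> weight" where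
  "attaches w ts = fold (\<lambda>t w. attach w (weight t)) ts w"

lemma attaches_simps [simp]:
  "attaches w [] = w"
  "attaches w (t # ts) = attaches (attach w (weight t)) ts"
  "attaches w (ts @ us) = attaches (attaches w ts) us"
  by (simp_all add: attaches_def)

lemma weight_Node: "weight (Node ts) = attaches (X, 1) ts"
  by (simp add: attaches_def)

declare weight.simps [simp del]

lemma weight_Node_simps [simp]:
  "weight (Node []) = (X, 1)"
  "weight (Node [t]) = attach (X, 1) (weight t)"
  by (simp_all add: weight_Node)

lemma attach_commute: "attach (attach w u) v = attach (attach w v) u"
  by (cases w; cases u; cases v) (auto simp: algebra_simps)

lemma attaches_attach: "attaches (attach w u) ts = attach (attaches w ts) u"
  by (induction ts arbitrary: w) (simp, metis attach_commute attaches_simps(2))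

lemma attaches_mset: "mset ts = mset us \<Longrightarrow> attaches w ts = attaches w us"
  unfolding attaches_def
  by (rule fold_permuted_eq) (auto simp: attach_commute)

lemma weight_Node_mset: "mset ts = mset us \<Longrightarrow> weight (Node ts) = weight (Node us)"
  unfolding weight_Node by (rule attaches_mset)

text \<open>Two graphs joined by an edge between their roots have the determinant
  \<^term>\<open>fst (attach v w)\<close>, which is symmetric in the two.\<close>

lemma fst_attach_Node:
  "fst (attach v (weight (Node ts))) = fst (attaches (attach (X, 1) v) ts)"
proof -
  have "fst (attach v (attaches u ts)) = fst (attaches (attach u v) ts)" for u
  proof (induction ts arbitrary: u)
    case Nil
    then show ?case by (cases u; cases v) (simp add: algebra_simps)
  qed (simp add: attach_commute)
  then show ?thesis by (simp add: weight_Node)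
qed

text \<open>The difference \<open>a - x b\<close> is the weight of the forests that connect the root to the
  ground; a rooted graph is good if it has more than one vertex.\<close>

definition ok_weight :: "weight \<Rightarrow> bool" where
  "ok_weight w \<longleftrightarrow> pos_coeffs (snd w) \<and> nonneg_coeffs (fst w - X * snd w)"

definition good_weight :: "weight \<Rightarrow> bool" where
  "good_weight w \<longleftrightarrow> pos_coeffs (snd w) \<and> pos_coeffs (fst w - X * snd w)"

lemma good_imp_ok: "good_weight w \<Longrightarrow> ok_weight w"
  by (auto simp: good_weight_def ok_weight_def pos_coeffs_def)

lemma ok_weight_fst:
  assumes "ok_weight w"
  shows "pos_coeffs (fst w)"
proof -
  have "pos_coeffs (X * snd w + (fst w - X * snd w))"
    using assms by (intro pos_coeffs_add pos_coeffs_mult) (auto simp: ok_weight_def)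
  then show ?thesis by simp
qed

lemma ok_weight_single [simp]: "ok_weight (X, 1)"
  by (simp add: ok_weight_def)

lemma good_attach:
  assumes "ok_weight v" "ok_weight w"
  shows "good_weight (attach v w)"
proof -
  obtain a b c d where vw: "v = (a, b)" "w = (c, d)" by (metis surj_pair)
  have c: "pos_coeffs c" using ok_weight_fst[OF assms(2)] vw by simp
  have b: "pos_coeffs b" and d: "pos_coeffs d" and a: "nonneg_coeffs (a - X * b)"
    using assms by (auto simp: ok_weight_def vw)
  have "a * (c + d) + b * c - X * (b * (c + d)) = b * c + (a - X * b) * (c + d)"
    by (simp only: algebra_simps)
  then have "pos_coeffs (a * (c + d) + b * c - X * (b * (c + d)))"
    unfolding \<open>_ = b * c + _\<close>
    by (intro pos_coeffs_add coeffs_intros) (use a b c d in \<open>auto simp: pos_coeffs_imp_nonneg\<close>)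
  moreover have "pos_coeffs (b * (c + d))"
    by (intro pos_coeffs_add coeffs_intros) (use b c d in \<open>auto simp: pos_coeffs_imp_nonneg\<close>)
  ultimately show ?thesis unfolding vw good_weight_def by simp
qed

lemma ok_attaches:
  assumes "ok_weight w" "\<And>t. t \<in> set ts \<Longrightarrow> ok_weight (weight t)"
  shows "ok_weight (attaches w ts)"
  using assms
proof (induction ts arbitrary: w)
  case (Cons t ts)
  then show ?case using good_imp_ok[OF good_attach[of w "weight t"]] by simp
qed simp

lemma ok_weight_tree [simp]: "ok_weight (weight t)"
  by (induction t) (auto simp: weight_Node intro!: ok_attaches)

lemma good_attaches:
  "good_weight w \<Longrightarrow> good_weight (attaches w ts)"
proof (induction ts arbitrary: w)
  case (Cons t ts)
  then show ?case using good_attach[of w "weight t"] by (simp add: good_imp_ok)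
qed simp

lemma good_weight_Node: "ts \<noteq> [] \<Longrightarrow> good_weight (weight (Node ts))"
  by (cases ts) (auto simp: weight_Node intro!: good_attaches good_attach)

lemma pos_coeffs_tree [simp]: "pos_coeffs (fst (weight t))" "pos_coeffs (snd (weight t))"
  using ok_weight_tree[of t] ok_weight_fst[of "weight t"] by (auto simp: ok_weight_def)

section \<open>Comparison with paths\<close>

definition wdiff :: "weight \<Rightarrow> weight \<Rightarrow> real poly" where
  "wdiff v w = snd v * fst w - fst v * snd w"

fun path_tree :: "nat \<Rightarrow> rtree" where
  "path_tree 0 = Node []"
| "path_tree (Suc n) = Node [path_tree n]"

lemma weight_path_tree [simp]:
  "weight (path_tree 0) = (X, 1)"
  "weight (path_tree (Suc n)) = attach (X, 1) (weight (path_tree n))"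
  by (simp_all add: weight_Node)

fun tall :: "nat \<Rightarrow> rtree \<Rightarrow> bool" where
  "tall 0 t \<longleftrightarrow> True"
| "tall (Suc n) (Node ts) \<longleftrightarrow> (\<exists>t\<in>set ts. tall n t)"

lemma tall_mono: "tall n t \<Longrightarrow> m \<le> n \<Longrightarrow> tall m t"
proof (induction n arbitrary: t m)
  case (Suc n)
  obtain ts where t: "t = Node ts" by (cases t)
  show ?case
  proof (cases m)
    case (Suc k)
    then show ?thesis using Suc.prems Suc.IH t by fastforce
  qed simp
qed simp

lemma wdiff_attach_child:
  "wdiff (attach (X, 1) v) (attach z y)
    = snd z * wdiff v y + (fst v + snd v) * (fst y + snd y) * (fst z - X * snd z)"
  by (cases v; cases y; cases z) (simp add: wdiff_def algebra_simps)

lemma wdiff_attach_root: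
  "wdiff v (attach y z) = (fst z + snd z) * wdiff v y + snd v * snd y * fst z"
  by (cases v; cases y; cases z) (simp add: wdiff_def algebra_simps)

definition exceeds_path :: "nat \<Rightarrow> weight \<Rightarrow> bool" where
  "exceeds_path n y \<longleftrightarrow> (\<forall>m\<le>n. pos_coeffs (wdiff (weight (path_tree m)) y))"

lemma exceeds_path_mono: "exceeds_path n y \<Longrightarrow> m \<le> n \<Longrightarrow> exceeds_path m y"
  by (auto simp: exceeds_path_def)

lemma wdiff_single: "wdiff (X, 1) y = fst y - X * snd y"
  by (simp add: wdiff_def)

lemma exceeds_path_attach_child:
  assumes "good_weight z" "ok_weight y"
    and "\<And>m. m \<le> n \<Longrightarrow> nonneg_coeffs (wdiff (weight (path_tree m)) y)"
  shows "exceeds_path (Suc n) (attach z y)"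
  unfolding exceeds_path_def
proof (intro allI impI)
  fix m assume m: "m \<le> Suc n"
  show "pos_coeffs (wdiff (weight (path_tree m)) (attach z y))"
  proof (cases m)
    case 0
    then show ?thesis using good_attach[of z y] assms
      by (simp add: wdiff_single good_weight_def good_imp_ok)
  next
    case (Suc k)
    have "nonneg_coeffs (wdiff (weight (path_tree k)) y)" using m Suc assms by auto
    then show ?thesis
      using assms ok_weight_fst[of y] unfolding Suc weight_path_tree wdiff_attach_child
      by (intro pos_coeffs_add' pos_coeffs_mult nonneg_coeffs_mult pos_coeffs_add)
        (auto simp: good_weight_def ok_weight_def pos_coeffs_imp_nonneg)
  qed
qed

lemma exceeds_path_attach_child':
  assumes "exceeds_path n y" "ok_weight y"
  shows "exceeds_path (Suc n) (attach (X, 1) y)"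
  unfolding exceeds_path_def
proof (intro allI impI)
  fix m assume m: "m \<le> Suc n"
  show "pos_coeffs (wdiff (weight (path_tree m)) (attach (X, 1) y))"
  proof (cases m)
    case 0
    then show ?thesis using good_attach[of "(X, 1)" y] assms
      by (simp add: wdiff_single good_weight_def)
  next
    case (Suc k)
    then show ?thesis
      using assms m unfolding Suc weight_path_tree wdiff_attach_child by (simp add: exceeds_path_def)
  qed
qed

lemma exceeds_path_attach_root:
  assumes "exceeds_path n y" "ok_weight y" "ok_weight z"
  shows "exceeds_path n (attach y z)"
  using assms ok_weight_fst[of z] unfolding exceeds_path_def wdiff_attach_root
  by (auto intro!: pos_coeffs_add coeffs_intros simp: ok_weight_def pos_coeffs_imp_nonneg)

lemma exceeds_path_attaches:
  assumes "exceeds_path n y" "ok_weight y"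
  shows "exceeds_path n (attaches y ts)"
  using assms
proof (induction ts arbitrary: y)
  case (Cons t ts)
  then show ?case
    using good_imp_ok[OF good_attach[of y "weight t"]] exceeds_path_attach_root[of n y "weight t"] by simp
qed simp

lemma wdiff_path_tree:
  "tall n t \<Longrightarrow> nonneg_coeffs (wdiff (weight (path_tree n)) (weight t))
     \<and> (t \<noteq> path_tree n \<longrightarrow> wdiff (weight (path_tree n)) (weight t) \<noteq> 0)"
proof (induction n arbitrary: t)
  case 0
  obtain ts where t: "t = Node ts" by (cases t)
  show ?case
  proof (cases "ts = []")
    case False
    then show ?thesis using good_weight_Node[of ts]
      by (simp add: t wdiff_single good_weight_def pos_coeffs_def)
  qed (simp add: t wdiff_single)
next
  case (Suc n)
  obtain ts where t: "t = Node ts" by (cases t)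
  then obtain s where s: "s \<in> set ts" "tall n s" using Suc.prems by auto
  obtain us vs where ts: "ts = us @ s # vs" using s(1) by (meson split_list)
  have w: "weight t = attach (weight (Node (us @ vs))) (weight s)"
    by (simp add: t ts weight_Node attaches_attach)
  let ?D = "wdiff (weight (path_tree n)) (weight s)" and ?z = "weight (Node (us @ vs))"
  let ?p = "weight (path_tree n)"
  have eq: "wdiff (weight (path_tree (Suc n))) (weight t) =
     snd ?z * ?D + (fst ?p + snd ?p) * (fst (weight s) + snd (weight s)) * (fst ?z - X * snd ?z)"
    unfolding w weight_path_tree by (rule wdiff_attach_child)
  have 1: "nonneg_coeffs (snd ?z * ?D)" using Suc.IH[OF s(2)]
    by (auto intro!: coeffs_intros simp: pos_coeffs_imp_nonneg)
  have c: "pos_coeffs ((fst ?p + snd ?p) * (fst (weight s) + snd (weight s)))"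
    by (auto intro!: pos_coeffs_add coeffs_intros simp: pos_coeffs_imp_nonneg)
  then have 2: "nonneg_coeffs ((fst ?p + snd ?p) * (fst (weight s) + snd (weight s)) * (fst ?z - X * snd ?z))"
    using ok_weight_tree[of "Node (us @ vs)"]
    by (intro nonneg_coeffs_mult[OF pos_coeffs_imp_nonneg[OF c]]) (auto simp: ok_weight_def)
  have "pos_coeffs (wdiff (weight (path_tree (Suc n))) (weight t))" if "t \<noteq> path_tree (Suc n)"
  proof (cases "us @ vs = []")
    case True
    then have "s \<noteq> path_tree n" using that t ts by auto
    then have "pos_coeffs ?D" using Suc.IH[OF s(2)] by (auto simp: pos_coeffs_def)
    then show ?thesis unfolding eq using 2 by (intro pos_coeffs_add pos_coeffs_mult) auto
  next
    case False
    then have "pos_coeffs (fst ?z - X * snd ?z)"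
      using good_weight_Node[of "us @ vs"] unfolding good_weight_def by blast
    then show ?thesis unfolding eq by (intro pos_coeffs_add'[OF 1] pos_coeffs_mult[OF c])
  qed
  moreover have "nonneg_coeffs (wdiff (weight (path_tree (Suc n))) (weight t))"
    unfolding eq by (intro nonneg_coeffs_add 1 2)
  ultimately show ?case by (auto simp: pos_coeffs_def)
qed

section \<open>Chains and cycles\<close>

text \<open>The transfer matrix \<open>(A, B, C, D)\<close> of a chain of rooted graphs maps potential and current
  at one end to those at the other end.\<close>

type_synonym mat2 = "real poly \<times> real poly \<times> real poly \<times> real poly"

fun times2 :: "mat2 \<Rightarrow> mat2 \<Rightarrow> mat2" where
  "times2 (a, b, c, d) (a', b', c', d') =
    (a * a' + b * c', a * b' + b * d', c * a' + d * c', c * b' + d * d')"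

fun transfer :: "weight \<Rightarrow> mat2" where
  "transfer (a, b) = (a + b, b, a, b)"

fun chain :: "weight list \<Rightarrow> mat2" where
  "chain [] = (1, 0, 0, 1)"
| "chain (w # ws) = times2 (chain ws) (transfer w)"

definition snd_prod :: "weight list \<Rightarrow> real poly" where
  "snd_prod ws = prod_list (map snd ws)"

fun cycle_poly :: "weight list \<Rightarrow> real poly" where
  "cycle_poly ws = (case chain ws of (a, b, c, d) \<Rightarrow> a + d - 2 * snd_prod ws)"

text \<open>The weight of the rest of the cycle, rooted at the cycle vertex that is left out.\<close>

fun cycle_outside :: "weight list \<Rightarrow> weight" where
  "cycle_outside ws = (case chain ws of (a, b, c, d) \<Rightarrow>
     (X * (a + b) + (a + c + d - 2 * snd_prod ws), a + b))"

declare cycle_poly.simps [simp del] cycle_outside.simps [simp del]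

lemma times2_assoc: "times2 (times2 k l) m = times2 k (times2 l m)"
  by (cases k; cases l; cases m) (simp add: algebra_simps)

lemma times2_one [simp]: "times2 (1, 0, 0, 1) m = m" "times2 m (1, 0, 0, 1) = m"
  by (cases m; simp)+

lemma chain_append: "chain (us @ vs) = times2 (chain vs) (chain us)"
  by (induction us) (simp_all add: times2_assoc)

lemma snd_prod_simps [simp]:
  "snd_prod [] = 1" "snd_prod (w # ws) = snd w * snd_prod ws"
  "snd_prod (us @ vs) = snd_prod us * snd_prod vs"
  by (simp_all add: snd_prod_def)

lemma cycle_poly_rotate: "cycle_poly (us @ vs) = cycle_poly (vs @ us)"
  by (cases "chain us"; cases "chain vs") (simp add: cycle_poly.simps chain_append algebra_simps)

lemma cycle_poly_Cons:
  "cycle_poly (w # ws) = fst w * snd (cycle_outside ws)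
     + snd w * (fst (cycle_outside ws) - X * snd (cycle_outside ws))"
  by (cases "chain ws"; cases w) (simp add: cycle_poly.simps cycle_outside.simps algebra_simps)

definition nonneg_mat2 :: "mat2 \<Rightarrow> bool" where
  "nonneg_mat2 m = (case m of (a, b, c, d) \<Rightarrow>
     nonneg_coeffs a \<and> nonneg_coeffs b \<and> nonneg_coeffs c \<and> nonneg_coeffs d)"

lemma chain_coeffs:
  assumes "\<And>w. w \<in> set ws \<Longrightarrow> ok_weight w"
  shows "case chain ws of (a, b, c, d) \<Rightarrow> nonneg_coeffs (a - snd_prod ws) \<and> nonneg_coeffs b
     \<and> nonneg_coeffs c \<and> nonneg_coeffs (d - snd_prod ws) \<and> pos_coeffs (snd_prod ws)
     \<and> (ws \<noteq> [] \<longrightarrow> pos_coeffs c)"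
  using assms
proof (induction ws)
  case (Cons w ws)
  obtain a b c d where ch: "chain ws = (a, b, c, d)" by (metis prod_cases4)
  obtain p q where w: "w = (p, q)" by (metis surj_pair)
  have q: "pos_coeffs q" and p: "pos_coeffs p"
    using Cons.prems[of w] ok_weight_fst[of w] by (simp_all add: w ok_weight_def)
  define s where "s = snd_prod ws"
  have IH: "nonneg_coeffs (a - s)" "nonneg_coeffs b" "nonneg_coeffs c" "nonneg_coeffs (d - s)"
    "pos_coeffs s"
    using Cons.IH[OF Cons.prems[OF list.set_intros(2)]] by (simp_all add: ch s_def)
  have "(a + 0) = (a - s) + s" "(d + 0) = (d - s) + s" by simp_all
  then have ad: "nonneg_coeffs a" "nonneg_coeffs d" "pos_coeffs d"
    using nonneg_coeffs_add[of "a - s" s] nonneg_coeffs_add[of "d - s" s]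
      pos_coeffs_add'[of "d - s" s] IH by (simp_all add: pos_coeffs_imp_nonneg)
  have 1: "nonneg_coeffs (a * (p + q) + b * p - q * s)"
  proof -
    have "a * (p + q) + b * p - q * s = (a - s) * q + a * p + b * p" by (simp only: algebra_simps)
    also have "nonneg_coeffs \<dots>"
      by (intro coeffs_intros) (use IH p q ad in \<open>auto simp: pos_coeffs_imp_nonneg\<close>)
    finally show ?thesis .
  qed
  have 2: "nonneg_coeffs (c * q + d * q - q * s)"
  proof -
    have "c * q + d * q - q * s = c * q + (d - s) * q" by (simp add: algebra_simps)
    also have "nonneg_coeffs \<dots>"
      by (intro coeffs_intros) (use IH q in \<open>auto simp: pos_coeffs_imp_nonneg\<close>)
    finally show ?thesis .
  qed
  have 3: "nonneg_coeffs (a * q + b * q)" "pos_coeffs (q * s)"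
    by (intro coeffs_intros; use IH q ad in \<open>auto simp: pos_coeffs_imp_nonneg\<close>)+
  have "pos_coeffs (c * (p + q) + d * p)"
    by (intro pos_coeffs_add' coeffs_intros) (use IH p q ad in \<open>auto simp: pos_coeffs_imp_nonneg\<close>)
  with 1 2 3 show ?case by (simp add: ch w s_def[symmetric] pos_coeffs_imp_nonneg)
qed simp

lemma good_cycle_outside:
  assumes "\<And>w. w \<in> set ws \<Longrightarrow> ok_weight w" "ws \<noteq> []"
  shows "good_weight (cycle_outside ws)"
proof -
  obtain a b c d where ch: "chain ws = (a, b, c, d)" by (metis prod_cases4)
  define s where "s = snd_prod ws"
  have 1: "nonneg_coeffs (a - s)" "nonneg_coeffs b" "pos_coeffs c" "nonneg_coeffs (d - s)"
    "pos_coeffs s"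
    using chain_coeffs[OF assms(1), of ws] assms(2) by (simp_all add: ch s_def)
  have "pos_coeffs (s + ((a - s) + b))" 
    by (intro pos_coeffs_add coeffs_intros) (use 1 in \<open>simp_all add: pos_coeffs_imp_nonneg\<close>)
  moreover have "pos_coeffs (c + ((a - s) + (d - s)))" 
    by (intro pos_coeffs_add coeffs_intros) (use 1 in \<open>simp_all add: pos_coeffs_imp_nonneg\<close>)
  ultimately show ?thesis
    by (simp add: good_weight_def cycle_outside.simps ch s_def[symmetric] algebra_simps)
qed

fun merge :: "weight \<Rightarrow> weight \<Rightarrow> weight" where
  "merge (a, b) (c, d) = (c * b + d * (a - X * b), b * d)"

lemma attaches_eq_merge: "attaches y us = merge y (weight (Node us))"
proof -
  have "merge y (attaches w us) = attaches (merge y w) us" for w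
  proof (induction us arbitrary: w)
    case (Cons u us)
    have "merge y (attach w (weight u)) = attach (merge y w) (weight u)"
      by (cases y; cases w; cases "weight u") (simp add: algebra_simps)
    then show ?case using Cons by simp
  qed simp
  moreover have "merge y (X, 1) = y" by (cases y) (simp add: algebra_simps)
  ultimately show ?thesis by (simp add: weight_Node)
qed

lemma fst_attach_eq_merge: "fst (attach v w) = fst (merge (attach (X, 1) v) w)"
  by (cases v; cases w) (simp add: algebra_simps)

lemma weight_Node_Cons: "weight (Node (t # ts)) = attach (weight (Node ts)) (weight t)"
  by (simp add: weight_Node attaches_attach)

lemma merge_Node_Cons:
  "fst (merge y (weight (Node (s # us)))) = fst (attach (attaches y us) (weight s))"
  by (simp add: attaches_eq_merge[symmetric] attaches_attach)

lemma cycle_poly_Cons_merge: "cycle_poly (w # ws) = fst (merge (cycle_outside ws) w)"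
  by (cases w; cases "cycle_outside ws") (simp add: cycle_poly_Cons)

lemma good_cycle_outside_trees: "ts \<noteq> [] \<Longrightarrow> good_weight (cycle_outside (map weight ts))"
  by (rule good_cycle_outside) auto

subsection \<open>A cycle with a tall tree dominates a path\<close>

lemma cycle_outside_linear:
  "wdiff v (cycle_outside (xs @ (k * a + l * a', k * b + l * b') # ys))
    = k * wdiff v (cycle_outside (xs @ (a, b) # ys)) + l * wdiff v (cycle_outside (xs @ (a', b') # ys))"
proof -
  obtain A B C D where xs: "chain xs = (A, B, C, D)" by (metis prod_cases4)
  obtain A' B' C' D' where ys: "chain ys = (A', B', C', D')" by (metis prod_cases4)
  have "snd (cycle_outside (xs @ (k * a + l * a', k * b + l * b') # ys))
    = k * snd (cycle_outside (xs @ (a, b) # ys)) + l * snd (cycle_outside (xs @ (a', b') # ys))"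
    by (simp add: cycle_outside.simps chain_append xs ys algebra_simps)
  moreover have "fst (cycle_outside (xs @ (k * a + l * a', k * b + l * b') # ys))
    = k * fst (cycle_outside (xs @ (a, b) # ys)) + l * fst (cycle_outside (xs @ (a', b') # ys))"
    by (simp add: cycle_outside.simps chain_append xs ys algebra_simps)
  ultimately show ?thesis by (simp add: wdiff_def algebra_simps)
qed

text \<open>The weight \<open>(1, 0)\<close> stands for a vertex identified with the ground. Grounding a vertex of
  the cycle cuts it open, so that the outside becomes a tree, which can be compared with paths
  of any length.\<close>

lemma chain_from_ground:
  assumes "\<And>w. w \<in> set ws \<Longrightarrow> ok_weight w"
  shows "case chain ws of (a, b, c, d) \<Rightarrow>
    nonneg_coeffs (a + b) \<and> nonneg_coeffs (c + d) \<and>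
    (\<forall>n. nonneg_coeffs (wdiff (weight (path_tree n)) (X * (a + b) + (c + d), a + b)))"
  using assms
proof (induction ws rule: rev_induct)
  case Nil
  have "nonneg_coeffs (wdiff (weight (path_tree n)) (X + 1, 1))" for n
  proof (cases n)
    case 0
    then show ?thesis by (simp add: wdiff_def)
  next
    case (Suc m)
    obtain p q where v: "weight (path_tree m) = (p, q)" by (metis surj_pair)
    have "pos_coeffs q" using pos_coeffs_tree(2)[of "path_tree m"] v by simp
    then show ?thesis unfolding Suc weight_path_tree v wdiff_def
      by (simp add: algebra_simps pos_coeffs_imp_nonneg)
  qed
  then show ?case by simp
next
  case (snoc w ws)
  obtain a b c d where ch: "chain ws = (a, b, c, d)" by (metis prod_cases4)
  obtain p q where w: "w = (p, q)" by (metis surj_pair)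
  have q: "pos_coeffs q" and p: "pos_coeffs p" and pq: "nonneg_coeffs (p - X * q)"
    using snoc.prems[of w] ok_weight_fst[of w] by (simp_all add: w ok_weight_def)
  have IH: "nonneg_coeffs (a + b)" "nonneg_coeffs (c + d)"
    "\<And>n. nonneg_coeffs (wdiff (weight (path_tree n)) (X * (a + b) + (c + d), a + b))"
    using snoc by (simp_all add: ch)
  define e f where "e = a + b" and "f = c + d"
  let ?e = "(p + q) * e + q * f" and ?f = "p * e + q * f"
  have ef: "nonneg_coeffs ?e" "nonneg_coeffs ?f"
    by (intro coeffs_intros; use p q IH e_def f_def in \<open>simp add: pos_coeffs_imp_nonneg\<close>)+
  have "nonneg_coeffs (wdiff (weight (path_tree n)) (X * ?e + ?f, ?e))" for n
  proof (cases n)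
    case 0
    then show ?thesis using ef by (simp add: wdiff_def)
  next
    case (Suc m)
    obtain r s where v: "weight (path_tree m) = (r, s)" by (metis surj_pair)
    have s: "pos_coeffs s" using pos_coeffs_tree(2)[of "path_tree m"] v by simp
    have "wdiff (attach (X, 1) (r, s)) (X * ?e + ?f, ?e)
      = q * wdiff (r, s) (X * e + f, e) + s * e * (p - X * q)"
      by (simp add: wdiff_def algebra_simps)
    moreover have "nonneg_coeffs \<dots>"
      using IH(3)[of m] v
      by (intro coeffs_intros) (use s q pq IH e_def f_def in \<open>simp_all add: pos_coeffs_imp_nonneg\<close>)
    ultimately show ?thesis by (simp only: Suc weight_path_tree v)
  qed
  moreover have "(p + q) * a + q * c + ((p + q) * b + q * d) = ?e"
    "p * a + q * c + (p * b + q * d) = ?f"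
    by (simp_all add: e_def f_def algebra_simps)
  ultimately show ?case using ef by (simp add: ch w chain_append)
qed

lemma cycle_outside_ground:
  assumes "\<And>w. w \<in> set xs \<union> set ys \<Longrightarrow> ok_weight w"
  shows "nonneg_coeffs (wdiff (weight (path_tree n)) (cycle_outside (xs @ (1, 0) # ys)))"
proof -
  obtain a b c d where ys: "chain ys = (a, b, c, d)" by (metis prod_cases4)
  obtain a' b' c' d' where xs: "chain xs = (a', b', c', d')" by (metis prod_cases4)
  obtain r s where v: "weight (path_tree n) = (r, s)" by (metis surj_pair)
  have s: "pos_coeffs s" using pos_coeffs_tree(2)[of "path_tree n"] v by simp
  have 1: "nonneg_coeffs (a + b)" "nonneg_coeffs (wdiff (r, s) (X * (a + b) + (c + d), a + b))"
    using chain_from_ground[of ys] assms by (simp_all add: ys v[symmetric])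
  have "nonneg_coeffs (a' - snd_prod xs)" "pos_coeffs (snd_prod xs)" and b': "nonneg_coeffs b'"
    using chain_coeffs[of xs] assms by (simp_all add: xs)
  from nonneg_coeffs_add[OF this(1) pos_coeffs_imp_nonneg[OF this(2)]] have a': "nonneg_coeffs a'"
    by simp
  have "wdiff (r, s) (cycle_outside (xs @ (1, 0) # ys))
    = (a' + b') * wdiff (r, s) (X * (a + b) + (c + d), a + b) + s * (a + b) * a'"
    by (simp add: cycle_outside.simps chain_append xs ys wdiff_def algebra_simps)
  also have "nonneg_coeffs \<dots>"
    by (intro nonneg_coeffs_add[of "_ * _"] nonneg_coeffs_mult 1 a' nonneg_coeffs_add[OF a' b'] pos_coeffs_imp_nonneg[OF s])
  finally show ?thesis by (simp add: v)
qed

lemma chain_replicate: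
  "\<exists>f s. chain (replicate m (X, 1)) = (f + X * s, s, X * s, f)
     \<and> nonneg_coeffs (f - 1) \<and> nonneg_coeffs s"
proof (induction m)
  case 0
  show ?case by (rule exI[of _ 1], rule exI[of _ 0]) simp
next
  case (Suc m)
  then obtain f s where fs: "chain (replicate m (X, 1)) = (f + X * s, s, X * s, f)"
    "nonneg_coeffs (f - 1)" "nonneg_coeffs s" by blast
  have f: "nonneg_coeffs f" using nonneg_coeffs_add[OF fs(2) nonneg_coeffs_1] by simp
  show ?case
  proof (intro exI conjI)
    show "chain (replicate (Suc m) (X, 1)) =
      ((f + X * s) + X * (f + s + X * s), f + s + X * s, X * (f + s + X * s), f + X * s)"
      by (simp add: fs algebra_simps)
    have "f + X * s - 1 = (f - 1) + X * s" by simp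
    moreover have "nonneg_coeffs \<dots>"
      by (intro coeffs_intros) (use fs in \<open>simp_all add: pos_coeffs_imp_nonneg\<close>)
    ultimately show "nonneg_coeffs (f + X * s - 1)" by metis
    show "nonneg_coeffs (f + s + X * s)"
      by (intro coeffs_intros) (use fs f in \<open>simp_all add: pos_coeffs_imp_nonneg\<close>)
  qed
qed

lemma cycle_outside_replicate:
  obtains n \<mu> \<nu> where
    "\<And>a b. cycle_outside (replicate i (X, 1) @ (a, b) # replicate j (X, 1))
       = (X * (a * n + b * \<mu>) + (a * \<mu> + b * \<nu>), a * n + b * \<mu>)"
    "nonneg_coeffs (\<nu> + X * \<mu> - X * n)"
proof -
  obtain f s where fs: "chain (replicate i (X, 1)) = (f + X * s, s, X * s, f)"
    "nonneg_coeffs (f - 1)" "nonneg_coeffs s" using chain_replicate by blast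
  obtain f' s' where fs': "chain (replicate j (X, 1)) = (f' + X * s', s', X * s', f')"
    "nonneg_coeffs (f' - 1)" "nonneg_coeffs s'" using chain_replicate by blast
  define n where "n = (f' + X * s' + s') * (f + X * s + s)"
  define \<mu> where "\<mu> = (f' + X * s') * (f + X * s + s + f + X * s) + s' * (f + X * s)"
  define \<nu> where "\<nu> = 2 * f * f' - 2 + 3 * X * s * f' + 3 * X * s' * f + 4 * X * X * s * s' + 2 * X * s * s'"
  have prod: "snd_prod (replicate m (X, 1)) = 1" for m by (induction m) simp_all
  have 1: "cycle_outside (replicate i (X, 1) @ (a, b) # replicate j (X, 1))
       = (X * (a * n + b * \<mu>) + (a * \<mu> + b * \<nu>), a * n + b * \<mu>)" for a b
    by (simp add: cycle_outside.simps chain_append fs fs' prod n_def \<mu>_def \<nu>_def algebra_simps)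
  have f: "nonneg_coeffs f" "nonneg_coeffs f'"
    using nonneg_coeffs_add[OF fs(2) nonneg_coeffs_1] nonneg_coeffs_add[OF fs'(2) nonneg_coeffs_1]
    by simp_all
  have "\<nu> + X * \<mu> - X * n = 2 * ((f - 1) * f' + (f' - 1)) + X * f * f'
      + (3 * X + X * X) * (s * f' + s' * f) + s * s' * (4 * X * X + X + X * X * X)"
    by (simp add: n_def \<mu>_def \<nu>_def algebra_simps)
  moreover have "nonneg_coeffs \<dots>"
    by (intro coeffs_intros) (use fs fs' f in \<open>simp_all add: pos_coeffs_imp_nonneg\<close>)
  ultimately show ?thesis using that 1 by metis
qed

lemma wdiff_cycle_outside_replicate:
  assumes "tall n t"
  shows "pos_coeffs (wdiff (weight (path_tree n))
           (cycle_outside (replicate i (X, 1) @ weight t # replicate j (X, 1))))"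
  using assms
proof (induction n arbitrary: t)
  case 0
  have "good_weight (cycle_outside (replicate i (X, 1) @ weight t # replicate j (X, 1)))"
    by (rule good_cycle_outside) auto
  then show ?case by (simp add: wdiff_single good_weight_def)
next
  case (Suc n)
  obtain ts where t: "t = Node ts" by (cases t)
  then obtain r where r: "r \<in> set ts" "tall n r" using Suc.prems by auto
  obtain us vs where ts: "ts = us @ r # vs" using r(1) by (meson split_list)
  obtain p q where pq: "weight r = (p, q)" by (metis surj_pair)
  have p: "pos_coeffs p" and q: "pos_coeffs q" using pos_coeffs_tree[of r] by (simp_all add: pq)
  obtain a b where ab: "weight (Node (us @ vs)) = (a, b)" by (metis surj_pair)
  have b: "pos_coeffs b" and a: "nonneg_coeffs (a - X * b)"
    using ok_weight_tree[of "Node (us @ vs)"] by (simp_all add: ab ok_weight_def)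
  have "weight t = attach (a, b) (p, q)"
    by (simp add: t ts weight_Node attaches_attach flip: ab pq)
  then have w: "weight t = (b * (X * (p + q) + p) + (a - X * b) * (p + q) * 1, b * (p + q) + (a - X * b) * (p + q) * 0)"
    by (simp add: algebra_simps)
  obtain e f where ef: "weight (path_tree n) = (e, f)" by (metis surj_pair)
  have e: "pos_coeffs e" and f: "pos_coeffs f" using pos_coeffs_tree[of "path_tree n"] by (simp_all add: ef)
  let ?C = "\<lambda>w. cycle_outside (replicate i (X, 1) @ w # replicate j (X, 1))"
  obtain m \<mu> \<nu> where C: "\<And>a b. ?C (a, b) = (X * (a * m + b * \<mu>) + (a * \<mu> + b * \<nu>), a * m + b * \<mu>)"
    and \<kappa>: "nonneg_coeffs (\<nu> + X * \<mu> - X * m)"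
    using cycle_outside_replicate[of i j] by metis
  have "wdiff (attach (X, 1) (e, f)) (?C (X * (p + q) + p, p + q))
    = wdiff (e, f) (?C (p, q)) + (\<nu> + X * \<mu> - X * m) * (e * p + f * p + e * q)"
    unfolding C wdiff_def by (simp add: algebra_simps)
  also have "pos_coeffs \<dots>"
    using Suc.IH[OF r(2)] unfolding pq ef
    by (intro pos_coeffs_add nonneg_coeffs_mult \<kappa> nonneg_coeffs_add)
      (use p q e f in \<open>simp_all add: pos_coeffs_imp_nonneg\<close>)
  finally have 1: "pos_coeffs (wdiff (attach (X, 1) (e, f)) (?C (X * (p + q) + p, p + q)))" .
  have 2: "nonneg_coeffs (wdiff (weight (path_tree (Suc n))) (?C (1, 0)))"
    by (rule cycle_outside_ground) auto
  show ?case
    unfolding w cycle_outside_linear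
    using 1 2 a b p q unfolding weight_path_tree ef
    by (intro pos_coeffs_add pos_coeffs_mult nonneg_coeffs_mult nonneg_coeffs_add)
      (simp_all add: pos_coeffs_imp_nonneg)
qed

text \<open>By linearity, each of the other trees may be replaced by a single vertex or by a
  connection to the ground.\<close>

lemma wdiff_cycle_outside_split:
  assumes "\<And>w. w \<in> set xs \<union> set ys \<Longrightarrow> ok_weight w" "ok_weight w"
    and "pos_coeffs (wdiff (weight (path_tree n)) (cycle_outside (xs @ (X, 1) # ys)))"
  shows "pos_coeffs (wdiff (weight (path_tree n)) (cycle_outside (xs @ w # ys)))"
proof -
  obtain a b where w: "w = (a, b)" by (metis surj_pair)
  then have ab: "w = (b * X + (a - X * b) * 1, b * 1 + (a - X * b) * 0)"
    by (simp add: algebra_simps)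
  have "pos_coeffs b" "nonneg_coeffs (a - X * b)" using assms(2) by (simp_all add: ok_weight_def w)
  moreover have "nonneg_coeffs (wdiff (weight (path_tree n)) (cycle_outside (xs @ (1, 0) # ys)))"
    using assms(1) by (rule cycle_outside_ground)
  ultimately show ?thesis
    using assms(3) unfolding ab cycle_outside_linear
    by (intro pos_coeffs_add pos_coeffs_mult nonneg_coeffs_mult)
qed

lemma exceeds_path_cycle_outside:
  assumes "\<And>w. w \<in> set xs \<union> set ys \<Longrightarrow> ok_weight w" "tall n t"
  shows "exceeds_path n (cycle_outside (xs @ weight t # ys))"
  unfolding exceeds_path_def
proof (intro allI impI)
  fix m assume "m \<le> n"
  then have tall: "tall m t" using assms(2) tall_mono by blast
  have 1: "pos_coeffs (wdiff (weight (path_tree m))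
      (cycle_outside ((replicate i (X, 1) @ weight t # replicate j (X, 1)) @ ys)))"
    if "\<And>w. w \<in> set ys \<Longrightarrow> ok_weight w" for ys i j
    using that
  proof (induction ys arbitrary: j)
    case Nil
    then show ?case using wdiff_cycle_outside_replicate[OF tall] by simp
  next
    case (Cons y ys)
    have "pos_coeffs (wdiff (weight (path_tree m))
      (cycle_outside ((replicate i (X, 1) @ weight t # replicate j (X, 1)) @ (X, 1) # ys)))"
      using Cons.IH[of "Suc j"] Cons.prems by (simp add: replicate_app_Cons_same)
    then show ?case by (rule wdiff_cycle_outside_split[rotated 2]) (use Cons.prems in auto)
  qed
  have 2: "pos_coeffs (wdiff (weight (path_tree m))
      (cycle_outside (replicate i (X, 1) @ xs @ weight t # ys)))"
    if "\<And>w. w \<in> set xs \<Longrightarrow> ok_weight w" for xs i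
    using that
  proof (induction xs arbitrary: i)
    case Nil
    then show ?case using 1[of ys i 0] assms(1) by simp
  next
    case (Cons x xs)
    have "pos_coeffs (wdiff (weight (path_tree m))
      (cycle_outside (replicate i (X, 1) @ (X, 1) # xs @ weight t # ys)))"
      using Cons.IH[of "Suc i"] Cons.prems by (simp add: replicate_app_Cons_same)
    then have "pos_coeffs (wdiff (weight (path_tree m))
      (cycle_outside (replicate i (X, 1) @ x # xs @ weight t # ys)))"
      by (rule wdiff_cycle_outside_split[rotated 2]) (use Cons.prems assms(1) in auto)
    then show ?case by simp
  qed
  show "pos_coeffs (wdiff (weight (path_tree m)) (cycle_outside (xs @ weight t # ys)))"
    using 2[of xs 0] assms(1) by simp
qed

section \<open>Decreasing transformations of trees\<close>

fun tree_order :: "rtree \<Rightarrow> nat" where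
  "tree_order (Node ts) = Suc (sum_list (map tree_order ts))"

fun leaf_count :: "rtree \<Rightarrow> nat" where
  "leaf_count (Node ts) = (if ts = [] then 1 else sum_list (map leaf_count ts))"

fun nonroot_leaves :: "rtree \<Rightarrow> nat" where
  "nonroot_leaves (Node ts) = sum_list (map leaf_count ts)"

lemma tree_order_pos [simp]: "tree_order t > 0"
  by (cases t) simp

lemma leaf_count_eq: "leaf_count t = (if tree_order t = 1 then 1 else nonroot_leaves t)"
proof (cases t)
  case (Node ts)
  then show ?thesis using tree_order_pos by (cases ts) (auto simp: less_not_refl2)
qed

lemma sum_list_map_mset:
  fixes f :: "'b \<Rightarrow> nat"
  shows "mset xs = mset ys \<Longrightarrow> sum_list (map f xs) = sum_list (map f ys)"
  unfolding sum_mset_sum_list[symmetric] mset_map by simp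

inductive leg :: "nat \<Rightarrow> rtree \<Rightarrow> bool" where
  leg_here: "path_tree n \<in> set ts \<Longrightarrow> length ts \<ge> 2 \<Longrightarrow> leg n (Node ts)"
| leg_there: "t \<in> set ts \<Longrightarrow> leg n t \<Longrightarrow> leg n (Node ts)"

text \<open>The branches at a vertex other than a pendant path \<open>Z\<close> move to the neighbour towards the
  root, behind which the rest \<open>y\<close> of the graph dominates \<open>Z\<close>.\<close>

lemma move_up:
  assumes "leg n s" "exceeds_path (Suc n) y" "ok_weight y"
  shows "\<exists>ss. pos_coeffs (fst (attach y (weight s)) - fst (attaches y ss)) \<and>
    sum_list (map tree_order ss) = tree_order s \<and> sum_list (map leaf_count ss) = leaf_count s \<and> ss \<noteq> []"
  using assms
proof (induction arbitrary: y)
  case (leg_here n ts)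
  then obtain us vs where ts: "ts = us @ path_tree n # vs" by (meson split_list)
  let ?xs = "us @ vs"
  let ?z = "weight (path_tree n)" and ?x = "weight (Node ?xs)"
  have xs: "?xs \<noteq> []" using leg_here.hyps(2) ts by auto
  then have x: "pos_coeffs (fst ?x - X * snd ?x)"
    using good_weight_Node unfolding good_weight_def by blast
  have "weight (Node ts) = attach ?x ?z"
    by (simp add: ts weight_Node attaches_attach)
  moreover have "attaches y (Node [path_tree n] # ?xs) = merge (attach y (attach (X, 1) ?z)) ?x"
    by (simp add: attaches_eq_merge[symmetric])
  moreover have "fst (attach y (attach x z)) - fst (merge (attach y (attach (X, 1) z)) x)
    = (fst x - X * snd x) * wdiff (attach (X, 1) z) y" for x z
    by (cases x; cases y; cases z) (simp add: wdiff_def algebra_simps)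
  ultimately have "fst (attach y (weight (Node ts))) - fst (attaches y (Node [path_tree n] # ?xs))
    = (fst ?x - X * snd ?x) * wdiff (weight (path_tree (Suc n))) y" by simp
  moreover have "pos_coeffs \<dots>"
    using leg_here.prems(1) by (intro pos_coeffs_mult x) (auto simp: exceeds_path_def)
  ultimately show ?case using xs
    by (intro exI[of _ "Node [path_tree n] # ?xs"]) (simp add: ts)
next
  case (leg_there t ts n)
  then obtain us vs where ts: "ts = us @ t # vs" by (meson split_list)
  let ?y = "attaches (attach (X, 1) y) (us @ vs)"
  have ok: "ok_weight (attach (X, 1) y)" 
    using leg_there.prems(2) by (rule good_imp_ok[OF good_attach[OF ok_weight_single]])
  have "exceeds_path (Suc n) ?y"
    by (intro exceeds_path_attaches ok exceeds_path_mono[OF exceeds_path_attach_child'])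
      (use leg_there.prems in auto)
  moreover have "ok_weight ?y" by (intro ok_attaches ok) auto
  ultimately obtain ss where ss: "pos_coeffs (fst (attach ?y (weight t)) - fst (attaches ?y ss))"
    "sum_list (map tree_order ss) = tree_order t" "sum_list (map leaf_count ss) = leaf_count t" "ss \<noteq> []"
    using leg_there.IH by blast
  have "fst (attach y (weight (Node ts))) = fst (attach ?y (weight t))"
    by (simp add: fst_attach_Node ts attaches_attach)
  moreover have "fst (attaches y [Node (us @ vs @ ss)]) = fst (attaches ?y ss)"
    by (simp add: fst_attach_Node)
  ultimately show ?case using ss
    by (intro exI[of _ "[Node (us @ vs @ ss)]"]) (simp add: ts)
qed

definition improves :: "weight \<Rightarrow> rtree \<Rightarrow> rtree \<Rightarrow> bool" where
  "improves y t t' \<longleftrightarrow> tree_order t' = tree_order t \<and> nonroot_leaves t' = nonroot_leaves t \<and>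
     pos_coeffs (fst (merge y (weight t)) - fst (merge y (weight t')))"

lemma improves_child:
  assumes "improves (attach (X, 1) (attaches y us)) s s'" "mset ts = mset (s # us)"
  shows "improves y (Node ts) (Node (s' # us))"
proof -
  have "leaf_count s' = leaf_count s" "tree_order s' = tree_order s"
    using assms(1) by (auto simp: improves_def leaf_count_eq)
  moreover have "fst (merge y (weight (Node (r # us)))) = fst (merge (attach (X, 1) (attaches y us)) (weight r))" for r
    by (simp add: merge_Node_Cons fst_attach_eq_merge)
  moreover have "weight (Node ts) = weight (Node (s # us))"
    using assms(2) by (rule weight_Node_mset)
  ultimately show ?thesis
    using assms(1) sum_list_map_mset[OF assms(2), of tree_order] sum_list_map_mset[OF assms(2), of leaf_count]
    by (simp add: improves_def)
qed

lemma improves_move_up: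
  assumes "leg n s" "exceeds_path (Suc n) (attaches y us)" "good_weight y" "mset ts = mset (s # us)"
  shows "\<exists>t'. improves y (Node ts) t'"
proof -
  obtain ss where ss: "pos_coeffs (fst (attach (attaches y us) (weight s)) - fst (attaches (attaches y us) ss))"
    "sum_list (map tree_order ss) = tree_order s" "sum_list (map leaf_count ss) = leaf_count s"
    using move_up[OF assms(1,2) good_imp_ok[OF good_attaches[OF assms(3)]]] by blast
  have "weight (Node ts) = weight (Node (s # us))"
    using assms(4) by (rule weight_Node_mset)
  then have "fst (merge y (weight (Node ts))) = fst (attach (attaches y us) (weight s))"
    by (simp only: merge_Node_Cons)
  moreover have "fst (merge y (weight (Node (us @ ss)))) = fst (attaches (attaches y us) ss)"
    by (simp flip: attaches_eq_merge)
  ultimately have "improves y (Node ts) (Node (us @ ss))"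
    using ss sum_list_map_mset[OF assms(4), of tree_order] sum_list_map_mset[OF assms(4), of leaf_count]
    by (simp add: improves_def)
  then show ?thesis by blast
qed

text \<open>The other neighbours of a vertex move across an edge to a neighbour that dominates the
  pendant path \<open>Z\<close> left behind.\<close>

lemma improves_move_across:
  assumes "mset ts = mset (path_tree n # Node cs # us)" "tall (Suc n) (Node cs)"
    "Node cs \<noteq> path_tree (Suc n)" "good_weight y"
  shows "\<exists>t'. improves y (Node ts) t'"
proof -
  let ?t' = "Node (Node [path_tree n] # cs @ us)"
  let ?z = "weight (path_tree n)" and ?u = "weight (Node us)" and ?c = "weight (Node cs)"
  let ?D = "wdiff (attach (X, 1) ?z) ?c"
  have D: "pos_coeffs ?D"
    using wdiff_path_tree[OF assms(2)] assms(3) by (simp add: pos_coeffs_def)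
  have cs: "cs \<noteq> []" using assms(2) by auto
  have "mset ts = mset (Node cs # path_tree n # us)" using assms(1) by simp
  from weight_Node_mset[OF this] have t: "weight (Node ts) = attach (attach ?u ?z) ?c"
    by (simp add: weight_Node_Cons)
  have t': "weight ?t' = merge (merge (attach (X, 1) (attach (X, 1) ?z)) ?c) ?u"
    by (simp add: weight_Node[of "Node [path_tree n] # cs @ us"] flip: attaches_eq_merge)
  have "fst (attach (attach u z) c) - fst (merge (merge (attach (X, 1) (attach (X, 1) z)) c) u)
      = (fst u - X * snd u) * wdiff (attach (X, 1) z) c"
    "snd (attach (attach u z) c) - snd (merge (merge (attach (X, 1) (attach (X, 1) z)) c) u)
      = snd u * wdiff (attach (X, 1) z) c" for u z c
    by (cases u; cases z; cases c; simp add: wdiff_def algebra_simps)+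
  from this[of ?u ?z ?c] have
    d: "fst (weight (Node ts)) - fst (weight ?t') = (fst ?u - X * snd ?u) * ?D"
    "snd (weight (Node ts)) - snd (weight ?t') = snd ?u * ?D" unfolding t t' .
  have "fst (merge y v) - fst (merge y w) = (snd v - snd w) * (fst y - X * snd y)
     + (fst v - fst w) * snd y" for v w
    by (cases v; cases w; cases y) (simp add: algebra_simps)
  from this[of "weight (Node ts)" "weight ?t'"]
  have "fst (merge y (weight (Node ts))) - fst (merge y (weight ?t'))
      = snd ?u * ?D * (fst y - X * snd y) + (fst ?u - X * snd ?u) * ?D * snd y"
    by (simp only: d)
  also have "pos_coeffs \<dots>"
    using D assms(4) ok_weight_tree[of "Node us"]
    by (intro pos_coeffs_add pos_coeffs_mult nonneg_coeffs_mult)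
      (simp_all add: good_weight_def ok_weight_def pos_coeffs_imp_nonneg)
  finally have "improves y (Node ts) ?t'"
    using cs sum_list_map_mset[OF assms(1), of tree_order] sum_list_map_mset[OF assms(1), of leaf_count]
    by (simp add: improves_def)
  then show ?thesis by blast
qed

lemma ok_weight_map: "w \<in> set (map weight ts) \<Longrightarrow> ok_weight w"
  by (metis (no_types) ex_map_conv ok_weight_tree)

fun spine :: "nat \<Rightarrow> rtree \<Rightarrow> rtree" where
  "spine 0 t = t"
| "spine (Suc k) t = Node [spine k t]"

definition balanced :: "nat list \<Rightarrow> bool" where
  "balanced qs \<longleftrightarrow> (\<forall>p\<in>set qs. \<forall>q\<in>set qs. p \<le> Suc q)"

definition canonical :: "nat \<Rightarrow> nat list \<Rightarrow> rtree \<Rightarrow> bool" where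
  "canonical k qs t \<longleftrightarrow> t = spine k (Node (map path_tree qs)) \<and> balanced qs \<and> (0 < k \<longrightarrow> 2 \<le> length qs)"

lemma tall_path_tree: "tall m (path_tree n) \<longleftrightarrow> m \<le> n"
proof (induction n arbitrary: m)
  case 0
  show ?case by (cases m) auto
next
  case (Suc n)
  then show ?case by (cases m) auto
qed

lemma path_tree_eq_iff [simp]: "path_tree m = path_tree n \<longleftrightarrow> m = n"
  by (metis antisym order_refl tall_path_tree)

lemma tall_spine: "tall n t \<Longrightarrow> tall n (spine k t)"
  by (induction k) (auto intro: tall_mono[of "Suc n" _ n for n] simp del: tall.simps simp: tall.simps(2))

lemma leg_spine: "leg n t \<Longrightarrow> leg n (spine k t)"
  by (induction k) (auto intro: leg_there)

lemma canonical_cases: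
  assumes "canonical k qs t"
  obtains n where "t = path_tree n" | n where "leg n t" "tall (Suc n) t"
proof (cases "2 \<le> length qs")
  case True
  then obtain q where q: "q \<in> set qs" by (cases qs) auto
  have "leg q (Node (map path_tree qs))" using q True by (intro leg_here) auto
  moreover have "tall (Suc q) (Node (map path_tree qs))" using q by (auto simp: tall_path_tree)
  moreover have "t = spine k (Node (map path_tree qs))" using assms by (simp add: canonical_def)
  ultimately show ?thesis using that(2)[of q] by (simp only: leg_spine tall_spine)
next
  case False
  then have t: "t = Node (map path_tree qs)" using assms by (auto simp: canonical_def)
  show ?thesis
  proof (cases qs)
    case Nil
    then show ?thesis using that(1)[of 0] t by simp
  next
    case (Cons q qs')
    then show ?thesis using that(1)[of "Suc q"] t False by (cases qs') auto
  qed
qed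

lemma improves_move_up_sibling:
  assumes "leg n s" "tall n s'" "good_weight y" "mset ts = mset (s # s' # us)"
  shows "\<exists>t'. improves y (Node ts) t'"
proof (rule improves_move_up[OF assms(1) _ assms(3,4)])
  have "exceeds_path (Suc n) (attach y (weight s'))"
    by (rule exceeds_path_attach_child)
      (use assms(2,3) wdiff_path_tree tall_mono in auto)
  then have "exceeds_path (Suc n) (attaches (attach y (weight s')) us)"
    by (intro exceeds_path_attaches good_imp_ok[OF good_attach[OF good_imp_ok[OF assms(3)]]]) auto
  then show "exceeds_path (Suc n) (attaches y (s' # us))" by simp
qed

lemma canonical_or_improves:
  assumes "good_weight y"
  shows "(\<exists>t'. improves y t t') \<or> (\<exists>k qs. canonical k qs t)"
  using assms
proof (induction t arbitrary: y)
  case (Node ts)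
  have IH: "\<exists>k qs. canonical k qs s" if none: "\<nexists>t'. improves y (Node ts) t'" and s: "s \<in> set ts" for s
  proof -
    obtain us vs where ts: "ts = us @ s # vs" using s by (meson split_list)
    have m: "mset ts = mset (s # us @ vs)" by (simp add: ts)
    have "good_weight (attach (X, 1) (attaches y (us @ vs)))"
      by (intro good_attach good_imp_ok[OF good_attaches[OF Node.prems]]) simp
    from Node.IH[OF s this] show ?thesis using improves_child[OF _ m] none by blast
  qed
  show ?case
  proof (cases "\<exists>t'. improves y (Node ts) t'")
    case False
    note none = False
    show ?thesis
    proof (cases "\<forall>s\<in>set ts. \<exists>n. s = path_tree n")
      case True
      then obtain f where f: "\<And>s. s \<in> set ts \<Longrightarrow> s = path_tree (f s)" by metis
      define qs where "qs = map f ts"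
      have ts: "ts = map path_tree qs"
        unfolding qs_def map_map by (rule map_idI[symmetric]) (use f in auto)
      have "balanced qs"
      proof (rule ccontr)
        assume "\<not> balanced qs"
        then obtain p q where pq: "p \<in> set qs" "q \<in> set qs" "p > Suc q"
          by (auto simp: balanced_def not_le)
        obtain us vs where qs: "qs = us @ q # vs" using pq(2) by (meson split_list)
        then have "p \<in> set (us @ vs)" using pq by auto
        then obtain us' vs' where "us @ vs = us' @ p # vs'" by (meson split_list)
        then have "mset (us @ vs) = mset (p # us' @ vs')" by simp
        then have "mset qs = mset (q # p # us' @ vs')" by (simp add: qs)
        then have "mset ts = mset (map path_tree (q # p # us' @ vs'))"
          unfolding ts mset_map by (rule arg_cong)
        moreover obtain cs where cs: "path_tree p = Node cs" by (cases "path_tree p")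
        ultimately have "mset ts = mset (path_tree q # Node cs # map path_tree (us' @ vs'))" by simp
        then have "\<exists>t'. improves y (Node ts) t'"
          by (rule improves_move_across)
            (use pq(3) Node.prems in \<open>auto simp del: tall.simps path_tree.simps simp: cs[symmetric] tall_path_tree\<close>)
        with none show False by blast
      qed
      then have "canonical 0 qs (Node ts)" by (simp add: canonical_def ts)
      then show ?thesis by blast
    next
      case False
      then obtain s where s: "s \<in> set ts" and nonpath: "\<And>n. s \<noteq> path_tree n" by blast
      obtain k qs where can: "canonical k qs s" using IH[OF none s] by blast
      obtain n where n: "leg n s" "tall (Suc n) s" by (rule canonical_cases[OF can]) (use nonpath in auto)
      obtain us vs where ts: "ts = us @ s # vs" using s by (meson split_list)
      show ?thesis
      proof (cases "us @ vs")
        case Nil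
        then have ts: "ts = [s]" using ts by simp
        have len: "2 \<le> length qs"
        proof (rule ccontr)
          assume "\<not> 2 \<le> length qs"
          then have "length qs \<le> 1" "k = 0" using can by (auto simp: canonical_def)
          then have "s = path_tree 0 \<or> s = path_tree (Suc (hd qs))"
            using can by (cases qs) (auto simp: canonical_def)
          then show False using nonpath by blast
        qed
        have "canonical (Suc k) qs (Node ts)" using can len by (simp add: canonical_def ts)
        then show ?thesis by blast
      next
        case (Cons s' ws)
        have m: "mset ts = mset (s # s' # ws)"
          using arg_cong[OF Cons, of mset] by (simp add: ts)
        then have m': "mset ts = mset (s' # s # ws)" by simp
        have s': "s' \<in> set ts" using m by (metis list.set_intros(1,2) mset_eq_setD)
        obtain k' qs' where can': "canonical k' qs' s'" using IH[OF none s'] by blast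
        have "\<exists>t'. improves y (Node ts) t'"
        proof (rule canonical_cases[OF can'])
          fix q assume q: "s' = path_tree q"
          obtain cs where cs: "s = Node cs" by (cases s)
          show ?thesis
          proof (cases "tall (Suc q) s")
            case True
            then show ?thesis
              using improves_move_across[of ts q cs ws y] m' nonpath[of "Suc q"] Node.prems
              unfolding q cs by blast
          next
            case False
            then have "n \<le> q" using n(2) tall_mono[of "Suc n" s "Suc q"] by linarith
            then have "tall n s'" by (simp add: q tall_path_tree)
            then show ?thesis by (rule improves_move_up_sibling[OF n(1) _ Node.prems m])
          qed
        next
          fix q assume q: "leg q s'" "tall (Suc q) s'"
          show ?thesis
          proof (cases "n \<le> q")
            case True
            then have "tall n s'" by (intro tall_mono[OF q(2)]) simp
            then show ?thesis by (rule improves_move_up_sibling[OF n(1) _ Node.prems m])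
          next
            case False
            then have "tall q s" using n(2) by (intro tall_mono[OF n(2)]) simp
            then show ?thesis by (rule improves_move_up_sibling[OF q(1) _ Node.prems m'])
          qed
        qed
        with none show ?thesis by blast
      qed
    qed
  qed blast
qed

definition cycle_of :: "rtree list \<Rightarrow> real poly" where
  "cycle_of ts = cycle_poly (map weight ts)"

lemma cycle_of_split: "cycle_of (us @ t # vs) = fst (merge (cycle_outside (map weight (vs @ us))) (weight t))"
  using cycle_poly_rotate[of "map weight us" "map weight (t # vs)"]
  by (simp add: cycle_of_def cycle_poly_Cons_merge)

lemma nonneg_coeffs_cycle_of: "nonneg_coeffs (cycle_of ts)"
proof -
  obtain a b c d where ch: "chain (map weight ts) = (a, b, c, d)" by (metis prod_cases4)
  let ?s = "snd_prod (map weight ts)"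
  have "nonneg_coeffs ((a - ?s) + (d - ?s))"
    using chain_coeffs[of "map weight ts", OF ok_weight_map] by (intro nonneg_coeffs_add) (simp_all add: ch)
  then show ?thesis by (simp add: cycle_of_def cycle_poly.simps ch algebra_simps)
qed

definition int_at_1 :: "real poly \<Rightarrow> bool" where
  "int_at_1 p \<longleftrightarrow> poly p 1 \<in> \<int>"

lemma int_at_1_intros:
  "int_at_1 0" "int_at_1 1" "int_at_1 X" "int_at_1 2" "int_at_1 p \<Longrightarrow> int_at_1 q \<Longrightarrow> int_at_1 (p + q)"
  "int_at_1 p \<Longrightarrow> int_at_1 q \<Longrightarrow> int_at_1 (p - q)" "int_at_1 p \<Longrightarrow> int_at_1 q \<Longrightarrow> int_at_1 (p * q)"
  by (auto simp: int_at_1_def)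

lemma int_at_1_weight: "int_at_1 (fst (weight t)) \<and> int_at_1 (snd (weight t))"
proof (induction t)
  case (Node ts)
  have "int_at_1 (fst (attaches w ts)) \<and> int_at_1 (snd (attaches w ts))"
    if "int_at_1 (fst w)" "int_at_1 (snd w)" for w
    using Node that
  proof (induction ts arbitrary: w)
    case (Cons t ts)
    obtain a b c d where "w = (a, b)" "weight t = (c, d)" by (metis surj_pair)
    then show ?case using Cons.prems(1)[of t] Cons.prems by (simp add: Cons.IH int_at_1_intros)
  qed simp
  then show ?case by (simp add: weight_Node int_at_1_intros)
qed

lemma int_at_1_cycle_of: "int_at_1 (cycle_of ts)"
proof -
  have "case chain (map weight ts) of (a, b, c, d) \<Rightarrow> int_at_1 a \<and> int_at_1 b \<and> int_at_1 c \<and>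
      int_at_1 d \<and> int_at_1 (snd_prod (map weight ts))"
  proof (induction ts)
    case (Cons t ts)
    obtain a b c d where "chain (map weight ts) = (a, b, c, d)" by (metis prod_cases4)
    moreover obtain p q where "weight t = (p, q)" by (metis surj_pair)
    ultimately show ?case using Cons int_at_1_weight[of t] by (simp add: int_at_1_intros)
  qed (simp add: int_at_1_intros)
  moreover obtain a b c d where "chain (map weight ts) = (a, b, c, d)" by (metis prod_cases4)
  ultimately show ?thesis by (simp add: cycle_of_def cycle_poly.simps int_at_1_intros)
qed

text \<open>Values at 1 make the strict decrease of the coefficients well-founded.\<close>

lemma cycle_of_decreasing:
  assumes "pos_coeffs (cycle_of ts - cycle_of us)"
  shows "nat \<lfloor>poly (cycle_of us) 1\<rfloor> < nat \<lfloor>poly (cycle_of ts) 1\<rfloor>"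
proof -
  have nonneg: "0 \<le> poly (cycle_of us) 1"
    using nonneg_coeffs_cycle_of[of us] poly_pos_coeffs[of "cycle_of us" 1]
    by (cases "cycle_of us = 0") (auto simp: pos_coeffs_def)
  have less: "poly (cycle_of us) 1 < poly (cycle_of ts) 1"
    using poly_pos_coeffs[OF assms, of 1] by simp
  obtain m n where "poly (cycle_of us) 1 = of_int m" "poly (cycle_of ts) 1 = of_int n"
    using int_at_1_cycle_of unfolding int_at_1_def by (metis Ints_cases)
  then show ?thesis using nonneg less by simp
qed

definition same_shape :: "rtree list \<Rightarrow> rtree list \<Rightarrow> bool" where
  "same_shape ts us \<longleftrightarrow> map tree_order ts = map tree_order us \<and> map nonroot_leaves ts = map nonroot_leaves us"

lemma cycle_improvement:
  assumes "improves (cycle_outside (map weight (vs @ us))) t t'"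
  shows "same_shape (us @ t # vs) (us @ t' # vs) \<and>
    pos_coeffs (cycle_of (us @ t # vs) - cycle_of (us @ t' # vs))"
  using assms by (simp add: improves_def same_shape_def cycle_of_split)

lemma canonical_all_or_improvement:
  assumes "2 \<le> length ts"
    and none: "\<nexists>us. same_shape ts us \<and> pos_coeffs (cycle_of ts - cycle_of us)"
  obtains ks qss where "\<And>i. i < length ts \<Longrightarrow> canonical (ks i) (qss i) (ts ! i)"
    "\<And>i j. i < length ts \<Longrightarrow> j < length ts \<Longrightarrow> 0 < ks i \<Longrightarrow> 0 < ks j \<Longrightarrow> i = j"
proof -
  have "\<exists>k qs. canonical k qs (ts ! i)" if i: "i < length ts" for i
  proof -
    have ts: "ts = take i ts @ ts ! i # drop (Suc i) ts" using i by (rule id_take_nth_drop)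
    have "drop (Suc i) ts @ take i ts \<noteq> []" using assms(1) i by auto
    from good_cycle_outside_trees[OF this]
    have good: "good_weight (cycle_outside (map weight (drop (Suc i) ts @ take i ts)))" .
    have "\<not> improves (cycle_outside (map weight (drop (Suc i) ts @ take i ts))) (ts ! i) t'" for t'
      using cycle_improvement[of "drop (Suc i) ts" "take i ts" "ts ! i" t'] none ts by metis
    then show ?thesis using canonical_or_improves[OF good, of "ts ! i"] by blast
  qed
  then obtain ks qss where c: "\<And>i. i < length ts \<Longrightarrow> canonical (ks i) (qss i) (ts ! i)" by metis
  have le: False
    if ij: "i < length ts" "j < length ts" "i \<noteq> j" and s: "ts ! i = Node [s]" "leg m s"
      and tall: "tall (Suc m) (ts ! j)" for i j m s
  proof -
    have ts: "ts = take i ts @ ts ! i # drop (Suc i) ts" using ij(1) by (rule id_take_nth_drop)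
    have "ts ! j \<in> set (drop (Suc i) ts @ take i ts)"
    proof (cases "j < i")
      case True
      then have "take i ts ! j = ts ! j" "j < length (take i ts)" using ij by auto
      then show ?thesis by (metis in_set_conv_nth Un_iff set_append)
    next
      case False
      then have "drop (Suc i) ts ! (j - Suc i) = ts ! j" "j - Suc i < length (drop (Suc i) ts)"
        using ij by auto
      then show ?thesis by (metis in_set_conv_nth Un_iff set_append)
    qed
    then obtain us vs where split: "drop (Suc i) ts @ take i ts = us @ ts ! j # vs" by (meson split_list)
    let ?y = "cycle_outside (map weight (us @ ts ! j # vs))"
    have "good_weight ?y" by (rule good_cycle_outside_trees) simp
    moreover have "exceeds_path (Suc m) (attaches ?y [])"
      using exceeds_path_cycle_outside[of "map weight us" "map weight vs", OF _ tall] ok_weight_map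
      by (metis Un_iff attaches_simps(1) list.simps(9) map_append)
    ultimately obtain t' where "improves ?y (ts ! i) t'"
      using improves_move_up[OF s(2), of ?y "[]" "[s]"] s(1) by auto
    then have "improves (cycle_outside (map weight (drop (Suc i) ts @ take i ts))) (ts ! i) t'"
      by (simp only: split)
    then show False using cycle_improvement none ts by metis
  qed
  have "i = j" if ij: "i < length ts" "j < length ts" "0 < ks i" "0 < ks j" for i j
  proof (rule ccontr)
    assume "i \<noteq> j"
    have *: "\<exists>s m. ts ! l = Node [s] \<and> leg m s \<and> tall (Suc m) (ts ! l)"
      if l: "l < length ts" "0 < ks l" for l
    proof -
      obtain k where k: "ks l = Suc k" using l(2) by (cases "ks l") auto
      have len: "2 \<le> length (qss l)" using c[OF l(1)] l(2) by (simp add: canonical_def)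
      define s where "s = spine k (Node (map path_tree (qss l)))"
      have ts: "ts ! l = Node [s]" using c[OF l(1)] by (simp add: canonical_def k s_def)
      obtain q where q: "q \<in> set (qss l)" using len by (cases "qss l") auto
      have "leg q (Node (map path_tree (qss l)))" using q len by (intro leg_here) auto
      moreover have "tall (Suc q) (Node (map path_tree (qss l)))" using q by (auto simp: tall_path_tree)
      ultimately have "leg q s" "tall (Suc q) s" by (simp_all only: s_def leg_spine tall_spine)
      moreover from this(2) have "tall (Suc q) (spine (Suc 0) s)" by (rule tall_spine)
      ultimately show ?thesis using ts by auto
    qed
    obtain s m where s: "ts ! i = Node [s]" "leg m s" "tall (Suc m) (ts ! i)" using *[OF ij(1,3)] by blast
    obtain s' m' where s': "ts ! j = Node [s']" "leg m' s'" "tall (Suc m') (ts ! j)" using *[OF ij(2,4)] by blast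
    show False
    proof (cases "m \<le> m'")
      case True
      then show False using le[OF ij(1,2) \<open>i \<noteq> j\<close> s(1,2)] tall_mono[OF s'(3)] by simp
    next
      case False
      then show False using le[OF ij(2,1) \<open>i \<noteq> j\<close>[symmetric] s'(1,2)] tall_mono[OF s(3)] by simp
    qed
  qed
  with c that show ?thesis by blast
qed

lemma exists_canonical_minorant:
  assumes "2 \<le> length ts"
  obtains us ks qss where "same_shape ts us" "us = ts \<or> pos_coeffs (cycle_of ts - cycle_of us)"
    "\<And>i. i < length ts \<Longrightarrow> canonical (ks i) (qss i) (us ! i)"
    "\<And>i j. i < length ts \<Longrightarrow> j < length ts \<Longrightarrow> 0 < ks i \<Longrightarrow> 0 < ks j \<Longrightarrow> i = j"
proof -
  have "\<exists>us ks qss. same_shape ts us \<and> (us = ts \<or> pos_coeffs (cycle_of ts - cycle_of us)) \<and>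
    (\<forall>i < length ts. canonical (ks i) (qss i) (us ! i)) \<and>
    (\<forall>i < length ts. \<forall>j < length ts. 0 < ks i \<longrightarrow> 0 < ks j \<longrightarrow> i = j)"
    using assms
  proof (induction "nat \<lfloor>poly (cycle_of ts) 1\<rfloor>" arbitrary: ts rule: less_induct)
    case less
    show ?case
    proof (cases "\<exists>us. same_shape ts us \<and> pos_coeffs (cycle_of ts - cycle_of us)")
      case True
      then obtain us where us: "same_shape ts us" "pos_coeffs (cycle_of ts - cycle_of us)" by blast
      have len: "length us = length ts" using us(1) by (metis same_shape_def length_map)
      then have "2 \<le> length us" using less.prems by simp
      from less.hyps[OF cycle_of_decreasing[OF us(2)] this]
      obtain vs ks qss where vs: "same_shape us vs" "vs = us \<or> pos_coeffs (cycle_of us - cycle_of vs)"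
        "\<And>i. i < length ts \<Longrightarrow> canonical (ks i) (qss i) (vs ! i)"
        "\<And>i j. i < length ts \<Longrightarrow> j < length ts \<Longrightarrow> 0 < ks i \<Longrightarrow> 0 < ks j \<Longrightarrow> i = j"
        unfolding len by blast
      have "pos_coeffs (cycle_of ts - cycle_of vs)"
      proof (cases "vs = us")
        case False
        then have "pos_coeffs ((cycle_of ts - cycle_of us) + (cycle_of us - cycle_of vs))"
          using vs(2) us(2) by (intro pos_coeffs_add) (auto simp: pos_coeffs_imp_nonneg)
        then show ?thesis by simp
      qed (use us in simp)
      moreover have "same_shape ts vs" using us(1) vs(1) by (simp add: same_shape_def)
      ultimately show ?thesis using vs(3,4) by blast
    next
      case False
      then obtain ks qss where "\<And>i. i < length ts \<Longrightarrow> canonical (ks i) (qss i) (ts ! i)"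
        "\<And>i j. i < length ts \<Longrightarrow> j < length ts \<Longrightarrow> 0 < ks i \<Longrightarrow> 0 < ks j \<Longrightarrow> i = j"
        using canonical_all_or_improvement[OF less.prems] by metis
      moreover have "same_shape ts ts" by (simp add: same_shape_def)
      ultimately show ?thesis by blast
    qed
  qed
  then show ?thesis using that by blast
qed

section \<open>Determinants indexed by finite sets\<close>

definition list_mat :: "'v list \<Rightarrow> ('v \<Rightarrow> 'v \<Rightarrow> real) \<Rightarrow> real mat" where
  "list_mat vs M = mat (length vs) (length vs) (\<lambda>(i, j). M (vs ! i) (vs ! j))"

lemma list_mat_carrier [simp]: "list_mat vs M \<in> carrier_mat (length vs) (length vs)"
  by (simp add: list_mat_def)

lemma det_list_mat_permute:
  assumes vs: "distinct vs" and ws: "distinct ws" and eq: "set vs = set ws"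
  shows "det (list_mat vs M) = det (list_mat ws M)"
proof -
  define n where "n = length vs"
  have n': "length ws = n"
    using vs ws eq unfolding n_def by (metis distinct_card)
  define P where "P = mat n n (\<lambda>(i, j). if vs ! j = ws ! i then 1 else (0::real))"
  define Q where "Q = transpose_mat P"
  have P: "P \<in> carrier_mat n n" and Q: "Q \<in> carrier_mat n n" by (simp_all add: P_def Q_def)
  have A: "list_mat vs M \<in> carrier_mat n n" by (simp add: n_def)
  have "\<exists>j<n. vs ! j = ws ! i" if "i < n" for i
    using that n' eq unfolding n_def by (metis in_set_conv_nth nth_mem)
  then obtain f where f: "\<And>i. i < n \<Longrightarrow> f i < n \<and> vs ! f i = ws ! i" by metis
  have P_eq: "P $$ (i, j) = (if j = f i then 1 else 0)" if "i < n" "j < n" for i j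
    using that f[of i] nth_eq_iff_index_eq[OF vs, of j "f i"] by (auto simp: P_def n_def)
  have PB: "(P * B) $$ (i, j) = B $$ (f i, j)" if "B \<in> carrier_mat n n" "i < n" "j < n" for B i j
  proof -
    have "(P * B) $$ (i, j) = (\<Sum>k = 0..<n. (if k = f i then 1 else 0) * B $$ (k, j))"
      using that P by (auto simp: scalar_prod_def P_eq intro!: sum.cong)
    also have "\<dots> = (\<Sum>k = 0..<n. if k = f i then B $$ (k, j) else 0)"
      by (intro sum.cong) auto
    finally show ?thesis using f[OF that(2)] by simp
  qed
  have BQ: "(B * Q) $$ (i, j) = B $$ (i, f j)" if "B \<in> carrier_mat n n" "i < n" "j < n" for B i j
  proof -
    have "(B * Q) $$ (i, j) = (\<Sum>k = 0..<n. B $$ (i, k) * (if k = f j then 1 else 0))"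
      using that P Q by (auto simp: scalar_prod_def Q_def P_eq intro!: sum.cong)
    also have "\<dots> = (\<Sum>k = 0..<n. if k = f j then B $$ (i, k) else 0)"
      by (intro sum.cong) auto
    finally show ?thesis using f[OF that(3)] by simp
  qed
  have PQ: "P * Q = 1\<^sub>m n"
  proof (rule eq_matI)
    fix i j assume "i < dim_row (1\<^sub>m n :: real mat)" "j < dim_col (1\<^sub>m n :: real mat)"
    then have ij: "i < n" "j < n" by auto
    have "f i = f j \<longleftrightarrow> i = j" using f[OF ij(1)] f[OF ij(2)] ij ws n' by (metis nth_eq_iff_index_eq)
    then show "(P * Q) $$ (i, j) = (1\<^sub>m n :: real mat) $$ (i, j)"
      using ij BQ[OF P ij] f[OF ij(2)] by (auto simp: P_eq)
  qed (use P Q in auto)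
  have "list_mat ws M = P * list_mat vs M * Q"
  proof (rule eq_matI)
    fix i j assume "i < dim_row (P * list_mat vs M * Q)" "j < dim_col (P * list_mat vs M * Q)"
    then have ij: "i < n" "j < n" using P Q by auto
    have PA: "P * list_mat vs M \<in> carrier_mat n n" using P A by simp
    have "(P * list_mat vs M * Q) $$ (i, j) = list_mat vs M $$ (f i, f j)"
      using BQ[OF PA ij] PB[OF A ij(1)] f[OF ij(2)] by simp
    then show "list_mat ws M $$ (i, j) = (P * list_mat vs M * Q) $$ (i, j)"
      using f[OF ij(1)] f[OF ij(2)] ij n' by (simp add: list_mat_def n_def)
  qed (use P Q n' in \<open>auto simp: list_mat_def\<close>)
  then have "det (list_mat ws M) = det P * det (list_mat vs M) * det Q"
    using P Q A by (simp add: det_mult[of _ n])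
  moreover have "det P * det Q = 1"
    using det_mult[OF P Q] PQ by simp
  ultimately show ?thesis by (simp add: mult.commute mult.left_commute)
qed

lemma det_list_mat_pivot:
  assumes p: "M v v \<noteq> 0"
  shows "det (list_mat (v # vs) M) = M v v * det (list_mat vs (\<lambda>i j. M i j - M i v * M v j / M v v))"
proof -
  define n where "n = length vs"
  define S where "S = list_mat vs (\<lambda>i j. M i j - M i v * M v j / M v v)"
  define P where "P = mat 1 1 (\<lambda>_. M v v)"
  define R where "R = mat 1 n (\<lambda>(_, j). M v (vs ! j))"
  define C where "C = mat n 1 (\<lambda>(i, _). M (vs ! i) v / M v v)"
  define L where "L = four_block_mat (1\<^sub>m 1) (0\<^sub>m 1 n) C (1\<^sub>m n)"
  define U where "U = four_block_mat P R (0\<^sub>m n 1) S"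
  have c: "P \<in> carrier_mat 1 1" "R \<in> carrier_mat 1 n" "C \<in> carrier_mat n 1" "S \<in> carrier_mat n n"
    by (simp_all add: P_def R_def C_def S_def n_def)
  have "L * U = four_block_mat P R (C * P) (C * R + S)"
    unfolding L_def U_def using c
    by (subst mult_four_block_mat[of _ 1 1 _ n _ n _ _ 1 _ n]) simp_all
  also have "\<dots> = list_mat (v # vs) M"
  proof (rule eq_matI)
    fix i j assume "i < dim_row (list_mat (v # vs) M)" "j < dim_col (list_mat (v # vs) M)"
    then have "i < Suc n" "j < Suc n" by (simp_all add: n_def list_mat_def)
    then show "four_block_mat P R (C * P) (C * R + S) $$ (i, j) = list_mat (v # vs) M $$ (i, j)"
      using c p
      by (cases i; cases j) (auto simp: P_def R_def C_def S_def list_mat_def n_def scalar_prod_def)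
  qed (use c in \<open>simp_all add: list_mat_def n_def\<close>)
  finally have "det (list_mat (v # vs) M) = det L * det U"
    using c det_mult[of L "Suc n" U] by (metis L_def U_def four_block_carrier_mat one_carrier_mat plus_1_eq_Suc)
  moreover have "det L = 1"
    unfolding L_def using c
    by (subst det_four_block_mat_upper_right_zero[of _ 1 _ n]) simp_all
  moreover have "det U = M v v * det S"
    unfolding U_def using c
    by (subst det_four_block_mat_lower_left_zero_col[of _ _ n]) (simp_all add: P_def det_single)
  ultimately show ?thesis by (simp add: S_def)
qed

definition det_on :: "'v set \<Rightarrow> ('v \<Rightarrow> 'v \<Rightarrow> real) \<Rightarrow> real" where
  "det_on V M = det (list_mat (SOME vs. distinct vs \<and> set vs = V) M)"

lemma det_on_eq:
  assumes "distinct vs" "set vs = V"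
  shows "det_on V M = det (list_mat vs M)"
proof -
  have "distinct (SOME vs. distinct vs \<and> set vs = V) \<and> set (SOME vs. distinct vs \<and> set vs = V) = V"
    by (rule someI[of "\<lambda>vs. distinct vs \<and> set vs = V" vs]) (use assms in simp)
  then show ?thesis unfolding det_on_def using assms by (intro det_list_mat_permute) auto
qed

lemma det_on_cong:
  assumes "finite V" "\<And>i j. i \<in> V \<Longrightarrow> j \<in> V \<Longrightarrow> M i j = N i j"
  shows "det_on V M = det_on V N"
proof -
  obtain vs where vs: "distinct vs" "set vs = V" using finite_distinct_list[OF assms(1)] by blast
  have "list_mat vs M = list_mat vs N"
    using assms(2) vs by (auto simp: list_mat_def intro!: eq_matI)
  then show ?thesis by (simp add: det_on_eq[OF vs])
qed

lemma det_on_pivot: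
  assumes "finite V" "v \<notin> V" "M v v \<noteq> 0"
  shows "det_on (insert v V) M = M v v * det_on V (\<lambda>i j. M i j - M i v * M v j / M v v)"
proof -
  obtain vs where vs: "distinct vs" "set vs = V" using finite_distinct_list[OF assms(1)] by blast
  have "det_on (insert v V) M = det (list_mat (v # vs) M)"
    using vs assms(2) by (intro det_on_eq) auto
  then show ?thesis using assms(3) by (simp add: det_list_mat_pivot det_on_eq[OF vs])
qed

lemma det_on_image:
  assumes "finite V" "inj_on f V"
  shows "det_on (f ` V) M = det_on V (\<lambda>i j. M (f i) (f j))"
proof -
  obtain vs where vs: "distinct vs" "set vs = V" using finite_distinct_list[OF assms(1)] by blast
  have "det_on (f ` V) M = det (list_mat (map f vs) M)"
    using vs assms(2) by (intro det_on_eq) (auto simp: distinct_map)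
  moreover have "list_mat (map f vs) M = list_mat vs (\<lambda>i j. M (f i) (f j))"
    by (auto simp: list_mat_def intro!: eq_matI)
  ultimately show ?thesis by (simp add: det_on_eq[OF vs])
qed

lemma det_on_pendant:
  assumes V: "finite V" "v \<notin> V" "r \<in> V" and d: "M v v \<noteq> 0"
    and M: "\<And>w. w \<in> V \<Longrightarrow> M v w = (if w = r then -1 else 0) \<and> M w v = (if w = r then -1 else 0)"
  shows "det_on (insert v V) M = M v v * det_on V (M(r := (M r)(r := M r r - 1 / M v v)))"
  unfolding det_on_pivot[of V v M, OF V(1,2) d]
  by (intro arg_cong[of _ _ "(*) (M v v)"] det_on_cong) (use V M d in auto)

section \<open>Elimination of trees\<close>

text \<open>\<open>realises V E r t\<close>: the graph with vertices \<open>V\<close> and arcs \<open>E\<close>, rooted at \<open>r\<close>, has the shape \<open>t\<close>.\<close>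

inductive realises :: "'v set \<Rightarrow> ('v \<times> 'v) set \<Rightarrow> 'v \<Rightarrow> rtree \<Rightarrow> bool" where
  single: "realises {r} {} r (Node [])"
| join: "realises V E r (Node ts) \<Longrightarrow> realises W F s t \<Longrightarrow> V \<inter> W = {} \<Longrightarrow>
    realises (V \<union> W) (insert (r, s) (insert (s, r) (E \<union> F))) r (Node (t # ts))"

lemma realises_basic:
  assumes "realises V E r t"
  shows "finite V" "r \<in> V" "E \<subseteq> V \<times> V" "sym E" "irrefl E"
proof -
  have "finite V \<and> r \<in> V \<and> E \<subseteq> V \<times> V \<and> sym E \<and> irrefl E"
    using assms
  proof induction
    case (join V E r ts W F s t)
    then show ?case by (auto simp: irrefl_def intro!: symI dest: symD)
  qed (auto simp: irrefl_def sym_def)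
  then show "finite V" "r \<in> V" "E \<subseteq> V \<times> V" "sym E" "irrefl E" by auto
qed

lemma realises_finite_arcs: "realises V E r t \<Longrightarrow> finite E"
  using realises_basic(1,3) by (metis finite_SigmaI finite_subset)

abbreviation deg :: "('v \<times> 'v) set \<Rightarrow> 'v \<Rightarrow> nat" where
  "deg E v \<equiv> card (E `` {v})"

lemma det_on_eliminate_tree:
  fixes M :: "'v \<Rightarrow> 'v \<Rightarrow> real" and y :: real
  assumes "realises V E r t" "finite U" "U \<inter> V = {}" "y > 0"
    and "\<And>v w. v \<in> V \<Longrightarrow> w \<in> V \<Longrightarrow> v \<noteq> w \<Longrightarrow> M v w = (if (v, w) \<in> E then -1 else 0)"
    and "\<And>v. v \<in> V - {r} \<Longrightarrow> M v v = y + deg E v"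
    and "\<And>v w. v \<in> V - {r} \<Longrightarrow> w \<in> U \<Longrightarrow> M v w = 0 \<and> M w v = 0"
  shows "det_on (U \<union> V) M = poly (snd (weight t)) y *
    det_on (insert r U) (M(r := (M r)(r :=
      M r r - y - deg E r + poly (fst (weight t)) y / poly (snd (weight t)) y)))"
  using assms
proof (induction arbitrary: U M)
  case (single r)
  have "det_on (insert r U) M = det_on (insert r U) (M(r := (M r)(r := M r r - y - 0 + y / 1)))"
    by (rule arg_cong[of _ _ "det_on _"]) auto
  then show ?case by simp
next
  case (join V E r ts W F s t)
  note V = realises_basic[OF join.hyps(1)] and W = realises_basic[OF join.hyps(2)]
  let ?E = "insert (r, s) (insert (s, r) (E \<union> F))"
  let ?a = "poly (fst (weight (Node ts))) y" and ?b = "poly (snd (weight (Node ts))) y"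
  let ?c = "poly (fst (weight t)) y" and ?d = "poly (snd (weight t)) y"
  have pos: "?a > 0" "?b > 0" "?c > 0" "?d > 0"
    using join.prems(3) by (simp_all only: poly_pos_coeffs pos_coeffs_tree)
  have w: "weight (Node (t # ts)) = (fst (weight (Node ts)) * (fst (weight t) + snd (weight t))
      + snd (weight (Node ts)) * fst (weight t), snd (weight (Node ts)) * (fst (weight t) + snd (weight t)))"
    by (cases "weight (Node ts)"; cases "weight t") (simp add: weight_Node_Cons)
  have rs: "r \<noteq> s" "s \<notin> V" "r \<notin> W" "s \<in> W" "r \<in> V"
    using V(2) W(2) join.hyps(3) by auto
  have finE: "finite E" "finite F" 
    by (rule realises_finite_arcs[OF join.hyps(1)], rule realises_finite_arcs[OF join.hyps(2)])
  have imE: "?E `` {v} = E `` {v}" if "v \<in> V - {r}" for v using that V(3) W(3) rs join.hyps(3) by auto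
  have imF: "?E `` {v} = F `` {v}" if "v \<in> W - {s}" for v using that V(3) W(3) rs join.hyps(3) by auto
  have "?E `` {s} = insert r (F `` {s})" "?E `` {r} = insert s (E `` {r})"
    using V(3) W(3) rs join.hyps(3) by auto
  moreover have "r \<notin> F `` {s}" "s \<notin> E `` {r}" using V(3) W(3) rs by auto
  ultimately have deg_s: "deg ?E s = Suc (deg F s)" and deg_r: "deg ?E r = Suc (deg E r)"
    using finE by simp_all
  have Msr: "M s v = (if v = r then -1 else 0) \<and> M v s = (if v = r then -1 else 0)"
    if "v \<in> U \<union> V" for v
  proof (cases "v \<in> U")
    case True
    then have "M s v = 0 \<and> M v s = 0" using join.prems(6)[of s v] rs by auto
    then show ?thesis using True join.prems(2) rs by auto
  next
    case False
    then have v: "v \<in> V" using that by simp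
    then have "v \<noteq> s" using rs by auto
    moreover have "(s, v) \<in> ?E \<longleftrightarrow> v = r" "(v, s) \<in> ?E \<longleftrightarrow> v = r" using v V(3) W(3) rs join.hyps(3) by auto
    ultimately show ?thesis
      using join.prems(4)[of s v] join.prems(4)[of v s] v rs by simp
  qed
  have 1: "det_on ((U \<union> V) \<union> W) M = ?d * det_on (insert s (U \<union> V))
    (M(s := (M s)(s := M s s - y - deg F s + ?c / ?d)))"
  proof (rule join.IH(2))
    show "finite (U \<union> V)" "(U \<union> V) \<inter> W = {}" "y > 0" using join.prems join.hyps(3) V(1) by auto
    show "M v w = (if (v, w) \<in> F then -1 else 0)" if "v \<in> W" "w \<in> W" "v \<noteq> w" for v w
    proof -
      have "(v, w) \<in> ?E \<longleftrightarrow> (v, w) \<in> F" using that V(3) rs join.hyps(3) by auto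
      then show ?thesis using join.prems(4)[of v w] that by simp
    qed
    show "M v v = y + deg F v" if "v \<in> W - {s}" for v
      using join.prems(5)[of v] imF[OF that] that rs by auto
    show "M v w = 0 \<and> M w v = 0" if vw: "v \<in> W - {s}" "w \<in> U \<union> V" for v w
    proof (cases "w \<in> U")
      case True
      then show ?thesis using join.prems(6)[of v w] vw rs by auto
    next
      case False
      then have w: "w \<in> V" using vw by simp
      then have "(v, w) \<notin> ?E" "(w, v) \<notin> ?E" "v \<noteq> w" using vw V(3) W(3) rs join.hyps(3) by auto
      then show ?thesis using join.prems(4)[of v w] join.prems(4)[of w v] vw w by simp
    qed
  qed
  define N where "N = M(s := (M s)(s := 1 + ?c / ?d))"
  have Ms: "M s s = y + deg F s + 1" using join.prems(5)[of s] rs deg_s by simp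
  have 2: "det_on (insert s (U \<union> V)) N = (1 + ?c / ?d) * det_on (U \<union> V) (N(r := (N r)(r := N r r - 1 / (1 + ?c / ?d))))"
  proof -
    have Nss: "N s s = 1 + ?c / ?d" by (simp add: N_def)
    have "N s s > 0" unfolding Nss using pos by (simp add: add_pos_pos)
    then have "det_on (insert s (U \<union> V)) N = N s s * det_on (U \<union> V) (N(r := (N r)(r := N r r - 1 / N s s)))"
      using Msr rs join.prems(1,2) V(1)
      by (intro det_on_pendant) (auto simp: N_def)
    then show ?thesis unfolding Nss .
  qed
  define K where "K = M(r := (M r)(r := M r r - ?d / (?c + ?d)))"
  have 3: "det_on (U \<union> V) (N(r := (N r)(r := N r r - 1 / (1 + ?c / ?d)))) = det_on (U \<union> V) K"
  proof (rule det_on_cong)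
    have sU: "s \<notin> U \<union> V" using join.prems(2) rs by auto
    fix i j assume "i \<in> U \<union> V" "j \<in> U \<union> V"
    then have "i \<noteq> s" "j \<noteq> s" using sU by auto
    then show "(N(r := (N r)(r := N r r - 1 / (1 + ?c / ?d)))) i j = K i j"
      using rs pos by (auto simp: N_def K_def field_simps)
  qed (use join.prems(1) V(1) in auto)
  have 4: "det_on (U \<union> V) K = ?b * det_on (insert r U) (K(r := (K r)(r := K r r - y - deg E r + ?a / ?b)))"
  proof (rule join.IH(1))
    show "finite U" "U \<inter> V = {}" "y > 0" using join.prems by auto
    show "K v w = (if (v, w) \<in> E then -1 else 0)" if "v \<in> V" "w \<in> V" "v \<noteq> w" for v w
    proof -
      have "(v, w) \<in> ?E \<longleftrightarrow> (v, w) \<in> E" using that W(3) rs join.hyps(3) by auto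
      then show ?thesis using join.prems(4)[of v w] that by (auto simp: K_def)
    qed
    show "K v v = y + deg E v" if "v \<in> V - {r}" for v
      using join.prems(5)[of v] imE[OF that] that by (auto simp: K_def)
    show "K v w = 0 \<and> K w v = 0" if "v \<in> V - {r}" "w \<in> U" for v w
      using join.prems(6)[of v w] that join.prems(2) rs by (auto simp: K_def)
  qed
  have 5: "K(r := (K r)(r := K r r - y - deg E r + ?a / ?b))
    = M(r := (M r)(r := M r r - y - deg ?E r + poly (fst (weight (Node (t # ts)))) y / poly (snd (weight (Node (t # ts)))) y))"
  proof -
    have "- (?d / (?c + ?d)) + 1 + ?a / ?b = (?a * (?c + ?d) + ?b * ?c) / (?b * (?c + ?d))"
      using pos by (simp add: field_simps add_pos_pos less_imp_neq[symmetric])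
    then have "M r r - ?d / (?c + ?d) - y - deg E r + ?a / ?b
      = M r r - y - deg ?E r + poly (fst (weight (Node (t # ts)))) y / poly (snd (weight (Node (t # ts)))) y"
      by (simp add: w deg_r)
    then show ?thesis by (simp only: K_def fun_upd_same fun_upd_upd)
  qed
  have "det_on (U \<union> (V \<union> W)) M = ?d * ((1 + ?c / ?d) * (?b * det_on (insert r U) (K(r := (K r)(r := K r r - y - deg E r + ?a / ?b)))))"
    using 1 2 3 4 Ms by (simp add: N_def Un_assoc)
  also have "\<dots> = (?b * (?c + ?d)) * det_on (insert r U) (K(r := (K r)(r := K r r - y - deg E r + ?a / ?b)))"
    using pos by (simp add: field_simps)
  also have "?b * (?c + ?d) = poly (snd (weight (Node (t # ts)))) y"
    by (simp add: w)
  finally show ?case by (simp only: 5)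
qed

section \<open>The Laplacian polynomial of a cycle with attached trees\<close>

type_synonym rmat2 = "real \<times> real \<times> real \<times> real"

fun rtimes2 :: "rmat2 \<Rightarrow> rmat2 \<Rightarrow> rmat2" where
  "rtimes2 (a, b, c, d) (a', b', c', d') =
    (a * a' + b * c', a * b' + b * d', c * a' + d * c', c * b' + d * d')"

fun rchain :: "real list \<Rightarrow> rmat2" where
  "rchain [] = (1, 0, 0, 1)"
| "rchain (d # ds) = rtimes2 (rchain ds) (1 + d, 1, d, 1)"

lemma chain_eval:
  assumes "\<And>w. w \<in> set ws \<Longrightarrow> poly (snd w) y \<noteq> 0"
  shows "case rchain (map (\<lambda>w. poly (fst w) y / poly (snd w) y) ws) of (a, b, c, d) \<Rightarrow>
    case chain ws of (a', b', c', d') \<Rightarrow>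
      poly a' y = poly (snd_prod ws) y * a \<and> poly b' y = poly (snd_prod ws) y * b \<and>
      poly c' y = poly (snd_prod ws) y * c \<and> poly d' y = poly (snd_prod ws) y * d"
  using assms
proof (induction ws)
  case (Cons w ws)
  obtain a b c d where r: "rchain (map (\<lambda>w. poly (fst w) y / poly (snd w) y) ws) = (a, b, c, d)"
    by (metis prod_cases4)
  obtain a' b' c' d' where c: "chain ws = (a', b', c', d')" by (metis prod_cases4)
  obtain p q where w: "w = (p, q)" by (metis surj_pair)
  have "poly q y \<noteq> 0" using Cons.prems[of w] w by simp
  then show ?case using Cons by (simp add: r c w) (simp add: field_simps)
qed simp

lemma cycle_poly_eval:
  assumes "\<And>w. w \<in> set ws \<Longrightarrow> poly (snd w) y \<noteq> 0"
  shows "poly (cycle_poly ws) y = poly (snd_prod ws) y *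
    (case rchain (map (\<lambda>w. poly (fst w) y / poly (snd w) y) ws) of (a, b, c, d) \<Rightarrow> a + d - 2)"
proof -
  obtain a b c d where r: "rchain (map (\<lambda>w. poly (fst w) y / poly (snd w) y) ws) = (a, b, c, d)"
    by (metis prod_cases4)
  obtain a' b' c' d' where c: "chain ws = (a', b', c', d')" by (metis prod_cases4)
  show ?thesis using chain_eval[of ws y, OF assms] by (simp add: r c cycle_poly.simps algebra_simps)
qed

text \<open>The vertices \<open>1, \<dots>, j - 1\<close> of a cycle on \<open>0, \<dots>, k\<close> have been eliminated, which leaves
  entries \<open>e\<close> and \<open>f\<close> at the vertices \<open>0\<close> and \<open>j\<close> and \<open>- h\<close> between them.\<close>

lemma det_on_partial_cycle:
  fixes M :: "nat \<Rightarrow> nat \<Rightarrow> real" and d :: "nat \<Rightarrow> real" and e f h :: real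
  assumes "1 \<le> j" "j \<le> k" "1 < f" "\<And>i. 0 < d i"
    and "M 0 0 = e" "M j j = f" "\<And>i. j < i \<Longrightarrow> i \<le> k \<Longrightarrow> M i i = 2 + d i"
    and "\<And>i. j \<le> i \<Longrightarrow> i \<le> k \<Longrightarrow> M 0 i = - ((if i = j then h else 0) + (if i = k then 1 else 0)) \<and> M i 0 = M 0 i"
    and "\<And>i l. j \<le> i \<Longrightarrow> i \<le> k \<Longrightarrow> j \<le> l \<Longrightarrow> l \<le> k \<Longrightarrow> i \<noteq> l \<Longrightarrow>
      M i l = (if i = Suc l \<or> l = Suc i then -1 else 0)"
  shows "det_on (insert 0 {j..k}) M = (case rchain (map d [Suc j..<Suc k]) of (a, b, c, b') \<Rightarrow>
    e * ((a + b) * f - b) + f * (c + b' - a - b) - h\<^sup>2 * (a + b) + (b - b') - 2 * h)"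
  using assms
proof (induction "k - j" arbitrary: j e f h M)
  case 0
  then have k: "k = j" by simp
  have f: "M j j \<noteq> 0" using "0.prems" by auto
  have "det_on (insert j {0}) M = M j j * det_on {0} (\<lambda>i l. M i l - M i j * M j l / M j j)"
    using "0.prems" f by (intro det_on_pivot) auto
  also have "det_on {0} (\<lambda>i l. M i l - M i j * M j l / M j j) = M 0 0 - M 0 j * M j 0 / M j j"
  proof -
    have "det_on {0} N = N 0 0" for N :: "nat \<Rightarrow> nat \<Rightarrow> real"
      by (subst det_on_eq[of "[0]"]) (simp_all add: list_mat_def det_single)
    then show ?thesis .
  qed
  also have "insert j {0} = insert 0 {j..k}" using k by auto
  finally have eq: "det_on (insert 0 {j..k}) M = M j j * (M 0 0 - M 0 j * M j 0 / M j j)" .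
  have "det_on (insert 0 {j..k}) M = f * (e - (h + 1)\<^sup>2 / f)"
  proof -
    have "M 0 j = - (h + 1)" "M j 0 = - (h + 1)" using "0.prems"(8)[of j] k by auto
    then have "M 0 j * M j 0 = (h + 1)\<^sup>2" by (simp only: power2_eq_square minus_mult_minus)
    with eq show ?thesis using "0.prems"(5,6) by simp
  qed
  also have "\<dots> = e * f - (h + 1)\<^sup>2" using f "0.prems"(6) by (simp add: right_diff_distrib)
  finally show ?case using k by (simp add: power2_eq_square algebra_simps)
next
  case (Suc m)
  have jk: "j < k" using Suc.hyps(2) by simp
  note prems = Suc.prems
  have Mj: "M j i = (if i = Suc j then -1 else 0)" "M i j = (if i = Suc j then -1 else 0)"
    if "Suc j \<le> i" "i \<le> k" for i
    using prems(9)[of j i] prems(9)[of i j] that jk by auto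
  have M0: "M 0 j = - h" "M j 0 = - h" using prems(8)[of j] jk by auto
  define N where "N = (\<lambda>i l. M i l - M i j * M j l / M j j)"
  have "insert 0 {j..k} = insert j (insert 0 {Suc j..k})" using jk by auto
  then have "det_on (insert 0 {j..k}) M = f * det_on (insert 0 {Suc j..k}) N"
    using det_on_pivot[of "insert 0 {Suc j..k}" j M] prems(1,3,6) by (simp add: N_def)
  also have "det_on (insert 0 {Suc j..k}) N = (case rchain (map d [Suc (Suc j)..<Suc k]) of (a, b, c, b') \<Rightarrow>
    (e - h\<^sup>2 / f) * ((a + b) * (2 + d (Suc j) - 1 / f) - b) + (2 + d (Suc j) - 1 / f) * (c + b' - a - b)
      - (h / f)\<^sup>2 * (a + b) + (b - b') - 2 * (h / f))"
  proof (rule Suc.hyps(1))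
    show "m = k - Suc j" "1 \<le> Suc j" "Suc j \<le> k" using Suc.hyps(2) by auto
    have "1 / f < 1" using prems(3) by simp
    then show "1 < 2 + d (Suc j) - 1 / f" using prems(4)[of "Suc j"] by simp
    show "0 < d i" for i by (rule prems(4))
    show "N 0 0 = e - h\<^sup>2 / f" using prems(5,6) M0 by (simp add: N_def power2_eq_square)
    show "N (Suc j) (Suc j) = 2 + d (Suc j) - 1 / f"
      using prems(6,7) Mj[of "Suc j"] jk by (simp add: N_def)
    show "N i i = 2 + d i" if "Suc j < i" "i \<le> k" for i
      using prems(7)[of i] Mj[of i] that by (simp add: N_def)
    show "N 0 i = - ((if i = Suc j then h / f else 0) + (if i = k then 1 else 0)) \<and> N i 0 = N 0 i"
      if "Suc j \<le> i" "i \<le> k" for i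
      using prems(8)[of i] prems(6) Mj[of i] M0 that by (auto simp: N_def)
    show "N i l = (if i = Suc l \<or> l = Suc i then -1 else 0)"
      if "Suc j \<le> i" "i \<le> k" "Suc j \<le> l" "l \<le> k" "i \<noteq> l" for i l
      using prems(9)[of i l] Mj[of i] Mj[of l] that by (auto simp: N_def)
  qed
  finally have eq: "det_on (insert 0 {j..k}) M = f * \<dots>" .
  obtain a b c b' where r: "rchain (map d [Suc (Suc j)..<Suc k]) = (a, b, c, b')" by (metis prod_cases4)
  have "[Suc j..<Suc k] = Suc j # [Suc (Suc j)..<Suc k]" using jk by (simp add: upt_conv_Cons)
  then have r': "rchain (map d [Suc j..<Suc k])
    = (a * (1 + d (Suc j)) + b * d (Suc j), a + b, c * (1 + d (Suc j)) + b' * d (Suc j), c + b')"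
    using r by simp
  define i where "i = 1 / f"
  have fi: "f * i = 1" using prems(3) by (simp add: i_def)
  have div: "x / f = x * i" for x by (simp add: i_def)
  have ex: "f * ((e - h\<^sup>2 * i) * ((a + b) * (2 + D - 1 * i) - b) + (2 + D - 1 * i) * (c + b' - a - b)
      - (h * i)\<^sup>2 * (a + b) + (b - b') - 2 * (h * i))
    = e * f * ((a + b) * (2 + D) - b) + f * (2 + D) * (c + b' - a - b) + f * (b - b')
      - (f * i) * (e * (a + b) + h\<^sup>2 * ((a + b) * (2 + D) - b) + (c + b' - a - b) + 2 * h)" for D
    by (simp add: algebra_simps power2_eq_square)
  show ?case unfolding eq r r' div prod.case ex fi
    by (simp add: algebra_simps)
qed

definition cyclic :: "nat \<Rightarrow> nat \<Rightarrow> nat \<Rightarrow> bool" where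
  "cyclic g i j \<longleftrightarrow> i < g \<and> j < g \<and> (j = Suc i mod g \<or> i = Suc j mod g)"

lemma cyclic_iff:
  assumes "3 \<le> g" "i < j" "j < g"
  shows "cyclic g i j \<longleftrightarrow> j = Suc i \<or> i = 0 \<and> Suc j = g" "cyclic g j i \<longleftrightarrow> j = Suc i \<or> i = 0 \<and> Suc j = g"
proof -
  have "Suc i mod g = Suc i" using assms by simp
  moreover have "Suc j mod g = (if Suc j = g then 0 else Suc j)" using assms by auto
  ultimately show "cyclic g i j \<longleftrightarrow> j = Suc i \<or> i = 0 \<and> Suc j = g" "cyclic g j i \<longleftrightarrow> j = Suc i \<or> i = 0 \<and> Suc j = g"
    using assms by (auto simp: cyclic_def)
qed

lemma cyclic_irrefl: "3 \<le> g \<Longrightarrow> \<not> cyclic g i i"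
  by (cases "Suc i = g") (auto simp: cyclic_def)

lemma card_cyclic:
  assumes "3 \<le> g" "i < g"
  shows "card {j. cyclic g i j} = 2"
proof -
  have "{j. cyclic g i j} = {if Suc i = g then 0 else Suc i, if i = 0 then g - 1 else i - 1}"
  proof (rule Set.set_eqI)
    fix j
    consider "j \<ge> g" | "j = i" | "j < i" | "i < j" "j < g" by linarith
    then show "j \<in> {j. cyclic g i j} \<longleftrightarrow> j \<in> {if Suc i = g then 0 else Suc i, if i = 0 then g - 1 else i - 1}"
    proof cases
      case 1
      then show ?thesis using assms by (auto simp: cyclic_def)
    next
      case 2
      then show ?thesis using assms cyclic_irrefl[of g i] by auto
    next
      case 3
      then show ?thesis using assms cyclic_iff(2)[of g j i] by auto
    next
      case 4
      then show ?thesis using assms cyclic_iff(1)[of g i j] by auto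
    qed
  qed
  moreover have "(if Suc i = g then 0 else Suc i) \<noteq> (if i = 0 then g - 1 else i - 1)"
    using assms by auto
  ultimately show ?thesis by simp
qed

lemma det_on_cycle:
  fixes d :: "nat \<Rightarrow> real"
  assumes g: "3 \<le> g" and d: "\<And>i. 0 < d i"
    and M: "\<And>i j. i < g \<Longrightarrow> j < g \<Longrightarrow> M i j = (if i = j then 2 + d i else if cyclic g i j then -1 else 0)"
  shows "det_on {..<g} M = (case rchain (map d [0..<g]) of (a, b, c, b') \<Rightarrow> a + b' - 2)"
proof -
  define k where "k = g - 1"
  have k: "g = Suc k" "2 \<le> k" using g by (auto simp: k_def)
  obtain a b c b' where r: "rchain (map d [Suc 1..<Suc k]) = (a, b, c, b')" by (metis prod_cases4)
  have set: "{..<g} = insert 0 {1..k}" using k by auto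
  have step: "det_on (insert 0 {1..k}) M = (case rchain (map d [Suc 1..<Suc k]) of (a, b, c, b') \<Rightarrow>
    (2 + d 0) * ((a + b) * (2 + d 1) - b) + (2 + d 1) * (c + b' - a - b) - 1\<^sup>2 * (a + b) + (b - b') - 2 * 1)"
  proof (rule det_on_partial_cycle[where e = "2 + d 0" and f = "2 + d 1" and h = 1 and j = 1 and k = k and M = M and d = d])
    show "1 < 2 + d 1" using d[of 1] by simp
    show "M 0 i = - ((if i = 1 then 1 else 0) + (if i = k then 1 else 0)) \<and> M i 0 = M 0 i"
      if "1 \<le> i" "i \<le> k" for i
      using M[of 0 i] M[of i 0] cyclic_iff[OF g, of 0 i] that k by (simp add: eq_commute[of 0 i])
    show "M i l = (if i = Suc l \<or> l = Suc i then -1 else 0)"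
      if "1 \<le> i" "i \<le> k" "1 \<le> l" "l \<le> k" "i \<noteq> l" for i l
      using M[of i l] cyclic_iff[OF g, of i l] cyclic_iff[OF g, of l i] that k
      by (cases "i < l") auto
    show "(1::nat) \<le> 1" "1 \<le> k" "0 < d i" for i using k d by simp_all
    show "M 0 0 = 2 + d 0" "M 1 1 = 2 + d 1" using M[of 0 0] M[of 1 1] k by simp_all
    show "M i i = 2 + d i" if "1 < i" "i \<le> k" for i using M[of i i] that k by simp
  qed
  have *: "det_on {..<g} M = (2 + d 0) * ((a + b) * (2 + d 1) - b) + (2 + d 1) * (c + b' - a - b)
     - (a + b) + (b - b') - 2"
    unfolding set step unfolding r by simp
  have "[0..<g] = 0 # 1 # [Suc 1..<Suc k]" using k by (simp add: upt_conv_Cons)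
  then have "rchain (map d [0..<g]) = rtimes2 (rtimes2 (a, b, c, b') (1 + d 1, 1, d 1, 1)) (1 + d 0, 1, d 0, 1)"
    using r by simp
  then show ?thesis unfolding * by (simp add: algebra_simps)
qed

lemma realises_image:
  assumes "realises V E r t" "inj_on f V"
  shows "realises (f ` V) (map_prod f f ` E) (f r) t"
  using assms
proof (induction rule: realises.induct)
  case (single r)
  then show ?case by (simp add: realises.single)
next
  case (join V E r ts W F s t)
  have "f ` V \<inter> f ` W = {}" using join.hyps(3) join.prems by (auto simp: inj_on_def)
  moreover have "inj_on f V" "inj_on f W" using join.prems by (auto simp: inj_on_Un)
  ultimately have "realises (f ` V \<union> f ` W)
    (insert (f r, f s) (insert (f s, f r) (map_prod f f ` E \<union> map_prod f f ` F))) (f r) (Node (t # ts))"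
    using join.IH by (intro realises.join)
  then show ?case by (simp add: image_Un)
qed

definition laplacian_fun :: "('v \<times> 'v) set \<Rightarrow> real \<Rightarrow> 'v \<Rightarrow> 'v \<Rightarrow> real" where
  "laplacian_fun E y v w = (if v = w then y + deg E v else 0) - (if (v, w) \<in> E then 1 else 0)"

lemma out_degree_with_proj: "out_degree (with_proj G) v = deg (parcs G) v"
proof -
  have "out_arcs (with_proj G) v = Pair v ` (parcs G `` {v})" by (auto simp: out_arcs_def)
  then show ?thesis by (simp add: out_degree_def card_image inj_on_def)
qed

lemma coeff_eq_lap_coeff:
  assumes fin: "finite (pverts G)"
    and p: "\<And>y. 0 < y \<Longrightarrow> det_on (pverts G) (laplacian_fun (parcs G) y) = poly p y"
  shows "p = (\<Sum>k\<le>card (pverts G). monom (lap_coeff G k) (card (pverts G) - k))"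
proof -
  define n where "n = card (pverts G)"
  define q where "q = (\<Sum>k\<le>n. monom (lap_coeff G k) (n - k))"
  obtain vs where vs: "distinct vs" "set vs = pverts G" using finite_distinct_list[OF fin] by blast
  have len: "length vs = n" using vs by (metis distinct_card n_def)
  define A where "A = laplacian_wrt G vs"
  have A: "A \<in> carrier_mat n n" using laplacian_wrt_carrier[of G vs] len by (simp add: A_def)
  have "poly q y = poly p y" if y: "0 < y" for y
  proof -
    have "poly (char_poly (laplacian G)) (- y) = (\<Sum>k\<le>n. (-1) ^ k * lap_coeff G k * (- y) ^ (n - k))"
      by (subst char_poly_laplacian_sum[OF fin]) (simp add: poly_sum poly_monom n_def)
    also have "\<dots> = (\<Sum>k\<le>n. (-1) ^ n * (lap_coeff G k * y ^ (n - k)))"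
    proof (rule sum.cong[OF refl])
      fix k assume "k \<in> {..n}"
      then have "(-1) ^ k * (- y) ^ (n - k) = (-1) ^ n * y ^ (n - k)"
        by (simp add: power_minus[of y] mult.assoc[symmetric] power_add[symmetric])
      then show "(-1) ^ k * lap_coeff G k * (- y) ^ (n - k) = (-1) ^ n * (lap_coeff G k * y ^ (n - k))"
        by (simp add: mult_ac)
    qed
    also have "\<dots> = (-1) ^ n * poly q y"
      by (simp add: q_def poly_sum poly_monom sum_distrib_left)
    finally have 1: "poly (char_poly A) (- y) = (-1) ^ n * poly q y"
      using char_poly_laplacian[OF vs] by (simp add: A_def)
    have "- char_matrix A (- y) = (-1) \<cdot>\<^sub>m list_mat vs (laplacian_fun (parcs G) y)"
    proof (rule eq_matI)
      fix i j assume "i < dim_row ((-1) \<cdot>\<^sub>m list_mat vs (laplacian_fun (parcs G) y))"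
        "j < dim_col ((-1) \<cdot>\<^sub>m list_mat vs (laplacian_fun (parcs G) y))"
      then have ij: "i < n" "j < n" by (simp_all add: list_mat_def len)
      then show "(- char_matrix A (- y)) $$ (i, j) = ((-1) \<cdot>\<^sub>m list_mat vs (laplacian_fun (parcs G) y)) $$ (i, j)"
        using A vs(1) len by (simp add: char_matrix_def list_mat_def laplacian_fun_def A_def
          laplacian_wrt_index out_degree_with_proj nth_eq_iff_index_eq)
    qed (use A len in \<open>auto simp: char_matrix_def list_mat_def\<close>)
    then have "poly (char_poly A) (- y) = (-1) ^ n * det (list_mat vs (laplacian_fun (parcs G) y))"
      using char_poly_matrix[OF A, of "- y"] len by (simp add: list_mat_def)
    then show ?thesis using 1 p[OF y] det_on_eq[OF vs, of "laplacian_fun (parcs G) y"] by simp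
  qed
  then have "{0<..} \<subseteq> {y. poly (q - p) y = 0}" by auto
  then have "q - p = 0"
    using poly_roots_finite[of "q - p"] infinite_Ioi[of "0::real"] finite_subset by blast
  then show ?thesis by (simp add: q_def n_def)
qed

lemma parcs_cycle_attach:
  "(p, q) \<in> parcs (cycle_attach g T u) \<longleftrightarrow>
    fst p = fst q \<and> fst p < g \<and> (snd p, snd q) \<in> parcs (T (fst p)) \<or>
    cyclic g (fst p) (fst q) \<and> snd p = u (fst p) \<and> snd q = u (fst q)"
  by (cases p; cases q) (auto simp: cycle_attach_def disj_union_def cyclic_def)

lemma pverts_cycle_attach: "pverts (cycle_attach g T u) = (SIGMA i:{..<g}. pverts (T i))"
  by (simp add: cycle_attach_def disj_union_def)

lemma deg_cycle_attach:
  assumes "3 \<le> g" "i < g" "finite (parcs (T i))"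
  shows "deg (parcs (cycle_attach g T u)) (i, x) = deg (parcs (T i)) x + (if x = u i then 2 else 0)"
proof -
  have "parcs (cycle_attach g T u) `` {(i, x)} =
    Pair i ` (parcs (T i) `` {x}) \<union> (if x = u i then (\<lambda>j. (j, u j)) ` {j. cyclic g i j} else {})"
    using assms(2) by (auto simp: parcs_cycle_attach image_iff)
  moreover have "finite (parcs (T i) `` {x})" using assms(3) by simp
  moreover have "finite {j. cyclic g i j}" by (rule finite_subset[of _ "{..<g}"]) (auto simp: cyclic_def)
  moreover have "Pair i ` (parcs (T i) `` {x}) \<inter> (\<lambda>j. (j, u j)) ` {j. cyclic g i j} = {}"
    using cyclic_irrefl[OF assms(1)] by auto
  moreover have "card (Pair i ` (parcs (T i) `` {x})) = deg (parcs (T i)) x"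
    by (simp add: card_image inj_on_def)
  moreover have "card ((\<lambda>j. (j, u j)) ` {j. cyclic g i j}) = 2"
    using card_cyclic[OF assms(1,2)] by (simp add: card_image inj_on_def)
  ultimately show ?thesis by (auto simp: card_Un_disjoint)
qed

lemma det_on_cycle_attach:
  assumes g: "3 \<le> g" and y: "0 < y"
    and R: "\<And>i. i < g \<Longrightarrow> realises (pverts (T i)) (parcs (T i)) (u i) (t i)"
  shows "det_on (pverts (cycle_attach g T u)) (laplacian_fun (parcs (cycle_attach g T u)) y)
    = poly (cycle_of (map t [0..<g])) y"
proof -
  define E where "E = parcs (cycle_attach g T u)"
  define a b where "a = (\<lambda>i. poly (fst (weight (t i))) y)" and "b = (\<lambda>i. poly (snd (weight (t i))) y)"
  have pos: "0 < a i" "0 < b i" for i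
    using y by (simp_all add: a_def b_def poly_pos_coeffs)
  define V where "V = (\<lambda>m. Pair m ` pverts (T m))"
  define W where "W = (\<lambda>m. {p. fst p < g \<and> snd p \<in> pverts (T (fst p)) \<and> (fst p < m \<longrightarrow> snd p = u (fst p))})"
  define L where "L = (\<lambda>m v w. if v = w \<and> fst v < m then 2 + a (fst v) / b (fst v) else laplacian_fun E y v w)"
  have fin: "finite (pverts (T i))" "finite (parcs (T i))" "u i \<in> pverts (T i)"
    "parcs (T i) \<subseteq> pverts (T i) \<times> pverts (T i)" if "i < g" for i
    using realises_basic[OF R[OF that]] realises_finite_arcs[OF R[OF that]] by auto
  have W0: "W 0 = pverts (cycle_attach g T u)" by (auto simp: W_def pverts_cycle_attach)
  have "finite (W 0)" unfolding W0 pverts_cycle_attach using fin by auto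
  then have finW: "finite (W m)" for m by (rule finite_subset[rotated]) (auto simp: W_def)
  have "det_on (W 0) (L 0) = (\<Prod>i<m. b i) * det_on (W m) (L m)" if "m \<le> g" for m
    using that
  proof (induction m)
    case (Suc m)
    then have m: "m < g" by simp
    define U where "U = {p \<in> W m. fst p \<noteq> m}"
    have Wm: "W m = U \<union> V m" using m by (auto simp: U_def W_def V_def)
    have WS: "W (Suc m) = insert (m, u m) U"
      using fin(3)[OF m] m by (auto simp: U_def W_def)
    have Rm: "realises (V m) (map_prod (Pair m) (Pair m) ` parcs (T m)) (m, u m) (t m)"
      unfolding V_def by (rule realises_image[OF R[OF m]]) (simp add: inj_on_def)
    have arc: "((m, x), (m, z)) \<in> E \<longleftrightarrow> (x, z) \<in> parcs (T m)" for x z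
      using m cyclic_irrefl[OF g] by (auto simp: E_def parcs_cycle_attach)
    have mem: "(v, w) \<in> map_prod (Pair m) (Pair m) ` parcs (T m) \<longleftrightarrow> (v, w) \<in> E" if "v \<in> V m" "w \<in> V m" for v w
      using that by (auto simp: V_def arc)
    have im: "(map_prod (Pair m) (Pair m) ` parcs (T m)) `` {(m, x)} = Pair m ` (parcs (T m) `` {x})" for x
      by auto
    have deg: "deg E (m, x) = deg (map_prod (Pair m) (Pair m) ` parcs (T m)) (m, x) + (if x = u m then 2 else 0)" for x
      unfolding im E_def using deg_cycle_attach[of g m T u x, OF g m fin(2)[OF m]]
      by (simp add: card_image inj_on_def)
    have loop: "(v, v) \<notin> E" if "v \<in> V m" for v
      using that realises_basic(5)[OF R[OF m]] arc by (auto simp: V_def irrefl_def)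
    have "det_on (U \<union> V m) (L m) = poly (snd (weight (t m))) y *
      det_on (insert (m, u m) U) ((L m)((m, u m) := (L m (m, u m))((m, u m) :=
        L m (m, u m) (m, u m) - y - deg (map_prod (Pair m) (Pair m) ` parcs (T m)) (m, u m)
          + poly (fst (weight (t m))) y / poly (snd (weight (t m))) y)))"
    proof (rule det_on_eliminate_tree[OF Rm])
      show "finite U" using finW[of m] by (simp add: U_def)
      show "U \<inter> V m = {}" by (auto simp: U_def V_def)
      show "0 < y" by (rule y)
      show "L m v w = (if (v, w) \<in> map_prod (Pair m) (Pair m) ` parcs (T m) then -1 else 0)"
        if "v \<in> V m" "w \<in> V m" "v \<noteq> w" for v w
        using mem[OF that(1,2)] that(3) by (simp add: L_def laplacian_fun_def)
      show "L m v v = y + deg (map_prod (Pair m) (Pair m) ` parcs (T m)) v" if v: "v \<in> V m - {(m, u m)}" for v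
      proof -
        obtain x where x: "v = (m, x)" "x \<noteq> u m" using v by (auto simp: V_def)
        then show ?thesis using deg[of x] loop[of v] v by (simp add: L_def laplacian_fun_def)
      qed
      show "L m v w = 0 \<and> L m w v = 0" if v: "v \<in> V m - {(m, u m)}" and w: "w \<in> U" for v w
      proof -
        obtain x where x: "v = (m, x)" "x \<noteq> u m" using v by (auto simp: V_def)
        then have "(v, w) \<notin> E" "(w, v) \<notin> E" "v \<noteq> w"
          using w by (auto simp: E_def parcs_cycle_attach U_def)
        then show ?thesis by (auto simp: L_def laplacian_fun_def)
      qed
    qed
    also have "det_on (insert (m, u m) U) ((L m)((m, u m) := (L m (m, u m))((m, u m) :=
        L m (m, u m) (m, u m) - y - deg (map_prod (Pair m) (Pair m) ` parcs (T m)) (m, u m)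
          + poly (fst (weight (t m))) y / poly (snd (weight (t m))) y))) = det_on (W (Suc m)) (L (Suc m))"
      unfolding WS
    proof (rule det_on_cong)
      show "finite (insert (m, u m) U)" using finW[of m] by (simp add: U_def)
      have "(m, u m) \<in> V m" using fin(3)[OF m] by (simp add: V_def)
      then have d: "L m (m, u m) (m, u m) = y + deg (map_prod (Pair m) (Pair m) ` parcs (T m)) (m, u m) + 2"
        using loop deg[of "u m"] by (simp add: L_def laplacian_fun_def)
      fix i j assume ij: "i \<in> insert (m, u m) U" "j \<in> insert (m, u m) U"
      have U: "fst p \<noteq> m" if "p \<in> U" for p using that by (simp add: U_def)
      show "((L m)((m, u m) := (L m (m, u m))((m, u m) :=
        L m (m, u m) (m, u m) - y - deg (map_prod (Pair m) (Pair m) ` parcs (T m)) (m, u m)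
          + poly (fst (weight (t m))) y / poly (snd (weight (t m))) y))) i j = L (Suc m) i j"
      proof (cases "i = (m, u m) \<and> j = (m, u m)")
        case True
        then show ?thesis unfolding d by (simp add: L_def a_def b_def)
      next
        case False
        then have "i = j \<Longrightarrow> i \<in> U" using ij by auto
        then have "i = j \<Longrightarrow> fst i \<noteq> m" using U by blast
        then have "L m i j = L (Suc m) i j" by (auto simp: L_def less_Suc_eq)
        then show ?thesis using False by (simp only: fun_upd_apply split: if_split) blast
      qed
    qed
    finally show ?case using Suc Wm by (simp add: b_def mult.assoc)
  qed simp
  from this[of g] have 1: "det_on (W 0) (L 0) = (\<Prod>i<g. b i) * det_on (W g) (L g)" by simp
  have "W g = (\<lambda>i. (i, u i)) ` {..<g}" using fin(3) by (auto simp: W_def)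
  then have "det_on (W g) (L g) = det_on {..<g} (\<lambda>i j. L g (i, u i) (j, u j))"
    by (simp add: det_on_image inj_on_def)
  also have "\<dots> = (case rchain (map (\<lambda>i. a i / b i) [0..<g]) of (a, b, c, d) \<Rightarrow> a + d - 2)"
  proof (rule det_on_cycle[OF g])
    show "0 < a i / b i" for i using pos by simp
    show "L g (i, u i) (j, u j) = (if i = j then 2 + a i / b i else if cyclic g i j then -1 else 0)"
      if "i < g" "j < g" for i j
      using that by (auto simp: L_def laplacian_fun_def E_def parcs_cycle_attach)
  qed
  finally have 2: "det_on (W g) (L g) = (case rchain (map (\<lambda>i. a i / b i) [0..<g]) of (a, b, c, d) \<Rightarrow> a + d - 2)" .
  have ab: "map (\<lambda>i. a i / b i) [0..<g]
    = map (\<lambda>w. poly (fst w) y / poly (snd w) y) (map weight (map t [0..<g]))"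
    by (simp add: a_def b_def)
  have 3: "(\<Prod>i<m. b i) = poly (snd_prod (map weight (map t [0..<m]))) y" for m
    by (induction m) (simp_all add: b_def mult.commute)
  have "poly (cycle_of (map t [0..<g])) y = det_on (W 0) (L 0)"
    unfolding cycle_of_def 1 2 3 ab
  proof (rule cycle_poly_eval)
    fix w assume "w \<in> set (map weight (map t [0..<g]))"
    then obtain s where "w = weight s" by auto
    then show "poly (snd w) y \<noteq> 0"
      using poly_pos_coeffs[OF pos_coeffs_tree(2)[of s] y] by simp
  qed
  moreover have "L 0 = laplacian_fun E y" by (intro ext) (simp add: L_def)
  ultimately show ?thesis by (simp add: W0 E_def)
qed

section \<open>Trees as graphs\<close>

lemma realises_add_leaf:
  assumes "realises V E r t" "p \<in> V" "v \<notin> V"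
  shows "\<exists>t'. realises (insert v V) (insert (p, v) (insert (v, p) E)) r t'"
  using assms
proof induction
  case (single r)
  have "realises ({r} \<union> {v}) (insert (r, v) (insert (v, r) ({} \<union> {}))) r (Node [Node []])"
    using single.prems by (intro realises.intros) auto
  then show ?case using single.prems by (auto simp: insert_commute)
next
  case (join V E r ts W F s t)
  show ?case
  proof (cases "p \<in> V")
    case True
    then obtain t' where t': "realises (insert v V) (insert (p, v) (insert (v, p) E)) r t'"
      using join by auto
    obtain ts' where "t' = Node ts'" by (cases t')
    with t' have "realises (insert v V \<union> W) (insert (r, s) (insert (s, r) (insert (p, v) (insert (v, p) E) \<union> F))) r (Node (t # ts'))"
      using join by (intro realises.join) auto
    moreover have "insert (r, s) (insert (s, r) (insert (p, v) (insert (v, p) E) \<union> F))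
      = insert (p, v) (insert (v, p) (insert (r, s) (insert (s, r) (E \<union> F))))" by auto
    ultimately show ?thesis by auto
  next
    case False
    then obtain t' where t': "realises (insert v W) (insert (p, v) (insert (v, p) F)) s t'"
      using join by auto
    have "realises (V \<union> insert v W) (insert (r, s) (insert (s, r) (E \<union> insert (p, v) (insert (v, p) F)))) r (Node (t' # ts))"
      using join t' by (intro realises.join) auto
    moreover have "insert (r, s) (insert (s, r) (E \<union> insert (p, v) (insert (v, p) F)))
      = insert (p, v) (insert (v, p) (insert (r, s) (insert (s, r) (E \<union> F))))" by auto
    ultimately show ?thesis by auto
  qed
qed

lemma pawalk_verts_append:
  "pcas x p z \<Longrightarrow> pawalk_verts x (p @ (z, s) # q) = pawalk_verts x p @ pawalk_verts s q"
  by (induction p arbitrary: x) auto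

lemma pcas_append: "pcas x (p @ q) z \<longleftrightarrow> (\<exists>w. pcas x p w \<and> pcas w q z)"
  by (induction p arbitrary: x) auto

lemma set_pawalk_verts: "set p \<subseteq> V \<times> V \<Longrightarrow> x \<in> V \<Longrightarrow> set (pawalk_verts x p) \<subseteq> V"
  by (induction p arbitrary: x) (simp, fastforce)

lemma realises_path:
  assumes "realises V E r t" "x \<in> V" "z \<in> V"
  shows "\<exists>p. pcas x p z \<and> set p \<subseteq> E \<and> distinct (pawalk_verts x p)"
  using assms
proof (induction arbitrary: x z)
  case (single r)
  then show ?case by (intro exI[of _ "[]"]) auto
next
  case (join V E r ts W F s t)
  note V = realises_basic[OF join.hyps(1)] and W = realises_basic[OF join.hyps(2)]
  have disj: "distinct (pawalk_verts x p @ pawalk_verts z q)"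
    if "set p \<subseteq> A" "set q \<subseteq> B" "A \<subseteq> S \<times> S" "B \<subseteq> S' \<times> S'" "x \<in> S" "z \<in> S'" "S \<inter> S' = {}"
      "distinct (pawalk_verts x p)" "distinct (pawalk_verts z q)" for x z p q A B S S'
  proof -
    have "set (pawalk_verts x p) \<subseteq> S" "set (pawalk_verts z q) \<subseteq> S'"
      using that by (intro set_pawalk_verts; blast)+
    then show ?thesis using that(7-9) by auto
  qed
  consider "x \<in> V" "z \<in> V" | "x \<in> V" "z \<in> W" | "x \<in> W" "z \<in> V" | "x \<in> W" "z \<in> W"
    using join.prems by blast
  then show ?case
  proof cases
    case 1
    then show ?thesis using join.IH(1)[of x z] by blast
  next
    case 2
    obtain p where p: "pcas x p r" "set p \<subseteq> E" "distinct (pawalk_verts x p)" using join.IH(1)[of x r] V 2 by blast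
    obtain q where q: "pcas s q z" "set q \<subseteq> F" "distinct (pawalk_verts s q)" using join.IH(2)[of s z] W 2 by blast
    have "distinct (pawalk_verts x p @ pawalk_verts s q)"
      by (rule disj[OF p(2) q(2) V(3) W(3) 2(1) W(2) join.hyps(3) p(3) q(3)])
    then show ?thesis using p q
      by (intro exI[of _ "p @ (r, s) # q"]) (auto simp: pawalk_verts_append pcas_append)
  next
    case 3
    obtain p where p: "pcas x p s" "set p \<subseteq> F" "distinct (pawalk_verts x p)" using join.IH(2)[of x s] W 3 by blast
    obtain q where q: "pcas r q z" "set q \<subseteq> E" "distinct (pawalk_verts r q)" using join.IH(1)[of r z] V 3 by blast
    have "W \<inter> V = {}" using join.hyps(3) by auto
    then have "distinct (pawalk_verts x p @ pawalk_verts r q)"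
      by (rule disj[OF p(2) q(2) W(3) V(3) 3(1) V(2) _ p(3) q(3)])
    then show ?thesis using p q
      by (intro exI[of _ "p @ (s, r) # q"]) (auto simp: pawalk_verts_append pcas_append)
  next
    case 4
    then show ?thesis using join.IH(2)[of x z] by blast
  qed
qed

lemma is_tree_imp_realises:
  assumes T: "is_tree T" and r: "r \<in> pverts T"
  shows "\<exists>t. realises (pverts T) (parcs T) r t"
proof -
  interpret pair_graph T using T by (simp add: is_tree_def)
  have sym: "sym (parcs T)" using sym_arcs by (simp add: symmetric_def)
  define P where "P = (\<lambda>S. S \<subseteq> pverts T \<and> (\<exists>E t. E \<subseteq> parcs T \<and> realises S E r t))"
  have "finite {S. P S}"
    by (rule finite_subset[of _ "Pow (pverts T)"]) (auto simp: P_def pair_finite_verts)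
  moreover have "P {r}" using r realises.single[of r] unfolding P_def by blast
  ultimately obtain S where S: "P S" "\<And>S'. P S' \<Longrightarrow> S \<subseteq> S' \<Longrightarrow> S' = S"
    using finite_has_maximal[of "{S. P S}"] by (metis empty_iff mem_Collect_eq)
  obtain E t where E: "E \<subseteq> parcs T" "realises S E r t" "S \<subseteq> pverts T" using S(1) by (auto simp: P_def)
  note basic = realises_basic[OF E(2)]
  have closed: "w \<in> S" if v: "v \<in> S" and vw: "(v, w) \<in> parcs T" for v w
  proof (rule ccontr)
    assume w: "w \<notin> S"
    obtain t' where t': "realises (insert w S) (insert (v, w) (insert (w, v) E)) r t'"
      using realises_add_leaf[OF E(2) v w] by blast
    have "(w, v) \<in> parcs T" using sym vw by (rule symD)
    then have "insert (v, w) (insert (w, v) E) \<subseteq> parcs T" using E(1) vw by simp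
    moreover have "insert w S \<subseteq> pverts T" using E(3) in_arcsD2[OF vw] by simp
    ultimately have "P (insert w S)" unfolding P_def using t' by (intro conjI exI)
    then show False using S(2)[of "insert w S"] w by auto
  qed
  have "S = pverts T"
  proof
    show "pverts T \<subseteq> S"
    proof
      fix v assume v: "v \<in> pverts T"
      have "strongly_connected (with_proj (mk_symmetric (with_proj T)))"
        using T by (simp add: is_tree_def connected_def)
      then have "r \<rightarrow>\<^sup>*\<^bsub>with_proj (mk_symmetric (with_proj T))\<^esub> v"
        using r v by (simp add: strongly_connected_def)
      then have "r \<rightarrow>\<^sup>*\<^bsub>with_proj T\<^esub> v" using sym_arcs by (simp add: reachable_mk_symmetric_eq)
      then have "(r, v) \<in> (parcs T)\<^sup>*" by (auto dest: reachable_rtranclI)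
      then show "v \<in> S"
        by (induction rule: rtrancl_induct) (use basic(2) closed in auto)
    qed
  qed (rule E(3))
  moreover have "E = parcs T"
  proof (rule ccontr)
    assume "E \<noteq> parcs T"
    then obtain x z where xz: "(x, z) \<in> parcs T" "(x, z) \<notin> E" using E(1) by auto
    have "x \<in> S" "z \<in> S" using xz(1) \<open>S = pverts T\<close> in_arcsD1 in_arcsD2 by blast+
    then obtain p where p: "pcas z p x" "set p \<subseteq> E" "distinct (pawalk_verts z p)"
      using realises_path[OF E(2), of z x] by blast
    have "x \<noteq> z" using xz(1) no_loops' by blast
    have "(z, x) \<notin> E" using xz(2) basic(4) by (auto dest: symD)
    then have "2 \<le> length p"
      using p \<open>x \<noteq> z\<close> by (cases p; cases "tl p") auto
    then have "cycle ((x, z) # p) \<and> 3 \<le> length ((x, z) # p)"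
      unfolding cycle_def awalk_def using p xz E(1) in_arcsD1[OF xz(1)] by (auto intro!: exI[of _ x])
    then have "cycles_of T \<noteq> {}" unfolding cycles_of_def by blast
    then show False using T by (simp add: is_tree_def)
  qed
  ultimately show ?thesis using E(2) by blast
qed

lemma realises_NodeE:
  assumes "realises V E r (Node (t # ts))"
  obtains V' E' W F s where "realises V' E' r (Node ts)" "realises W F s t" "V' \<inter> W = {}"
    "V = V' \<union> W" "E = insert (r, s) (insert (s, r) (E' \<union> F))"
  using assms by (cases rule: realises.cases) auto

lemma realises_move_front:
  "realises V E r (Node (us @ t # vs)) \<Longrightarrow> realises V E r (Node (t # us @ vs))"
proof (induction us arbitrary: V E)
  case (Cons u us)
  from Cons.prems have "realises V E r (Node (u # us @ t # vs))" by simp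
  then obtain V' E' W F s where 1: "realises V' E' r (Node (us @ t # vs))" "realises W F s u"
    "V' \<inter> W = {}" "V = V' \<union> W" "E = insert (r, s) (insert (s, r) (E' \<union> F))"
    by (rule realises_NodeE)
  obtain V'' E'' W' F' s' where 2: "realises V'' E'' r (Node (us @ vs))" "realises W' F' s' t"
    "V'' \<inter> W' = {}" "V' = V'' \<union> W'" "E' = insert (r, s') (insert (s', r) (E'' \<union> F'))"
    using Cons.IH[OF 1(1)] by (rule realises_NodeE)
  have "realises ((V'' \<union> W) \<union> W') (insert (r, s') (insert (s', r)
      (insert (r, s) (insert (s, r) (E'' \<union> F)) \<union> F'))) r (Node (t # u # us @ vs))"
    by (intro realises.join 1 2) (use 1 2 in auto)
  moreover have "(V'' \<union> W) \<union> W' = V" using 1 2 by auto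
  moreover have "insert (r, s') (insert (s', r) (insert (r, s) (insert (s, r) (E'' \<union> F)) \<union> F')) = E"
    unfolding 1(5) 2(5) by auto
  ultimately show ?case by simp
qed simp

lemma realises_mset:
  assumes "realises V E r (Node ts)" "mset ts = mset us"
  shows "realises V E r (Node us)"
  using assms
proof (induction us arbitrary: V E ts)
  case (Cons u us)
  then have "u \<in> set ts" by (metis list.set_intros(1) mset_eq_setD)
  then obtain xs ys where ts: "ts = xs @ u # ys" by (meson split_list)
  from Cons.prems(1) have "realises V E r (Node (u # xs @ ys))"
    unfolding ts by (rule realises_move_front)
  then obtain V' E' W F s where 1: "realises V' E' r (Node (xs @ ys))" "realises W F s u"
    "V' \<inter> W = {}" "V = V' \<union> W" "E = insert (r, s) (insert (s, r) (E' \<union> F))"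
    by (rule realises_NodeE)
  have "mset (xs @ ys) = mset us" using Cons.prems(2) ts by simp
  from realises.join[OF Cons.IH[OF 1(1) this] 1(2,3)] show ?case by (simp only: 1(4,5))
qed simp

lemma realises_spine_mset:
  assumes "realises V E r (spine k (Node ts))" "mset ts = mset us"
  shows "realises V E r (spine k (Node us))"
  using assms(1)
proof (induction k arbitrary: V E r)
  case 0
  then show ?case using realises_mset[OF _ assms(2)] by simp
next
  case (Suc k)
  then have "realises V E r (Node [spine k (Node ts)])" by simp
  then obtain V' E' W F s where 1: "realises V' E' r (Node [])" "realises W F s (spine k (Node ts))"
    "V' \<inter> W = {}" "V = V' \<union> W" "E = insert (r, s) (insert (s, r) (E' \<union> F))"
    by (rule realises_NodeE)
  from realises.join[OF 1(1) Suc.IH[OF 1(2)] 1(3)] show ?case by (simp only: 1(4,5) spine.simps)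
qed

lemma card_realises: "realises V E r t \<Longrightarrow> card V = tree_order t"
proof (induction rule: realises.induct)
  case (join V E r ts W F s t)
  then show ?case
    using realises_basic(1)[OF join.hyps(1)] realises_basic(1)[OF join.hyps(2)]
    by (simp add: card_Un_disjoint)
qed simp

lemma card_leaves_realises:
  "realises V E r t \<Longrightarrow> card {v \<in> V - {r}. deg E v = 1} = nonroot_leaves t \<and>
     deg E r = length (case t of Node ts \<Rightarrow> ts)"
proof (induction rule: realises.induct)
  case (single r)
  then show ?case by simp
next
  case (join V E r ts W F s t)
  note V = realises_basic[OF join.hyps(1)] and W = realises_basic[OF join.hyps(2)]
  let ?E = "insert (r, s) (insert (s, r) (E \<union> F))"
  have rs: "r \<notin> W" "s \<notin> V" "r \<in> V" "s \<in> W" using V(2) W(2) join.hyps(3) by auto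
  have fin: "finite E" "finite F"
    by (rule realises_finite_arcs[OF join.hyps(1)], rule realises_finite_arcs[OF join.hyps(2)])
  have imE: "?E `` {v} = E `` {v}" if "v \<in> V - {r}" for v using that V(3) W(3) rs join.hyps(3) by auto
  have imF: "?E `` {v} = F `` {v}" if "v \<in> W - {s}" for v using that V(3) W(3) rs join.hyps(3) by auto
  have "?E `` {s} = insert r (F `` {s})" "?E `` {r} = insert s (E `` {r})"
    using V(3) W(3) rs join.hyps(3) by auto
  moreover have "r \<notin> F `` {s}" "s \<notin> E `` {r}" using V(3) W(3) rs by auto
  ultimately have deg_s: "deg ?E s = Suc (deg F s)" and deg_r: "deg ?E r = Suc (deg E r)"
    using fin by simp_all
  obtain us where t: "t = Node us" by (cases t)
  let ?A = "{v \<in> V - {r}. deg E v = 1}" and ?B = "{v \<in> W - {s}. deg F v = 1}"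
  have "{v \<in> (V \<union> W) - {r}. deg ?E v = 1} = ?A \<union> (?B \<union> (if us = [] then {s} else {}))"
  proof (rule Set.set_eqI)
    fix v
    consider "v \<in> V - {r}" | "v \<in> W - {s}" | "v = s" | "v = r" | "v \<notin> V \<union> W" by blast
    then show "v \<in> {v \<in> (V \<union> W) - {r}. deg ?E v = 1} \<longleftrightarrow> v \<in> ?A \<union> (?B \<union> (if us = [] then {s} else {}))"
    proof cases
      case 1
      then have "v \<notin> W" "v \<noteq> s" using join.hyps(3) rs by auto
      then show ?thesis using imE[OF 1] 1 by simp
    next
      case 2
      then have "v \<notin> V" "v \<noteq> r" using join.hyps(3) rs by auto
      then show ?thesis using imF[OF 2] 2 by simp
    next
      case 3
      then show ?thesis using deg_s join.IH(2) rs t by auto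
    qed (use rs in auto)
  qed
  moreover have "?A \<inter> (?B \<union> (if us = [] then {s} else {})) = {}" using join.hyps(3) rs by auto
  moreover have "?B \<inter> (if us = [] then {s} else {}) = {}" by auto
  ultimately have "card {v \<in> (V \<union> W) - {r}. deg ?E v = 1} = card ?A + (card ?B + (if us = [] then 1 else 0))"
    using V(1) W(1) by (simp add: card_Un_disjoint)
  then show ?case using join.IH deg_r t by simp
qed

lemma realises_iso:
  assumes "realises V E r t" "realises V' E' r' t"
  shows "\<exists>f. inj_on f V \<and> f ` V = V' \<and> f r = r' \<and> map_prod f f ` E = E'"
  using assms
proof (induction arbitrary: V' E' r')
  case (single r)
  then have "V' = {r'}" "E' = {}" by (auto elim: realises.cases)
  then show ?case by (intro exI[of _ "\<lambda>_. r'"]) auto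
next
  case (join V E r ts W F s t)
  note V = realises_basic[OF join.hyps(1)] and W = realises_basic[OF join.hyps(2)]
  obtain V'' E'' W' F' s' where 1: "realises V'' E'' r' (Node ts)" "realises W' F' s' t"
    "V'' \<inter> W' = {}" "V' = V'' \<union> W'" "E' = insert (r', s') (insert (s', r') (E'' \<union> F'))"
    using join.prems by (rule realises_NodeE)
  obtain f where f: "inj_on f V" "f ` V = V''" "f r = r'" "map_prod f f ` E = E''"
    using join.IH(1)[OF 1(1)] by blast
  obtain h where h: "inj_on h W" "h ` W = W'" "h s = s'" "map_prod h h ` F = F'"
    using join.IH(2)[OF 1(2)] by blast
  define k where "k = (\<lambda>x. if x \<in> V then f x else h x)"
  have kV: "k x = f x" if "x \<in> V" for x using that by (simp add: k_def)
  have kW: "k x = h x" if "x \<in> W" for x using that join.hyps(3) by (auto simp: k_def)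
  have im: "k ` V = V''" "k ` W = W'" using kV kW f(2) h(2) by (auto simp: image_iff)
  have "map_prod k k ` E = map_prod f f ` E"
    using V(3) kV by (intro image_cong) auto
  moreover have "map_prod k k ` F = map_prod h h ` F"
    using W(3) kW by (intro image_cong) auto
  moreover have "k r = r'" "k s = s'" using kV[OF V(2)] kW[OF W(2)] f h by auto
  ultimately have arcs: "map_prod k k ` insert (r, s) (insert (s, r) (E \<union> F)) = E'"
    using f(4) h(4) 1(5) by (simp add: image_Un)
  have "inj_on k V" "inj_on k W" using f(1) h(1) kV kW by (simp_all cong: inj_on_cong)
  then have "inj_on k (V \<union> W)"
    using im 1(3) by (intro inj_on_Un[THEN iffD2] conjI) auto
  then show ?case using arcs im \<open>k r = r'\<close> 1(4) by (intro exI[of _ k]) (auto simp: image_Un)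
qed

section \<open>Isomorphisms\<close>

lemma pair_wf_digraph_parcs: "pair_wf_digraph G \<Longrightarrow> parcs G \<subseteq> pverts G \<times> pverts G"
  using pair_wf_digraph.in_arcsD1 pair_wf_digraph.in_arcsD2 by fast

lemma digraph_isoI:
  assumes "pair_wf_digraph G" "inj_on f (pverts G)" "f ` pverts G = pverts H"
    "map_prod f f ` parcs G = parcs H"
  shows "digraph_iso (with_proj G) (with_proj H)"
proof -
  let ?h = "\<lparr>iso_verts = f, iso_arcs = map_prod f f, iso_head = snd, iso_tail = fst\<rparr>"
  have "inj_on (map_prod f f) (parcs G)"
    by (rule inj_on_subset[OF map_prod_inj_on[OF assms(2,2)] pair_wf_digraph_parcs[OF assms(1)]])
  then have "pre_digraph.digraph_isomorphism (with_proj G) ?h"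
    using assms by (auto simp: pre_digraph.digraph_isomorphism_def wf_digraph_wp_iff)
  moreover have "with_proj H = app_iso ?h (with_proj G)"
    using assms(3,4) by (simp add: app_iso_def with_proj_def)
  ultimately show ?thesis unfolding digraph_iso_def by blast
qed

lemma digraph_isoE:
  assumes "digraph_iso (with_proj G) (with_proj H)"
  obtains f where "pair_wf_digraph G" "inj_on f (pverts G)" "f ` pverts G = pverts H"
    "map_prod f f ` parcs G = parcs H"
proof -
  obtain h where h: "pre_digraph.digraph_isomorphism (with_proj G) h" "with_proj H = app_iso h (with_proj G)"
    using assms unfolding digraph_iso_def by blast
  then have eq: "pverts H = iso_verts h ` pverts G" "parcs H = iso_arcs h ` parcs G"
    "iso_head h = snd" "iso_tail h = fst"
    by (simp_all add: app_iso_def with_proj_def)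
  have "iso_arcs h e = map_prod (iso_verts h) (iso_verts h) e" if "e \<in> parcs G" for e
    using h(1) that eq(3,4) by (auto simp: pre_digraph.digraph_isomorphism_def map_prod_def intro: prod_eqI split: prod.splits)
  then have "map_prod (iso_verts h) (iso_verts h) ` parcs G = parcs H"
    using eq(2) by (metis image_cong)
  moreover have "pair_wf_digraph G" "inj_on (iso_verts h) (pverts G)"
    using h(1) by (auto simp: pre_digraph.digraph_isomorphism_def wf_digraph_wp_iff)
  ultimately show ?thesis using that eq(1) by blast
qed

lemma digraph_iso_lap_eq:
  assumes iso: "digraph_iso (with_proj G) (with_proj H)" and fin: "finite (pverts G)"
  shows "G \<approx>\<^sub>L H"
proof -
  obtain f where f: "pair_wf_digraph G" "inj_on f (pverts G)" "f ` pverts G = pverts H"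
    "map_prod f f ` parcs G = parcs H" using iso by (rule digraph_isoE)
  obtain vs where vs: "distinct vs" "set vs = pverts G" using finite_distinct_list[OF fin] by blast
  have arc: "(f x, f z) \<in> parcs H \<longleftrightarrow> (x, z) \<in> parcs G" if "x \<in> pverts G" "z \<in> pverts G" for x z
  proof
    assume "(f x, f z) \<in> parcs H"
    then obtain x' z' where "(x', z') \<in> parcs G" "f x = f x'" "f z = f z'" unfolding f(4)[symmetric] by auto
    moreover from this have "x' \<in> pverts G" "z' \<in> pverts G"
      using pair_wf_digraph_parcs[OF f(1)] by auto
    ultimately show "(x, z) \<in> parcs G" using f(2) that by (metis inj_onD)
  qed (use f(4) in force)
  have deg: "deg (parcs H) (f x) = deg (parcs G) x" if x: "x \<in> pverts G" for x
  proof -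
    have sub: "parcs G `` {x} \<subseteq> pverts G" using pair_wf_digraph_parcs[OF f(1)] by auto
    have "parcs H `` {f x} = f ` (parcs G `` {x})"
    proof (intro equalityI subsetI)
      fix w assume w: "w \<in> parcs H `` {f x}"
      then have "w \<in> f ` pverts G" using f(4) pair_wf_digraph_parcs[OF f(1)] by force
      then show "w \<in> f ` (parcs G `` {x})" using w arc[OF x] by auto
    next
      fix w assume "w \<in> f ` (parcs G `` {x})"
      then show "w \<in> parcs H `` {f x}" using sub arc[OF x] by auto
    qed
    then show ?thesis using inj_on_subset[OF f(2) sub] by (simp add: card_image)
  qed
  have in_vs: "vs ! i \<in> pverts G" if "i < length vs" for i using nth_mem[OF that] vs(2) by simp
  have "laplacian_wrt H (map f vs) = laplacian_wrt G vs"
  proof (rule eq_matI)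
    fix i j assume "i < dim_row (laplacian_wrt G vs)" "j < dim_col (laplacian_wrt G vs)"
    then have ij: "i < length vs" "j < length vs" using laplacian_wrt_carrier[of G vs] by auto
    then show "laplacian_wrt H (map f vs) $$ (i, j) = laplacian_wrt G vs $$ (i, j)"
      using in_vs[OF ij(1)] in_vs[OF ij(2)] by (simp add: laplacian_wrt_index out_degree_with_proj deg arc)
  qed (use laplacian_wrt_carrier[of G vs] laplacian_wrt_carrier[of H "map f vs"] in auto)
  moreover have "distinct (map f vs)" "set (map f vs) = pverts H"
    using vs f(2,3) by (simp_all add: distinct_map)
  ultimately have "char_poly (laplacian H) = char_poly (laplacian G)"
    using char_poly_laplacian[OF vs] char_poly_laplacian[of "map f vs" H] by simp
  moreover have "card (pverts H) = card (pverts G)" using f(2,3) by (metis card_image)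
  ultimately show ?thesis by (simp add: lap_eq_def lap_coeff_def)
qed

section \<open>The girth\<close>

lemma card_cycle_edges:
  assumes G: "pair_graph G" and C: "C \<in> cycles_of G"
  shows "3 \<le> card C"
proof -
  interpret pair_graph G by (rule G)
  obtain p where p: "cycle p" "3 \<le> length p" and C: "C = (\<lambda>(x, y). {x, y}) ` set p"
    using C by (auto simp: cycles_of_def)
  obtain a where a: "set p \<subseteq> parcs G" "pcas a p a" "distinct (tl (pawalk_verts a p))"
    using p(1) by (auto simp: cycle_def awalk_def)
  have heads: "pcas x q z \<Longrightarrow> tl (pawalk_verts x q) = map snd q" for x q z
  proof (induction q arbitrary: x)
    case (Cons e q)
    then show ?case by (cases q) auto
  qed simp
  obtain e1 e2 e3 q where q: "p = e1 # e2 # e3 # q"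
    using p(2) by (auto simp: numeral_3_eq_3 Suc_le_length_iff)
  obtain b c d where e: "e1 = (a, b)" "e2 = (b, c)" "e3 = (c, d)"
    using a(2) unfolding q by (cases e1; cases e2; cases e3) auto
  have dist: "distinct (map snd p)" using a(3) heads[OF a(2)] by simp
  then have bcd: "b \<noteq> c" "c \<noteq> d" "b \<noteq> d" by (auto simp: q e)
  have "a \<in> set (d # map snd q)"
  proof -
    have "pcas x q z \<Longrightarrow> z \<in> set (x # map snd q)" for x q and z :: 'a
      by (induction q arbitrary: x) auto
    moreover have "pcas d q a" using a(2) by (simp add: q e)
    ultimately show ?thesis by blast
  qed
  then have "a \<noteq> c" using dist by (auto simp: q e)
  moreover have "a \<noteq> b" using a(1) no_loops' by (auto simp: q e)
  ultimately have "card {{a, b}, {b, c}, {c, d}} = 3"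
    using bcd by (simp add: doubleton_eq_iff)
  moreover have "{{a, b}, {b, c}, {c, d}} \<subseteq> C" by (auto simp: C q e)
  moreover have "finite C" by (simp add: C)
  ultimately show ?thesis by (metis card_mono)
qed

lemma unicyclic_graphs_girth:
  assumes "G \<in> unicyclic_graphs n l g"
  shows "3 \<le> g"
proof -
  have G: "pair_graph G" "unicyclic G" "girth G = g" using assms by (auto simp: unicyclic_graphs_def)
  then obtain C where C: "C \<in> cycles_of G" "\<forall>D. D \<in> cycles_of G \<longrightarrow> D = C" unfolding unicyclic_def by metis
  then have "cycles_of G = {C}" by blast
  then have "girth G = card C" by (simp add: girth_def)
  then show ?thesis using card_cycle_edges[OF G(1) C(1)] G(3) by simp
qed

section \<open>Balanced starlike trees\<close>

definition path_arcs :: "nat \<Rightarrow> (nat \<times> nat) set" where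
  "path_arcs k = {(i, j). i \<le> k \<and> j \<le> k \<and> (j = Suc i \<or> i = Suc j)}"

lemma path_arcs_Suc: "path_arcs (Suc k) = insert (0, 1) (insert (1, 0) (map_prod Suc Suc ` path_arcs k))"
proof (rule Set.set_eqI)
  fix p :: "nat \<times> nat"
  obtain i j where p: "p = (i, j)" by (cases p)
  show "p \<in> path_arcs (Suc k) \<longleftrightarrow> p \<in> insert (0, 1) (insert (1, 0) (map_prod Suc Suc ` path_arcs k))"
    unfolding p by (cases i; cases j) (auto simp: path_arcs_def image_iff)
qed

lemma realises_spine_path:
  assumes "realises V E (f k) t" "inj_on f {..k}" "\<And>i. i < k \<Longrightarrow> f i \<notin> V"
  shows "realises (V \<union> f ` {..<k}) (E \<union> map_prod f f ` path_arcs k) (f 0) (spine k t)"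
  using assms
proof (induction k arbitrary: f)
  case 0
  have "path_arcs 0 = {}" by (auto simp: path_arcs_def)
  then show ?case using 0 by simp
next
  case (Suc k)
  have "inj_on (f \<circ> Suc) {..k}"
    by (rule comp_inj_on) (use Suc.prems(2) in \<open>auto simp: inj_on_def\<close>)
  with Suc.prems have IH: "realises (V \<union> (f \<circ> Suc) ` {..<k})
      (E \<union> map_prod (f \<circ> Suc) (f \<circ> Suc) ` path_arcs k) (f 1) (spine k t)"
    using Suc.IH[of "f \<circ> Suc"] by (simp add: comp_def)
  have "f 0 \<noteq> f (Suc i)" if "i < k" for i
    using inj_onD[OF Suc.prems(2), of 0 "Suc i"] that by auto
  then have "{f 0} \<inter> (V \<union> (f \<circ> Suc) ` {..<k}) = {}" using Suc.prems(3)[of 0] by auto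
  from realises.join[OF realises.single IH this]
  have "realises ({f 0} \<union> (V \<union> (f \<circ> Suc) ` {..<k})) (insert (f 0, f 1) (insert (f 1, f 0)
      ({} \<union> (E \<union> map_prod (f \<circ> Suc) (f \<circ> Suc) ` path_arcs k)))) (f 0) (Node [spine k t])" .
  moreover have "{f 0} \<union> (V \<union> (f \<circ> Suc) ` {..<k}) = V \<union> f ` {..<Suc k}"
    by (auto simp: lessThan_Suc_eq_insert_0)
  moreover have "insert (f 0, f 1) (insert (f 1, f 0)
      ({} \<union> (E \<union> map_prod (f \<circ> Suc) (f \<circ> Suc) ` path_arcs k))) = E \<union> map_prod f f ` path_arcs (Suc k)"
  proof -
    have "map_prod f f (map_prod Suc Suc e) = map_prod (f \<circ> Suc) (f \<circ> Suc) e" for e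
      by (cases e) simp
    then show ?thesis by (simp add: path_arcs_Suc image_image)
  qed
  ultimately show ?case by simp
qed

lemma path_tree_eq_spine: "path_tree k = spine k (Node [])"
  by (induction k) simp_all

lemma realises_path_tree:
  assumes "inj_on f {..k}"
  shows "realises (f ` {..k}) (map_prod f f ` path_arcs k) (f 0) (path_tree k)"
proof -
  have "realises ({f k} \<union> f ` {..<k}) ({} \<union> map_prod f f ` path_arcs k) (f 0) (spine k (Node []))"
    by (rule realises_spine_path[OF realises.single assms]) (use assms in \<open>force simp: inj_on_def\<close>)
  moreover have "{f k} \<union> f ` {..<k} = f ` {..k}" by (auto simp: lessThan_Suc_atMost[symmetric] lessThan_Suc)
  ultimately show ?thesis by (simp add: path_tree_eq_spine)
qed

lemma realises_starlike:
  assumes "\<And>j. j < l \<Longrightarrow> 2 \<le> a j"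
  shows "realises (pverts (starlike l a)) (parcs (starlike l a)) star_center
    (Node (map (\<lambda>j. path_tree (a j - 2)) (rev [0..<l])))"
proof -
  define f where "f = (\<lambda>(j, k). if k = (0::nat) then (0::nat, 0::nat) else (j, k))"
  have arcs: "parcs (starlike l a) = {(f (j, x), f (j, y)) | j x y. j < l \<and> (x, y) \<in> path_arcs (a j - 1)}"
  proof -
    have "parcs (path_graph (a j)) = path_arcs (a j - 1)" if "j < l" for j
      using assms[OF that] by (auto simp: path_graph_def path_arcs_def)
    then show ?thesis
      by (auto simp: starlike_def Let_def disj_union_def f_def[symmetric] image_iff) metis+
  qed
  have verts: "pverts (starlike l a) = insert (0, 0) (SIGMA j:{..<l}. {1..<a j})"
  proof -
    have "pverts (starlike l a) = insert (0, 0) (f ` (SIGMA j:{..<l}. {..<a j}))"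
      by (simp add: starlike_def disj_union_def path_graph_def Let_def f_def)
    also have "\<dots> = insert (0, 0) (SIGMA j:{..<l}. {1..<a j})"
    proof (intro equalityI subsetI)
      fix x assume "x \<in> insert (0, 0) (f ` (SIGMA j:{..<l}. {..<a j}))"
      then show "x \<in> insert (0, 0) (SIGMA j:{..<l}. {1..<a j})"
        by (auto simp: f_def split: if_splits)
    next
      fix x assume "x \<in> insert (0, 0) (SIGMA j:{..<l}. {1..<a j})"
      then show "x \<in> insert (0, 0) (f ` (SIGMA j:{..<l}. {..<a j}))"
        by (cases x) (auto simp: f_def intro!: image_eqI[of _ _ x])
    qed
    finally show ?thesis .
  qed
  have "realises (insert (0, 0) (SIGMA j:{..<m}. {1..<a j}))
    {(f (j, x), f (j, y)) | j x y. j < m \<and> (x, y) \<in> path_arcs (a j - 1)} (0, 0)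
    (Node (map (\<lambda>j. path_tree (a j - 2)) (rev [0..<m])))" if "m \<le> l" for m
    using that
  proof (induction m)
    case 0
    then show ?case using realises.single[of "(0::nat, 0::nat)"] by simp
  next
    case (Suc m)
    let ?V = "insert (0, 0) (SIGMA j:{..<m}. {1..<a j})"
    let ?E = "{(f (j, x), f (j, y)) | j x y. j < m \<and> (x, y) \<in> path_arcs (a j - 1)}"
    let ?h = "\<lambda>i. (m, Suc i)"
    have a: "2 \<le> a m" using assms[of m] Suc.prems by simp
    then obtain k where k: "a m = Suc (Suc k)" by (metis add_2_eq_Suc le_Suc_ex)
    have path: "realises (?h ` {..k}) (map_prod ?h ?h ` path_arcs k) (m, 1) (path_tree k)"
      using realises_path_tree[of ?h k] by (simp add: inj_on_def)
    have "realises (?V \<union> ?h ` {..k}) (insert ((0, 0), (m, 1)) (insert ((m, 1), (0, 0)) (?E \<union> map_prod ?h ?h ` path_arcs k)))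
      (0, 0) (Node (path_tree k # map (\<lambda>j. path_tree (a j - 2)) (rev [0..<m])))"
      by (rule realises.join[OF _ path]) (use Suc in auto)
    moreover have "?V \<union> ?h ` {..k} = insert (0, 0) (SIGMA j:{..<Suc m}. {1..<a j})"
    proof -
      have "?h ` {..k} = {m} \<times> {1..<a m}"
      proof (intro equalityI subsetI)
        fix x assume "x \<in> {m} \<times> {1..<a m}"
        then show "x \<in> ?h ` {..k}" using k by (cases x; cases "snd x") (auto intro!: image_eqI[of _ _ "snd x - 1"])
      qed (use k in auto)
      then show ?thesis by (auto simp: less_Suc_eq)
    qed
    moreover have "insert ((0, 0), (m, 1)) (insert ((m, 1), (0, 0)) (?E \<union> map_prod ?h ?h ` path_arcs k))
      = {(f (j, x), f (j, y)) | j x y. j < Suc m \<and> (x, y) \<in> path_arcs (a j - 1)}"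
    proof -
      have "{(f (m, x), f (m, y)) | x y. (x, y) \<in> path_arcs (a m - 1)}
        = (\<lambda>(x, y). (f (m, x), f (m, y))) ` path_arcs (Suc k)"
        by (simp add: k) (force simp: image_def)
      also have "\<dots> = insert ((0, 0), (m, 1)) (insert ((m, 1), (0, 0)) (map_prod ?h ?h ` path_arcs k))"
        by (simp add: path_arcs_Suc image_image f_def case_prod_beta map_prod_def)
      finally have m: "{(f (m, x), f (m, y)) | x y. (x, y) \<in> path_arcs (a m - 1)} = \<dots>" .
      have "{(f (j, x), f (j, y)) | j x y. j < Suc m \<and> (x, y) \<in> path_arcs (a j - 1)}
        = ?E \<union> {(f (m, x), f (m, y)) | x y. (x, y) \<in> path_arcs (a m - 1)}"
        unfolding less_Suc_eq by blast
      then show ?thesis unfolding m by auto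
    qed
    moreover have "map (\<lambda>j. path_tree (a j - 2)) (rev [0..<Suc m])
      = path_tree k # map (\<lambda>j. path_tree (a j - 2)) (rev [0..<m])" by (simp add: k)
    ultimately show ?case by simp
  qed
  from this[of l] show ?thesis by (simp add: verts arcs star_center_def)
qed

lemma two_values_mset:
  assumes "\<And>x. x \<in> set xs \<Longrightarrow> x = v \<or> x = Suc v"
  shows "\<exists>c\<le>length xs. mset xs = replicate_mset (length xs - c) v + replicate_mset c (Suc v) \<and>
    sum_list xs = length xs * v + c \<and> (v \<in> set xs \<longrightarrow> c < length xs)"
  using assms
proof (induction xs)
  case (Cons x xs)
  then obtain c where c: "c \<le> length xs" "mset xs = replicate_mset (length xs - c) v + replicate_mset c (Suc v)"
    "sum_list xs = length xs * v + c" "v \<in> set xs \<longrightarrow> c < length xs" by auto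
  have "x = v \<or> x = Suc v" using Cons.prems by simp
  then show ?case
  proof
    assume "x = v"
    then show ?thesis using c by (intro exI[of _ c]) (simp add: Suc_diff_le)
  next
    assume "x = Suc v"
    then show ?thesis using c by (intro exI[of _ "Suc c"]) auto
  qed
qed simp

lemma balanced_mset:
  assumes "balanced xs" "xs \<noteq> []"
  shows "mset xs = replicate_mset (length xs - sum_list xs mod length xs) (sum_list xs div length xs)
    + replicate_mset (sum_list xs mod length xs) (Suc (sum_list xs div length xs))"
proof -
  define v where "v = Min (set xs)"
  have v: "v \<in> set xs" using assms(2) by (simp add: v_def)
  have "x = v \<or> x = Suc v" if "x \<in> set xs" for x
  proof -
    have "v \<le> x" using that by (simp add: v_def)
    moreover have "x \<le> Suc v" using assms(1) that v by (simp add: balanced_def)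
    ultimately show ?thesis by linarith
  qed
  then obtain c where c: "mset xs = replicate_mset (length xs - c) v + replicate_mset c (Suc v)"
    "sum_list xs = length xs * v + c" "c < length xs" using two_values_mset[of xs v] v by blast
  have "sum_list xs div length xs = v" "sum_list xs mod length xs = c"
    using c(2,3) assms(2) by simp_all
  then show ?thesis using c(1) by simp
qed

lemma balanced_mset_unique:
  assumes "balanced xs" "balanced ys" "length xs = length ys" "sum_list xs = sum_list ys"
  shows "mset xs = mset ys"
proof (cases "xs = []")
  case False
  then have "ys \<noteq> []" using assms(3) by auto
  then show ?thesis using balanced_mset[OF assms(1) False] balanced_mset[OF assms(2)] assms(3,4) by simp
qed (use assms(3) in simp)

text \<open>The path with index \<open>j\<close> in \<open>BST m l\<close> has \<open>BST_leg m l j + 1\<close> vertices other than the centre.\<close>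

definition BST_leg :: "nat \<Rightarrow> nat \<Rightarrow> nat \<Rightarrow> nat" where
  "BST_leg m l j = (m - 1) div l - 1 + (if j < (m - 1) mod l then 1 else 0)"

lemma realises_BST:
  assumes "BST_params m l"
  shows "realises (pverts (BST m l)) (parcs (BST m l)) star_center
    (Node (map (\<lambda>j. path_tree (BST_leg m l j)) (rev [0..<l])))"
proof -
  define b where "b = m - 1"
  define a where "a = (\<lambda>j. if j < b mod l then nat \<lceil>real b / real l\<rceil> + 1 else nat \<lfloor>real b / real l\<rfloor> + 1)"
  have a: "2 \<le> a j \<and> a j - 2 = BST_leg m l j" if "j < l" for j
  proof -
    have l: "0 < l" "l \<le> b" using that assms by (auto simp: BST_params_def b_def)
    then have "1 \<le> b div l" by (simp add: Suc_le_eq div_greater_zero_iff)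
    moreover have "BST_leg m l j = b div l - 1 + (if j < b mod l then 1 else 0)"
      by (simp add: BST_leg_def b_def)
    ultimately show ?thesis using l
      by (auto simp: a_def nat_floor_of_nat_divide nat_ceiling_of_nat_divide)
  qed
  have legs: "map (\<lambda>j. path_tree (a j - 2)) (rev [0..<l]) = map (\<lambda>j. path_tree (BST_leg m l j)) (rev [0..<l])"
    using a by (intro map_cong) auto
  have "realises (pverts (starlike l a)) (parcs (starlike l a)) star_center
    (Node (map (\<lambda>j. path_tree (BST_leg m l j)) (rev [0..<l])))"
    unfolding legs[symmetric] by (rule realises_starlike) (use a in blast)
  then show ?thesis unfolding BST_def b_def[symmetric] a_def[symmetric] .
qed

lemma realises_path_BST:
  assumes "1 \<le> p" "BST_params (n - p + 1) l"
  shows "realises (pverts (path_BST n l p)) (parcs (path_BST n l p)) path_BST_root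
    (spine (p - 1) (Node (map (\<lambda>j. path_tree (BST_leg (n - p + 1) l j)) (rev [0..<l]))))"
proof -
  define f where "f = (\<lambda>w. if w = star_center then Inl (p - 1) else (Inr w :: nat + nat \<times> nat))"
  let ?B = "BST (n - p + 1) l" and ?t = "Node (map (\<lambda>j. path_tree (BST_leg (n - p + 1) l j)) (rev [0..<l]))"
  note B = realises_BST[OF assms(2)]
  have "inj_on f (pverts ?B)" by (auto simp: inj_on_def f_def)
  from realises_image[OF B this]
  have fB: "realises (f ` pverts ?B) (map_prod f f ` parcs ?B) (Inl (p - 1)) ?t" by (simp add: f_def)
  have "Inl i \<notin> f ` pverts ?B" if "i < p - 1" for i using that by (auto simp: f_def)
  from realises_spine_path[of _ _ Inl "p - 1", OF fB _ this]
  have "realises (f ` pverts ?B \<union> Inl ` {..<p - 1}) (map_prod f f ` parcs ?B \<union> map_prod Inl Inl ` path_arcs (p - 1))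
    (Inl 0) (spine (p - 1) ?t)" by simp
  moreover have path_BST: "path_BST n l p = \<lparr>pverts = Inl ` pverts (path_graph p) \<union> f ` pverts ?B,
      parcs = map_prod Inl Inl ` parcs (path_graph p) \<union> map_prod f f ` parcs ?B\<rparr>"
    unfolding path_BST_def identify_def Let_def f_def ..
  moreover have "f ` pverts ?B \<union> Inl ` {..<p - 1} = pverts (path_BST n l p)"
  proof -
    have "{..<p} = insert (p - 1) {..<p - 1}" using assms(1) by auto
    moreover have "Inl (p - 1) \<in> f ` pverts ?B" using realises_basic(2)[OF fB] .
    ultimately show ?thesis
      by (auto simp: path_BST path_graph_def)
  qed
  moreover have "map_prod f f ` parcs ?B \<union> map_prod Inl Inl ` path_arcs (p - 1) = parcs (path_BST n l p)"
  proof -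
    have "parcs (path_graph p) = path_arcs (p - 1)" using assms(1) by (auto simp: path_graph_def path_arcs_def)
    then show ?thesis by (simp add: path_BST Un_commute)
  qed
  ultimately show ?thesis by (simp only: path_BST_root_def)
qed

lemma tree_order_path_tree [simp]: "tree_order (path_tree k) = Suc k"
  by (induction k) simp_all

lemma leaf_count_path_tree [simp]: "leaf_count (path_tree k) = 1"
  by (induction k) simp_all

lemma canonical_order:
  assumes "canonical k qs t"
  shows "tree_order t = Suc (k + sum_list (map Suc qs))" "nonroot_leaves t = length qs"
proof -
  let ?s = "Node (map path_tree qs)"
  have t: "t = spine k ?s" using assms by (simp add: canonical_def)
  have "tree_order ?s = Suc (sum_list (map Suc qs))" by (simp add: comp_def)
  then show "tree_order t = Suc (k + sum_list (map Suc qs))"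
    unfolding t by (induction k) simp_all
  have leaves: "nonroot_leaves ?s = length qs" by (simp add: comp_def sum_list_triv)
  show "nonroot_leaves t = length qs"
  proof (cases k)
    case (Suc k')
    then have "qs \<noteq> []" using assms by (auto simp: canonical_def)
    then have "leaf_count (spine k' ?s) = length qs" by (induction k') (simp_all add: comp_def sum_list_triv)
    then show ?thesis using Suc t by simp
  qed (use leaves t in simp)
qed

lemma canonical_path_BST:
  assumes "canonical k qs t" "n = tree_order t" "l = nonroot_leaves t"
  shows "Suc k \<le> n" "BST_params (n - Suc k + 1) l"
    "realises (pverts (path_BST n l (Suc k))) (parcs (path_BST n l (Suc k))) path_BST_root t"
proof -
  note o = canonical_order[OF assms(1)]
  define m where "m = n - Suc k + 1"
  have n: "n = Suc (k + sum_list (map Suc qs))" and l: "l = length qs" using o assms(2,3) by simp_all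
  then have m: "m - 1 = sum_list (map Suc qs)" "1 \<le> m" by (simp_all add: m_def)
  have sum: "sum_list (map Suc qs) = length qs + sum_list qs" by (induction qs) simp_all
  show "Suc k \<le> n" using n by simp
  show params: "BST_params (n - Suc k + 1) l"
    using m sum l unfolding m_def[symmetric] BST_params_def by (cases qs) auto
  let ?ys = "map (BST_leg m l) (rev [0..<l])"
  have "sum_list ?ys = sum_list qs"
  proof (cases "l = 0")
    case False
    let ?q = "(m - 1) div l" and ?r = "(m - 1) mod l"
    have q: "1 \<le> ?q" using m sum l False by (simp add: Suc_le_eq div_greater_zero_iff)
    have "sum_list ?ys = (\<Sum>j<l. BST_leg m l j)"
      by (simp add: rev_map[symmetric] sum_list_rev interv_sum_list_conv_sum_set_nat atLeast0LessThan)
    also have "\<dots> = (\<Sum>j<l. ?q - 1) + (\<Sum>j<l. if j < ?r then 1 else 0)"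
      by (simp add: BST_leg_def sum.distrib)
    also have "(\<Sum>j<l. if j < ?r then 1 else 0) = card ({..<l} \<inter> {j. j < ?r})"
      by (simp add: sum.If_cases)
    also have "{..<l} \<inter> {j. j < ?r} = {..<?r}"
      using less_trans[OF _ mod_less_divisor[of l "m - 1"]] False by blast
    finally have "sum_list ?ys = l * (?q - 1) + ?r" by simp
    moreover have "l * ?q + ?r = l + sum_list qs" unfolding mult_div_mod_eq m(1) sum l ..
    moreover have "l * ?q = l * (?q - 1) + l" using q by (simp add: algebra_simps)
    ultimately show ?thesis by linarith
  qed (use l in simp)
  moreover have "balanced ?ys" by (auto simp: balanced_def BST_leg_def)
  moreover have "balanced qs" using assms(1) by (simp add: canonical_def)
  ultimately have "mset ?ys = mset qs" using l by (intro balanced_mset_unique) simp_all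
  then have ys: "mset (map path_tree ?ys) = mset (map path_tree qs)" unfolding mset_map by simp
  have "realises (pverts (path_BST n l (Suc k))) (parcs (path_BST n l (Suc k))) path_BST_root
    (spine k (Node (map path_tree ?ys)))"
    using realises_path_BST[of "Suc k" n l] params by (simp add: m_def comp_def)
  from realises_spine_mset[OF this ys]
  show "realises (pverts (path_BST n l (Suc k))) (parcs (path_BST n l (Suc k))) path_BST_root t"
    using assms(1) by (simp only: canonical_def)
qed

lemma cycle_of_eq_lap_coeff:
  assumes "3 \<le> g" "\<And>i. i < g \<Longrightarrow> realises (pverts (T i)) (parcs (T i)) (u i) (t i)"
  defines "C \<equiv> cycle_attach g T u"
  shows "finite (pverts C)" "card (pverts C) = (\<Sum>i<g. tree_order (t i))"
    "cycle_of (map t [0..<g]) = (\<Sum>k\<le>card (pverts C). monom (lap_coeff C k) (card (pverts C) - k))"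
proof -
  have fin: "finite (pverts (T i))" "card (pverts (T i)) = tree_order (t i)" if "i < g" for i
    using realises_basic(1)[OF assms(2)] card_realises[OF assms(2)] that by auto
  show "finite (pverts C)" using fin by (auto simp: C_def pverts_cycle_attach)
  show "card (pverts C) = (\<Sum>i<g. tree_order (t i))"
    using fin by (simp add: C_def pverts_cycle_attach)
  show "cycle_of (map t [0..<g]) = (\<Sum>k\<le>card (pverts C). monom (lap_coeff C k) (card (pverts C) - k))"
    by (rule coeff_eq_lap_coeff[OF \<open>finite (pverts C)\<close>])
      (use det_on_cycle_attach[OF assms(1) _ assms(2)] C_def in simp)
qed

lemma coeff_sum_monom_diff:
  assumes "k \<le> n"
  shows "coeff (\<Sum>j\<le>n. monom (c j :: real) (n - j)) (n - k) = c k"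
proof -
  have "coeff (\<Sum>j\<le>n. monom (c j) (n - j)) (n - k) = (\<Sum>j\<le>n. if j = k then c j else 0)"
    unfolding coeff_sum by (rule sum.cong) (use assms in auto)
  then show ?thesis using assms by simp
qed

lemma cycle_attach_iso:
  assumes "\<And>i. i < g \<Longrightarrow> realises (pverts (S i)) (parcs (S i)) (w i) (t i)"
    and "\<And>i. i < g \<Longrightarrow> realises (pverts (T i)) (parcs (T i)) (u i) (t i)"
  shows "digraph_iso (with_proj (cycle_attach g S w)) (with_proj (cycle_attach g T u))"
proof -
  let ?C = "cycle_attach g S w" and ?D = "cycle_attach g T u"
  have "\<exists>f. inj_on f (pverts (S i)) \<and> f ` pverts (S i) = pverts (T i) \<and> f (w i) = u i \<and>
      map_prod f f ` parcs (S i) = parcs (T i)" if "i < g" for i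
    using realises_iso[OF assms(1)[OF that] assms(2)[OF that]] .
  then obtain f where f: "\<And>i. i < g \<Longrightarrow> inj_on (f i) (pverts (S i))"
    "\<And>i. i < g \<Longrightarrow> f i ` pverts (S i) = pverts (T i)" "\<And>i. i < g \<Longrightarrow> f i (w i) = u i"
    "\<And>i. i < g \<Longrightarrow> map_prod (f i) (f i) ` parcs (S i) = parcs (T i)" by metis
  have sub: "parcs (S i) \<subseteq> pverts (S i) \<times> pverts (S i)" "w i \<in> pverts (S i)" if "i < g" for i
    using realises_basic(2,3)[OF assms(1)[OF that]] by auto
  define h where "h = (\<lambda>(i, x). (i, f i x))"
  show ?thesis
  proof (rule digraph_isoI)
    have "parcs ?C \<subseteq> pverts ?C \<times> pverts ?C"
      using sub by (fastforce simp: parcs_cycle_attach pverts_cycle_attach cyclic_def)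
    then show "pair_wf_digraph ?C" by unfold_locales auto
    show "inj_on h (pverts ?C)"
      using f(1) by (auto simp: inj_on_def h_def pverts_cycle_attach)
    show "h ` pverts ?C = pverts ?D"
    proof (intro equalityI subsetI)
      fix q assume "q \<in> pverts ?D"
      then obtain i y where q: "q = (i, y)" "i < g" "y \<in> f i ` pverts (S i)"
        using f(2) by (auto simp: pverts_cycle_attach)
      then show "q \<in> h ` pverts ?C" by (auto simp: h_def pverts_cycle_attach image_iff)
    qed (use f(2) in \<open>auto simp: h_def pverts_cycle_attach\<close>)
    show "map_prod h h ` parcs ?C = parcs ?D"
    proof (intro equalityI subsetI)
      fix e assume "e \<in> map_prod h h ` parcs ?C"
      then obtain i x j y where e: "e = ((i, f i x), (j, f j y))" "((i, x), (j, y)) \<in> parcs ?C"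
        by (auto simp: h_def)
      then have "i = j \<and> i < g \<and> (f i x, f i y) \<in> parcs (T i) \<or>
          cyclic g i j \<and> x = w i \<and> y = w j"
        using f(4) by (force simp: parcs_cycle_attach)
      then show "e \<in> parcs ?D"
        unfolding e(1) using f(3) by (auto simp: parcs_cycle_attach cyclic_def)
    next
      fix e assume "e \<in> parcs ?D"
      moreover obtain i x j y where e: "e = ((i, x), (j, y))" by (metis surj_pair)
      ultimately consider "i = j" "i < g" "(x, y) \<in> parcs (T i)" | "cyclic g i j" "x = u i" "y = u j"
        by (auto simp: parcs_cycle_attach)
      then show "e \<in> map_prod h h ` parcs ?C"
      proof cases
        case 1
        then have "(x, y) \<in> map_prod (f i) (f i) ` parcs (S i)" using f(4) by simp
        then obtain x' y' where "x = f i x'" "y = f i y'" "(x', y') \<in> parcs (S i)" by auto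
        then show ?thesis using 1 e
          by (intro image_eqI[of _ _ "((i, x'), (i, y'))"]) (auto simp: h_def parcs_cycle_attach)
      next
        case 2
        then show ?thesis using f(3) e
          by (intro image_eqI[of _ _ "((i, w i), (j, w j))"]) (auto simp: h_def parcs_cycle_attach cyclic_def)
      qed
    qed
  qed
qed

theorem theorem2p5:
  fixes T :: "nat \<Rightarrow> 'a pair_pre_digraph" and u :: "nat \<Rightarrow> 'a"
    and n l g :: nat and ns ls :: "nat \<Rightarrow> nat"
  assumes trees: "\<And>i. i < g \<Longrightarrow> is_tree (T i)"
    and roots: "\<And>i. i < g \<Longrightarrow> u i \<in> pverts (T i)"
    and G: "cycle_attach g T u \<in> unicyclic_graphs n l g"
    and ns: "\<And>i. i < g \<Longrightarrow> ns i = card (pverts (T i))"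
    and ls: "\<And>i. i < g \<Longrightarrow> ls i = card {v \<in> pverts (T i). (i, v) \<in> leaves (cycle_attach g T u)}"
  shows "\<exists>p :: nat \<Rightarrow> nat.
    (\<forall>i<g. 1 \<le> p i \<and> p i \<le> ns i \<and> BST_params (ns i - p i + 1) (ls i)) \<and>
    card {i. i < g \<and> p i \<noteq> 1} \<le> 1 \<and>
    (let C\<^sub>B = cycle_attach g (\<lambda>i. path_BST (ns i) (ls i) (p i)) (\<lambda>i. path_BST_root);
         C\<^sub>T = cycle_attach g T u
     in C\<^sub>B \<preceq>\<^sub>L C\<^sub>T \<and>
        (C\<^sub>B \<approx>\<^sub>L C\<^sub>T \<longleftrightarrow> digraph_iso (with_proj C\<^sub>B) (with_proj C\<^sub>T)))"
proof -
  have g: "3 \<le> g" using G by (rule unicyclic_graphs_girth)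
  have "\<forall>i. \<exists>t. i < g \<longrightarrow> realises (pverts (T i)) (parcs (T i)) (u i) t"
    using is_tree_imp_realises trees roots by metis
  then obtain t where t: "\<And>i. i < g \<Longrightarrow> realises (pverts (T i)) (parcs (T i)) (u i) (t i)" by metis
  define ts where "ts = map t [0..<g]"
  have len: "length ts = g" by (simp add: ts_def)
  obtain us ks qss where us: "same_shape ts us" "us = ts \<or> pos_coeffs (cycle_of ts - cycle_of us)"
    and can: "\<And>i. i < g \<Longrightarrow> canonical (ks i) (qss i) (us ! i)"
    and unique: "\<And>i j. i < g \<Longrightarrow> j < g \<Longrightarrow> 0 < ks i \<Longrightarrow> 0 < ks j \<Longrightarrow> i = j"
    using exists_canonical_minorant[of ts] g unfolding len by auto
  have len_us: "length us = g" using us(1) len by (metis same_shape_def length_map)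
  have stats: "tree_order (us ! i) = ns i" "nonroot_leaves (us ! i) = ls i" if i: "i < g" for i
  proof -
    have "map tree_order ts ! i = map tree_order us ! i" "map nonroot_leaves ts ! i = map nonroot_leaves us ! i"
      using us(1) by (simp_all add: same_shape_def)
    then have *: "tree_order (us ! i) = tree_order (t i)" "nonroot_leaves (us ! i) = nonroot_leaves (t i)"
      using i len len_us by (simp_all add: ts_def)
    show "tree_order (us ! i) = ns i" using * card_realises[OF t[OF i]] ns[OF i] by simp
    have "{v \<in> pverts (T i). (i, v) \<in> leaves (cycle_attach g T u)}
      = {v \<in> pverts (T i) - {u i}. deg (parcs (T i)) v = 1}"
      using i deg_cycle_attach[of g i T u, OF g i realises_finite_arcs[OF t[OF i]]]
      by (auto simp: leaves_def pverts_cycle_attach out_degree_with_proj split: if_splits)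
    then show "nonroot_leaves (us ! i) = ls i"
      using * card_leaves_realises[OF t[OF i]] ls[OF i] by simp
  qed
  define p where "p = (\<lambda>i. Suc (ks i))"
  define CB where "CB = cycle_attach g (\<lambda>i. path_BST (ns i) (ls i) (p i)) (\<lambda>i. path_BST_root)"
  define CT where "CT = cycle_attach g T u"
  have B: "realises (pverts (path_BST (ns i) (ls i) (p i))) (parcs (path_BST (ns i) (ls i) (p i))) path_BST_root (us ! i)"
    and p: "1 \<le> p i \<and> p i \<le> ns i \<and> BST_params (ns i - p i + 1) (ls i)" if "i < g" for i
    using canonical_path_BST[OF can[OF that] stats(1)[OF that, symmetric] stats(2)[OF that, symmetric]]
    by (simp_all add: p_def)
  have "card {i. i < g \<and> p i \<noteq> 1} \<le> 1"
  proof -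
    have "{i. i < g \<and> p i \<noteq> 1} \<subseteq> {i}" if "i < g" "0 < ks i" for i
      using unique that by (auto simp: p_def)
    then have "\<exists>i. {i. i < g \<and> p i \<noteq> 1} \<subseteq> {i}" by (cases "\<exists>i<g. 0 < ks i") (auto simp: p_def)
    then show ?thesis by (metis card_mono card.insert card.empty finite.intros equals0D One_nat_def)
  qed
  moreover have "CB \<preceq>\<^sub>L CT \<and> (CB \<approx>\<^sub>L CT \<longleftrightarrow> digraph_iso (with_proj CB) (with_proj CT))"
  proof -
    note cB = cycle_of_eq_lap_coeff[of g "\<lambda>i. path_BST (ns i) (ls i) (p i)" "\<lambda>i. path_BST_root" "\<lambda>i. us ! i", OF g B, folded CB_def]
    note cT = cycle_of_eq_lap_coeff[of g T u t, OF g t, folded CT_def ts_def]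
    have "map (\<lambda>i. us ! i) [0..<g] = us" using len_us map_nth[of us] by simp
    note cB = cB[unfolded this]
    define N where "N = card (pverts CT)"
    have "tree_order (us ! i) = tree_order (t i)" if "i < g" for i
      using stats(1)[OF that] ns[OF that] card_realises[OF t[OF that]] by simp
    then have N: "card (pverts CB) = N" "card (pverts CT) = N" using cB(2) cT(2) by (simp_all add: N_def)
    have coeffs: "coeff (cycle_of us) (N - k) = lap_coeff CB k" "coeff (cycle_of ts) (N - k) = lap_coeff CT k"
      if "k \<le> N" for k
      using coeff_sum_monom_diff[OF that] cB(3) cT(3) N by simp_all
    have iso_eq: "CB \<approx>\<^sub>L CT" if "digraph_iso (with_proj CB) (with_proj CT)"
      using digraph_iso_lap_eq[OF that cB(1)] .
    show ?thesis
    proof (cases "us = ts")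
      case True
      have "us ! i = t i" if "i < g" for i using True that by (simp add: ts_def)
      then have "digraph_iso (with_proj CB) (with_proj CT)"
        unfolding CB_def CT_def using B t by (intro cycle_attach_iso[where t = t]) auto
      then show ?thesis using iso_eq by (auto simp: lap_le_def lap_eq_def)
    next
      case False
      then have diff: "pos_coeffs (cycle_of ts - cycle_of us)" using us(2) by simp
      have "lap_coeff CB k \<le> lap_coeff CT k" if "k \<le> N" for k
        using diff coeffs[OF that, symmetric] by (simp add: pos_coeffs_def nonneg_coeffs_def)
      then have "CB \<preceq>\<^sub>L CT" by (simp add: lap_le_def N)
      moreover have "\<not> CB \<approx>\<^sub>L CT"
      proof
        assume "CB \<approx>\<^sub>L CT"
        then have "(\<Sum>k\<le>N. monom (lap_coeff CB k) (N - k)) = (\<Sum>k\<le>N. monom (lap_coeff CT k) (N - k))"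
          by (intro sum.cong) (simp_all add: lap_eq_def N)
        then have "cycle_of us = cycle_of ts" using cB(3) cT(3) N by simp
        then show False using diff by (simp add: pos_coeffs_def)
      qed
      ultimately show ?thesis using iso_eq by blast
    qed
  qed
  ultimately show ?thesis using p unfolding Let_def CB_def CT_def by blast
qed

end
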